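(* There is a polynomial-time algorithm that solves the clustering problem without replication exactly for cluster capacity $M=2$, unit vertex weights and zero vertex delays, when the underlying simple graph of the input DAG $G$ is a tree.
   Context: Clustering problem: given a directed acyclic graph $G=(V,E)$, an intra-cluster delay $d$, an inter-cluster delay $D>d$ and capacity $M=2$, partition $V$ into pairwise disjoint clusters of at most $2$ vertices each, minimizing the delay of the network. Given a clustering, an arc $(u,v)$ has delay $d$ if $u,v$ lie in the same cluster and $D$ otherwise; the delay of a directed path is the sum of its arc delays; the delay of the network is the maximum delay of a directed path from a source (in-degree $0$ vertex) to a sink (out-degree $0$ vertex). *)

theory Defs
  imports
    "Graph_Theory.Graph_Theory"
    "HOL-Library.Disjoint_Sets"
    "HOL-Computational_Algebra.Polynomial"
begin

section \<open>A machine model for polynomial time\<close>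

text \<open>
  Programs are systems of mutually recursive first-order functions over unlabelled binary trees,
  evaluated call-by-value; this is the functional language F of N. Jones (Computability and
  Complexity from a Programming Perspective), with several functions of several arguments.
  Every elementary operation costs one step. There is no unit-cost equality test on trees, only a
  test for being a leaf, so that with trees stored as shared pointer structures each step is a
  constant number of pointer operations. Hence running time in this model and running time on
  Turing machines are polynomially related.
\<close>

datatype btree = Leaf | Node btree btree

fun left :: "btree \<Rightarrow> btree" where
  "left Leaf = Leaf"
| "left (Node l r) = l"

fun right :: "btree \<Rightarrow> btree" where
  "right Leaf = Leaf"
| "right (Node l r) = r"

datatype expr =
    Var nat
  | LeafE
  | NodeE expr expr
  | LeftE expr
  | RightE expr
  | IfE expr expr expr
  | Call nat "expr list"

text \<open>
  A program is the list of its function bodies. In the body of a function, \<open>Var i\<close> is the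
  \<open>i\<close>-th argument. A reference to a missing argument or function gets stuck.
\<close>

type_synonym program = "expr list"

text \<open>
  \<open>eval P env e v t\<close>: in the environment \<open>env\<close>, the expression \<open>e\<close> evaluates to \<open>v\<close> in exactly
  \<open>t\<close> steps. \<open>IfE\<close> takes its first branch iff the condition is not a leaf.
\<close>

inductive eval :: "program \<Rightarrow> btree list \<Rightarrow> expr \<Rightarrow> btree \<Rightarrow> nat \<Rightarrow> bool"
  and evals :: "program \<Rightarrow> btree list \<Rightarrow> expr list \<Rightarrow> btree list \<Rightarrow> nat \<Rightarrow> bool"
  for P :: program where
  eval_Var: "i < length env \<Longrightarrow> eval P env (Var i) (env ! i) 1"
| eval_Leaf: "eval P env LeafE Leaf 1"
| eval_Node: "eval P env a u s \<Longrightarrow> eval P env b v t \<Longrightarrow>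
    eval P env (NodeE a b) (Node u v) (Suc (s + t))"
| eval_Left: "eval P env a u s \<Longrightarrow> eval P env (LeftE a) (left u) (Suc s)"
| eval_Right: "eval P env a u s \<Longrightarrow> eval P env (RightE a) (right u) (Suc s)"
| eval_IfTrue: "eval P env c w s \<Longrightarrow> w \<noteq> Leaf \<Longrightarrow> eval P env a v t \<Longrightarrow>
    eval P env (IfE c a b) v (Suc (s + t))"
| eval_IfFalse: "eval P env c Leaf s \<Longrightarrow> eval P env b v t \<Longrightarrow>
    eval P env (IfE c a b) v (Suc (s + t))"
| eval_Call: "f < length P \<Longrightarrow> evals P env es vs s \<Longrightarrow> eval P vs (P ! f) v t \<Longrightarrow>
    eval P env (Call f es) v (Suc (s + t))"
| evals_Nil: "evals P env [] [] 0"
| evals_Cons: "eval P env e v s \<Longrightarrow> evals P env es vs t \<Longrightarrow>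
    evals P env (e # es) (v # vs) (s + t)"

inductive_cases eval_VarE: "eval P env (Var i) v t"
inductive_cases eval_LeafE: "eval P env LeafE v t"
inductive_cases eval_NodeE: "eval P env (NodeE a b) v t"
inductive_cases eval_LeftE: "eval P env (LeftE a) v t"
inductive_cases eval_RightE: "eval P env (RightE a) v t"
inductive_cases eval_IfE: "eval P env (IfE c a b) v t"
inductive_cases eval_CallE: "eval P env (Call f es) v t"
inductive_cases evals_NilE: "evals P env [] vs t"
inductive_cases evals_ConsE: "evals P env (e # es) vs t"

lemma eval_evals_deterministic:
  "eval P env e v t \<Longrightarrow> (\<forall>v' t'. eval P env e v' t' \<longrightarrow> v' = v \<and> t' = t)"
  "evals P env es vs t \<Longrightarrow> (\<forall>vs' t'. evals P env es vs' t' \<longrightarrow> vs' = vs \<and> t' = t)"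
proof (induction rule: eval_evals.inducts)
  case eval_Var then show ?case by (intro allI impI) (erule eval_VarE; simp)
next
  case eval_Leaf then show ?case by (intro allI impI) (erule eval_LeafE; simp)
next
  case eval_Node then show ?case by (intro allI impI) (erule eval_NodeE; blast)
next
  case eval_Left then show ?case by (intro allI impI) (erule eval_LeftE; blast)
next
  case eval_Right then show ?case by (intro allI impI) (erule eval_RightE; blast)
next
  case eval_IfTrue then show ?case by (intro allI impI) (erule eval_IfE; blast)
next
  case eval_IfFalse then show ?case by (intro allI impI) (erule eval_IfE; blast)
next
  case eval_Call then show ?case by (intro allI impI) (erule eval_CallE; blast)
next
  case evals_Nil then show ?case by (intro allI impI) (erule evals_NilE; blast)
next
  case evals_Cons then show ?case by (intro allI impI) (erule evals_ConsE; blast)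
qed

text \<open>The function at index 0 is the main function; it receives the input as its only argument.\<close>

definition runs :: "program \<Rightarrow> btree \<Rightarrow> btree \<Rightarrow> nat \<Rightarrow> bool" where
  "runs P x y t \<longleftrightarrow> P \<noteq> [] \<and> eval P [x] (P ! 0) y t"

text \<open>
  Search problems: every valid instance \<open>x\<close> must be mapped to (the code of) some solution of \<open>x\<close>,
  in time polynomial in the size of the code of \<open>x\<close>.
\<close>

definition poly_time_solvable ::
  "('i \<Rightarrow> btree) \<Rightarrow> ('o \<Rightarrow> btree) \<Rightarrow> ('i \<Rightarrow> bool) \<Rightarrow> ('i \<Rightarrow> 'o \<Rightarrow> bool) \<Rightarrow> bool" where
  "poly_time_solvable enc_in enc_out valid solution \<longleftrightarrow>
    (\<exists>(P :: program) (q :: nat poly). \<forall>x. valid x \<longrightarrow>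
      (\<exists>y t. runs P (enc_in x) (enc_out y) t \<and> t \<le> poly q (size (enc_in x)) \<and> solution x y))"


section \<open>Encodings\<close>

definition enc_bool :: "bool \<Rightarrow> btree" where
  "enc_bool b = (if b then Node Leaf Leaf else Leaf)"

text \<open>Binary notation, least significant bit first, without leading zeros.\<close>

fun enc_nat :: "nat \<Rightarrow> btree" where
  "enc_nat n = (if n = 0 then Leaf else Node (enc_bool (odd n)) (enc_nat (n div 2)))"

declare enc_nat.simps [simp del]

definition enc_prod :: "('a \<Rightarrow> btree) \<Rightarrow> ('b \<Rightarrow> btree) \<Rightarrow> 'a \<times> 'b \<Rightarrow> btree" where
  "enc_prod f g p = Node (f (fst p)) (g (snd p))"

primrec enc_list :: "('a \<Rightarrow> btree) \<Rightarrow> 'a list \<Rightarrow> btree" where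
  "enc_list f [] = Leaf"
| "enc_list f (x # xs) = Node (f x) (enc_list f xs)"

text \<open>For nonnegative rationals: numerator and denominator of the reduced fraction.\<close>

definition enc_rat :: "rat \<Rightarrow> btree" where
  "enc_rat r = (case quotient_of r of (a, b) \<Rightarrow> Node (enc_nat (nat a)) (enc_nat (nat b)))"

lemma enc_nat_inject: "enc_nat m = enc_nat n \<Longrightarrow> m = n"
proof (induction m arbitrary: n rule: less_induct)
  case (less m)
  show ?case
  proof (cases "m = 0 \<or> n = 0")
    case True
    then show ?thesis
      using less.prems by (auto simp: enc_nat.simps[of m] enc_nat.simps[of n] split: if_splits)
  next
    case False
    then have "odd m = odd n" "enc_nat (m div 2) = enc_nat (n div 2)"
      using less.prems
      by (auto simp: enc_nat.simps[of m] enc_nat.simps[of n] enc_bool_def split: if_splits)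
    moreover from this have "m div 2 = n div 2"
      using less.IH[of "m div 2"] False by simp
    ultimately show ?thesis
      by (metis bit_eq_rec)
  qed
qed

lemma inj_enc_nat: "inj enc_nat"
  by (simp add: enc_nat_inject injI)

lemma inj_enc_list: "inj f \<Longrightarrow> inj (enc_list f)"
proof (rule injI)
  fix xs ys assume "inj f" "enc_list f xs = enc_list f ys"
  then show "xs = ys"
  proof (induction xs arbitrary: ys)
    case Nil then show ?case by (cases ys) auto
  next
    case (Cons x xs) then show ?case by (cases ys) (auto dest: injD)
  qed
qed


section \<open>Clustering without replication\<close>

definition dag :: "'a pair_pre_digraph \<Rightarrow> bool" where
  "dag G \<longleftrightarrow> pair_fin_digraph G \<and> \<not> (\<exists>p. pre_digraph.cycle (with_proj G) p)"

text \<open>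
  \<open>mk_symmetric\<close> represents the underlying simple graph by a symmetric digraph, in which every edge
  yields a closed walk of length 2 that counts as a \<open>cycle\<close>; the cycles of the undirected graph are
  those of length at least 3. The constant \<open>tree\<close> of the library only excludes directed cycles.
\<close>

definition underlying_tree :: "'a pair_pre_digraph \<Rightarrow> bool" where
  "underlying_tree G \<longleftrightarrow> connected (with_proj G) \<and>
    \<not> (\<exists>p. pre_digraph.cycle (with_proj (mk_symmetric (with_proj G))) p \<and> 3 \<le> length p)"

text \<open>All vertices have weight 1, so the weight of a cluster is its cardinality.\<close>

definition clustering :: "nat \<Rightarrow> 'a pair_pre_digraph \<Rightarrow> 'a set set \<Rightarrow> bool" where
  "clustering M G \<C> \<longleftrightarrow> partition_on (pverts G) \<C> \<and> (\<forall>C\<in>\<C>. card C \<le> M)"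

definition arc_delay :: "rat \<Rightarrow> rat \<Rightarrow> 'a set set \<Rightarrow> 'a \<times> 'a \<Rightarrow> rat" where
  "arc_delay d D \<C> e = (if \<exists>C\<in>\<C>. fst e \<in> C \<and> snd e \<in> C then d else D)"

definition path_delay :: "rat \<Rightarrow> rat \<Rightarrow> 'a set set \<Rightarrow> ('a \<times> 'a) awalk \<Rightarrow> rat" where
  "path_delay d D \<C> p = (\<Sum>e\<leftarrow>p. arc_delay d D \<C> e)"

definition source_sink_path :: "'a pair_pre_digraph \<Rightarrow> ('a \<times> 'a) awalk \<Rightarrow> bool" where
  "source_sink_path G p \<longleftrightarrow> (\<exists>u v. pre_digraph.apath (with_proj G) u p v \<and>
     in_degree (with_proj G) u = 0 \<and> out_degree (with_proj G) v = 0)"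

definition network_delay :: "'a pair_pre_digraph \<Rightarrow> rat \<Rightarrow> rat \<Rightarrow> 'a set set \<Rightarrow> rat" where
  "network_delay G d D \<C> = Max {path_delay d D \<C> p | p. source_sink_path G p}"

definition optimal_clustering ::
  "nat \<Rightarrow> 'a pair_pre_digraph \<Rightarrow> rat \<Rightarrow> rat \<Rightarrow> 'a set set \<Rightarrow> bool" where
  "optimal_clustering M G d D \<C> \<longleftrightarrow> clustering M G \<C> \<and>
     (\<forall>\<C>'. clustering M G \<C>' \<longrightarrow> network_delay G d D \<C> \<le> network_delay G d D \<C>')"

text \<open>
  An instance lists the vertices (arbitrary natural numbers) and the arcs of the digraph, in any
  order, followed by the intra-cluster delay and the inter-cluster delay.
\<close>

type_synonym cluster_instance = "nat list \<times> (nat \<times> nat) list \<times> rat \<times> rat"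

definition enc_instance :: "cluster_instance \<Rightarrow> btree" where
  "enc_instance = enc_prod (enc_list enc_nat)
     (enc_prod (enc_list (enc_prod enc_nat enc_nat)) (enc_prod enc_rat enc_rat))"

definition list_digraph :: "nat list \<Rightarrow> (nat \<times> nat) list \<Rightarrow> nat pair_pre_digraph" where
  "list_digraph vs as = \<lparr> pverts = set vs, parcs = set as \<rparr>"

fun tree_instance :: "cluster_instance \<Rightarrow> bool" where
  "tree_instance (vs, as, d, D) \<longleftrightarrow> distinct vs \<and> distinct as \<and>
     dag (list_digraph vs as) \<and> underlying_tree (list_digraph vs as) \<and> 0 \<le> d \<and> d < D"

definition enc_clusters :: "nat list list \<Rightarrow> btree" where
  "enc_clusters = enc_list (enc_list enc_nat)"

text \<open>A clustering is output as a list of clusters, in which every vertex occurs exactly once.\<close>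

fun solves_clustering :: "nat \<Rightarrow> cluster_instance \<Rightarrow> nat list list \<Rightarrow> bool" where
  "solves_clustering M (vs, as, d, D) cs \<longleftrightarrow> distinct (concat cs) \<and>
     optimal_clustering M (list_digraph vs as) d D (set (map set cs))"

end

theory Submission
  imports Defs
begin

text \<open>
  A clustering of capacity 2 matters only through the matching of arcs that it makes cheap. Every
  network delay is a sum of at most \<open>n\<close> copies of \<open>d\<close> and at most \<open>n\<close> copies of \<open>D\<close>, \<open>n\<close> being the
  number of arcs, so it suffices to decide for each of these \<open>(n + 1)\<^sup>2\<close> bounds \<open>T\<close> whether some
  matching keeps all directed walks within \<open>T\<close>. For fixed \<open>T\<close> the leaves of the tree are absorbed
  one by one into their neighbours. For a vertex and the part of the tree absorbed into it, a
  matching of that part is summarized by whether the vertex is matched, and by the maximal delays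
  of the walks into and out of it. When a leaf is absorbed along its arc, only one of its two
  delays is relevant from then on, depending on the direction of the arc; hence only its cheapest
  choice and its cheapest unmatched choice need to be kept, and the number of choices at a vertex
  grows by at most one per absorbed leaf.

  All data are natural numbers in binary, pairs and lists. Folding a polynomial-time step over a
  list takes polynomial time as long as the accumulator stays polynomially bounded.
\<close>

text \<open>With \<open>T\<close> fixed, a walk inside an absorbed part is merely a constraint that
  has been checked for good; otherwise it would be a third quantity to trade against the delays into
  and out of the vertex. A walk between the part of an absorbed leaf and the rest has to use the arc
  of the leaf. If that arc leaves the leaf, such a walk sees only the delay into the leaf, otherwise
  only the delay out of it. The choices at the neighbour remain a genuine trade-off between two
  delays, and they stay few because at most one of them is unmatched: an unmatched choice arises
  only from an unmatched one, and only the unmatched one splits in two.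

  The time bound rests on this count. Subtrees can be shared, so running time does not bound the
  size of the output, and a cheap step can be iterated to exponential size. Sizes are therefore
  bounded separately. The bound for the table comes from the invariants behind its correctness and
  is proved only along an elimination order, which is why polynomial time is taken relative to a
  predicate on the inputs.\<close>

section \<open>Linking programs\<close>

text \<open>The cost \<open>1\<close> in the rules of \<^const>\<open>eval\<close> must survive simplification.\<close>

declare One_nat_def [simp del]

primrec shift :: "nat \<Rightarrow> expr \<Rightarrow> expr" where
  "shift n (Var i) = Var i"
| "shift n LeafE = LeafE"
| "shift n (NodeE a b) = NodeE (shift n a) (shift n b)"
| "shift n (LeftE a) = LeftE (shift n a)"
| "shift n (RightE a) = RightE (shift n a)"
| "shift n (IfE c a b) = IfE (shift n c) (shift n a) (shift n b)"
| "shift n (Call f es) = Call (n + f) (map (shift n) es)"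

lemma eval_shift:
  "eval P env e v t \<Longrightarrow> eval (Q @ map (shift (length Q)) P @ R) env (shift (length Q) e) v t"
  "evals P env es vs t \<Longrightarrow>
    evals (Q @ map (shift (length Q)) P @ R) env (map (shift (length Q)) es) vs t"
proof (induction rule: eval_evals.inducts)
  case (eval_Call f env es vs s v t)
  then show ?case
    by (auto simp: nth_append intro!: eval_evals.eval_Call)
qed (auto intro: eval_evals.intros)

definition callable :: "program \<Rightarrow> nat \<Rightarrow> program \<Rightarrow> bool" where
  "callable L c P \<longleftrightarrow> (\<forall>env a x s y t. eval L env a x s \<longrightarrow> runs P x y t \<longrightarrow>
     eval L env (Call c [a]) y (Suc (s + t)))"

lemma callableD:
  "callable L c P \<Longrightarrow> runs P x y t \<Longrightarrow> eval L env a x s \<Longrightarrow>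
    eval L env (Call c [a]) y (Suc (s + t))"
  by (auto simp: callable_def)

lemma callable_shift: "callable (Q @ map (shift (length Q)) P @ R) (length Q) P"
  unfolding callable_def runs_def
proof (intro allI impI, elim conjE)
  fix env a x s y t
  let ?L = "Q @ map (shift (length Q)) P @ R"
  assume a: "eval ?L env a x s" and P: "P \<noteq> []" "eval P [x] (P ! 0) y t"
  have "?L ! length Q = shift (length Q) (P ! 0)"
    using P(1) by (simp add: nth_append)
  with eval_shift(1)[OF P(2)] have "eval ?L [x] (?L ! length Q) y t"
    by metis
  moreover have "evals ?L env [a] [x] (s + 0)"
    by (intro eval_evals.intros a)
  ultimately show "eval ?L env (Call (length Q) [a]) y (Suc (s + t))"
    using P(1) by (intro eval_Call) auto
qed

text \<open>The bodies refer to the addresses of the three programs, and these addresses depend on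
  how many bodies precede them; a length of \<open>es\<close> independent of its arguments breaks
  this circle. Constructions with fewer subprograms pass one of them more than once.\<close>

lemma link:
  assumes "\<And>a b c. length (es a b c) = m"
  shows "\<exists>L c1 c2 c3. m \<le> length L \<and> (\<forall>i<m. L ! i = es c1 c2 c3 ! i) \<and>
    callable L c1 P1 \<and> callable L c2 P2 \<and> callable L c3 P3"
proof -
  define c2 where "c2 = m + length P1"
  define c3 where "c3 = c2 + length P2"
  define E where "E = es m c2 c3"
  define L where "L = E @ map (shift m) P1 @ map (shift c2) P2 @ map (shift c3) P3"
  have len: "length E = m"
    by (simp add: E_def assms)
  have "callable L m P1"
    using callable_shift[of E P1] by (simp add: L_def len)
  moreover have "callable L c2 P2"
    using callable_shift[of "E @ map (shift m) P1" P2] by (simp add: L_def len c2_def)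
  moreover have "callable L c3 P3"
    using callable_shift[of "E @ map (shift m) P1 @ map (shift c2) P2" P3 "[]"]
    by (simp add: L_def len c2_def c3_def add.assoc)
  moreover have "m \<le> length L" "\<forall>i<m. L ! i = es m c2 c3 ! i"
    by (auto simp: L_def len nth_append E_def[symmetric])
  ultimately show ?thesis
    by blast
qed


section \<open>Polynomial-time functions on encoded data\<close>

text \<open>The encoding is determined by the type, so that the closure rules for polynomial time
  can be applied by the shape of a term alone.\<close>

class encodable =
  fixes code :: "'a \<Rightarrow> btree"

instantiation bool :: encodable
begin
definition "code = enc_bool"
instance ..
end

instantiation nat :: encodable
begin
definition "code = enc_nat"
instance ..
end

instantiation rat :: encodable
begin
definition "code = enc_rat"
instance ..
end

instantiation prod :: (encodable, encodable) encodable
begin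
definition "code = enc_prod code code"
instance ..
end

instantiation list :: (encodable) encodable
begin
definition "code = enc_list code"
instance ..
end

lemma code_simps [simp]:
  "code (a, b) = Node (code a) (code b)"
  "code ([] :: 'a::encodable list) = Leaf"
  "code ((x :: 'a::encodable) # xs) = Node (code x) (code xs)"
  "code True = Node Leaf Leaf" "code False = Leaf"
  by (simp_all add: code_prod_def code_list_def code_bool_def enc_prod_def enc_bool_def)

abbreviation csize :: "'a::encodable \<Rightarrow> nat" where
  "csize x \<equiv> size (code x)"

lemma code_eq_Leaf_iff [simp]:
  "code (xs :: 'a::encodable list) = Leaf \<longleftrightarrow> xs = []" "code b = Leaf \<longleftrightarrow> \<not> b"
  by (cases xs; simp) (cases b; simp)

text \<open>The base is at least 2, so every constant lies below a power and products only add
  exponents; a single exponent then describes any polynomial bound.\<close>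

definition poly_bounded :: "('a::encodable \<Rightarrow> bool) \<Rightarrow> ('a \<Rightarrow> nat) \<Rightarrow> bool" where
  "poly_bounded A g \<longleftrightarrow> (\<exists>k. \<forall>x. A x \<longrightarrow> g x \<le> (csize x + 2) ^ k)"

named_theorems pb_intros

lemma poly_bounded_mono:
  "poly_bounded A g \<Longrightarrow> (\<And>x. A x \<Longrightarrow> f x \<le> g x) \<Longrightarrow> poly_bounded A f"
  unfolding poly_bounded_def by (meson order_trans)

lemma poly_bounded_const [pb_intros]: "poly_bounded A (\<lambda>x. c)"
  unfolding poly_bounded_def
proof (intro exI allI impI)
  fix x
  have "c \<le> 2 ^ c"
    by (rule less_imp_le) (rule less_exp)
  also have "\<dots> \<le> (csize x + 2) ^ c"
    by (intro power_mono) auto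
  finally show "c \<le> (csize x + 2) ^ c" .
qed

lemma poly_bounded_csize [pb_intros]: "poly_bounded A (\<lambda>x. csize x)"
  unfolding poly_bounded_def by (intro exI[of _ 1]) auto

lemma poly_bounded_mult [pb_intros]:
  assumes "poly_bounded A f" "poly_bounded A g"
  shows "poly_bounded A (\<lambda>x. f x * g x)"
proof -
  obtain j k where "\<And>x. A x \<Longrightarrow> f x \<le> (csize x + 2) ^ j" "\<And>x. A x \<Longrightarrow> g x \<le> (csize x + 2) ^ k"
    using assms by (auto simp: poly_bounded_def)
  then have "A x \<Longrightarrow> f x * g x \<le> (csize x + 2) ^ (j + k)" for x
    by (simp add: power_add mult_mono)
  then show ?thesis
    by (auto simp: poly_bounded_def)
qed

text \<open>Sums are reduced to products by \<open>f + g \<le> (f + 1) * (g + 1)\<close>; adding 1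
  at most doubles the power and so costs one exponent.\<close>

lemma poly_bounded_add [pb_intros]:
  assumes "poly_bounded A f" "poly_bounded A g"
  shows "poly_bounded A (\<lambda>x. f x + g x)"
proof (rule poly_bounded_mono)
  have *: "poly_bounded A (\<lambda>x. h x + 1)" if h: "poly_bounded A h" for h
  proof (rule poly_bounded_mono)
    obtain k where k: "\<And>x. A x \<Longrightarrow> h x \<le> (csize x + 2) ^ k"
      using h by (auto simp: poly_bounded_def)
    have "A x \<Longrightarrow> 2 * (csize x + 2) ^ k \<le> (csize x + 2) ^ Suc k" for x
      by simp
    moreover have "1 \<le> (csize x + 2) ^ k" for x
      by (rule one_le_power) simp
    ultimately have "A x \<Longrightarrow> h x + 1 \<le> (csize x + 2) ^ Suc k" for x
      using k[of x] by (metis add_mono mult_2 order_trans)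
    then show "poly_bounded A (\<lambda>x. h x + 1)"
      unfolding poly_bounded_def by blast
  qed simp
  show "poly_bounded A (\<lambda>x. (f x + 1) * (g x + 1))"
    using assms by (intro poly_bounded_mult *)
qed (simp add: algebra_simps)

lemma poly_bounded_Suc [pb_intros]: "poly_bounded A f \<Longrightarrow> poly_bounded A (\<lambda>x. Suc (f x))"
  using poly_bounded_add[OF _ poly_bounded_const[of _ 1], of A f] by (simp add: Suc_eq_plus1)

lemma poly_bounded_power [pb_intros]: "poly_bounded A f \<Longrightarrow> poly_bounded A (\<lambda>x. f x ^ k)"
  by (induction k) (auto intro!: pb_intros)

lemma poly_bounded_comp:
  assumes "poly_bounded B g" "\<And>x. A x \<Longrightarrow> B (f x)" "poly_bounded A (\<lambda>x. csize (f x))"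
  shows "poly_bounded A (\<lambda>x. g (f x))"
proof -
  obtain k where k: "\<And>x. B x \<Longrightarrow> g x \<le> (csize x + 2) ^ k"
    using assms(1) by (auto simp: poly_bounded_def)
  have "poly_bounded A (\<lambda>x. (csize (f x) + 2) ^ k)"
    by (intro pb_intros assms)
  then show ?thesis
    by (rule poly_bounded_mono) (use k assms in auto)
qed

text \<open>The bound on the output size does not follow from the time bound: \<open>NodeE\<close>
  can double a shared tree in constantly many steps. Composition needs it, since the second function
  is polynomial only in the size of the intermediate result.\<close>

definition poly_time :: "('a::encodable \<Rightarrow> bool) \<Rightarrow> ('a \<Rightarrow> 'b::encodable) \<Rightarrow> bool" where
  "poly_time A f \<longleftrightarrow> poly_bounded A (\<lambda>x. csize (f x)) \<and>
     (\<exists>P T. poly_bounded A T \<and> (\<forall>x. A x \<longrightarrow> (\<exists>t \<le> T x. runs P (code x) (code (f x)) t)))"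

lemma poly_time_csize [pb_intros]: "poly_time A f \<Longrightarrow> poly_bounded A (\<lambda>x. csize (f x))"
  by (simp add: poly_time_def)

lemma poly_timeE:
  assumes "poly_time A f"
  obtains P T where "poly_bounded A T" "\<And>x. A x \<Longrightarrow> \<exists>t \<le> T x. runs P (code x) (code (f x)) t"
  using assms unfolding poly_time_def by blast

named_theorems pt_intros

lemma poly_time_id [pt_intros]: "poly_time A (\<lambda>x. x)"
  unfolding poly_time_def runs_def
  by (intro conjI pb_intros exI[of _ "[Var 0]"] exI[of _ "\<lambda>_. 1"] allI impI)
    (auto intro!: exI[of _ 1] eval_evals.intros eval_Var[of 0 "[_]", simplified])

text \<open>The programs for \<open>f\<close>, \<open>g\<close>, \<open>h\<close> are linked below the bodies \<open>es\<close>, which call them.\<close>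

lemma poly_time_link:
  assumes f: "poly_time A f" and g: "poly_time B g" and h: "poly_time C h"
  assumes len: "\<And>a b c. length (es a b c) = Suc m"
  assumes size: "poly_bounded D (\<lambda>x. csize (F x))"
  assumes main: "\<And>L c1 c2 c3 Tf Tg Th. poly_bounded A Tf \<Longrightarrow> poly_bounded B Tg \<Longrightarrow> poly_bounded C Th \<Longrightarrow>
      (\<And>x env a s. A x \<Longrightarrow> eval L env a (code x) s \<Longrightarrow>
        \<exists>t \<le> Suc (s + Tf x). eval L env (Call c1 [a]) (code (f x)) t) \<Longrightarrow>
      (\<And>x env a s. B x \<Longrightarrow> eval L env a (code x) s \<Longrightarrow>
        \<exists>t \<le> Suc (s + Tg x). eval L env (Call c2 [a]) (code (g x)) t) \<Longrightarrow>
      (\<And>x env a s. C x \<Longrightarrow> eval L env a (code x) s \<Longrightarrow>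
        \<exists>t \<le> Suc (s + Th x). eval L env (Call c3 [a]) (code (h x)) t) \<Longrightarrow>
      (\<And>i. i < Suc m \<Longrightarrow> L ! i = es c1 c2 c3 ! i) \<Longrightarrow> Suc m \<le> length L \<Longrightarrow>
      \<exists>T. poly_bounded D T \<and> (\<forall>x. D x \<longrightarrow> (\<exists>t \<le> T x. eval L [code x] (es c1 c2 c3 ! 0) (code (F x)) t))"
  shows "poly_time D F"
proof -
  obtain P1 T1 where 1: "poly_bounded A T1" "\<And>x. A x \<Longrightarrow> \<exists>t \<le> T1 x. runs P1 (code x) (code (f x)) t"
    using f by (rule poly_timeE) blast
  obtain P2 T2 where 2: "poly_bounded B T2" "\<And>x. B x \<Longrightarrow> \<exists>t \<le> T2 x. runs P2 (code x) (code (g x)) t"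
    using g by (rule poly_timeE) blast
  obtain P3 T3 where 3: "poly_bounded C T3" "\<And>x. C x \<Longrightarrow> \<exists>t \<le> T3 x. runs P3 (code x) (code (h x)) t"
    using h by (rule poly_timeE) blast
  obtain L c1 c2 c3 where L: "Suc m \<le> length L" "\<And>i. i < Suc m \<Longrightarrow> L ! i = es c1 c2 c3 ! i"
    "callable L c1 P1" "callable L c2 P2" "callable L c3 P3"
    using link[of es "Suc m" P1 P2 P3, OF len] by blast
  have "\<exists>T. poly_bounded D T \<and> (\<forall>x. D x \<longrightarrow> (\<exists>t \<le> T x. eval L [code x] (es c1 c2 c3 ! 0) (code (F x)) t))"
  proof (rule main[OF 1(1) 2(1) 3(1)])
    show "\<exists>t \<le> Suc (s + T1 x). eval L env (Call c1 [a]) (code (f x)) t"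
      if "A x" "eval L env a (code x) s" for x env a s
      using 1(2)[OF that(1)] callableD[OF L(3) _ that(2)] by (meson Suc_le_mono add_le_cancel_left)
    show "\<exists>t \<le> Suc (s + T2 x). eval L env (Call c2 [a]) (code (g x)) t"
      if "B x" "eval L env a (code x) s" for x env a s
      using 2(2)[OF that(1)] callableD[OF L(4) _ that(2)] by (meson Suc_le_mono add_le_cancel_left)
    show "\<exists>t \<le> Suc (s + T3 x). eval L env (Call c3 [a]) (code (h x)) t"
      if "C x" "eval L env a (code x) s" for x env a s
      using 3(2)[OF that(1)] callableD[OF L(5) _ that(2)] by (meson Suc_le_mono add_le_cancel_left)
  qed (use L in auto)
  moreover have "L \<noteq> []" "L ! 0 = es c1 c2 c3 ! 0"
    using L by auto
  ultimately show ?thesis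
    unfolding poly_time_def runs_def using size by metis
qed

section \<open>Closure of polynomial time under pairing, composition, branching and
  iteration\<close>

lemma eval_Var0: "eval L (x # env) (Var 0) x 1"
  using eval_Var[of 0 "x # env"] by simp

lemma poly_time_Pair [pt_intros]:
  assumes "poly_time A f" "poly_time A g"
  shows "poly_time A (\<lambda>x. (f x, g x))"
proof (rule poly_time_link[OF assms assms(2), where m = 0
      and es = "\<lambda>a b c. [NodeE (Call a [Var 0]) (Call b [Var 0])]"], goal_cases)
  case 2
  show ?case
    using assms by (auto intro!: pb_intros)
next
  case (3 L c1 c2 c3 Tf Tg Th)
  show ?case
  proof (rule exI, intro conjI allI impI)
    show "poly_bounded A (\<lambda>x. Suc (Suc (1 + Tf x) + Suc (1 + Tg x)))"
      by (intro pb_intros 3)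
    fix x assume "A x"
    with 3(4)[of x "[code x]" "Var 0" 1] 3(5)[of x "[code x]" "Var 0" 1]
    obtain s t where "eval L [code x] (Call c1 [Var 0]) (code (f x)) s" "s \<le> Suc (1 + Tf x)"
      "eval L [code x] (Call c2 [Var 0]) (code (g x)) t" "t \<le> Suc (1 + Tg x)"
      by (auto simp: eval_Var0)
    then show "\<exists>t \<le> Suc (Suc (1 + Tf x) + Suc (1 + Tg x)).
      eval L [code x] ([NodeE (Call c1 [Var 0]) (Call c2 [Var 0])] ! 0) (code (f x, g x)) t"
      by (intro exI[of _ "Suc (s + t)"]) (auto intro: eval_Node)
  qed
qed auto

lemma poly_time_comp:
  assumes "poly_time B g" "poly_time A f" "\<And>x. A x \<Longrightarrow> B (f x)"
  shows "poly_time A (\<lambda>x. g (f x))"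
proof (rule poly_time_link[OF assms(2,1,1), where m = 0
      and es = "\<lambda>a b c. [Call b [Call a [Var 0]]]"], goal_cases)
  case 2
  show ?case
    by (rule poly_bounded_comp[of B "\<lambda>y. csize (g y)" A f]) (intro pb_intros assms | assumption)+
next
  case (3 L c1 c2 c3 Tf Tg Th)
  show ?case
  proof (rule exI, intro conjI allI impI)
    show "poly_bounded A (\<lambda>x. Suc (Suc (1 + Tf x) + Tg (f x)))"
      by (intro pb_intros 3 poly_bounded_comp[of B Tg A f] assms)
    fix x assume "A x"
    obtain s where s: "eval L [code x] (Call c1 [Var 0]) (code (f x)) s" "s \<le> Suc (1 + Tf x)"
      using 3(4)[OF \<open>A x\<close> eval_Var0] by blast
    obtain t where "eval L [code x] (Call c2 [Call c1 [Var 0]]) (code (g (f x))) t" "t \<le> Suc (s + Tg (f x))"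
      using 3(5)[OF assms(3)[OF \<open>A x\<close>] s(1)] by blast
    with s(2) show "\<exists>t \<le> Suc (Suc (1 + Tf x) + Tg (f x)).
      eval L [code x] ([Call c2 [Call c1 [Var 0]]] ! 0) (code (g (f x))) t"
      by (intro exI[of _ t]) auto
  qed
qed auto

lemma poly_time_expr:
  assumes "poly_bounded A (\<lambda>x. csize (f x))"
  assumes "\<And>x. A x \<Longrightarrow> \<exists>t \<le> c. eval [e] [code x] e (code (f x)) t"
  shows "poly_time A f"
  unfolding poly_time_def runs_def
  by (intro conjI assms exI[of _ "[e]"] exI[of _ "\<lambda>_. c"] pb_intros) (use assms in auto)

primrec quote :: "btree \<Rightarrow> expr" where
  "quote Leaf = LeafE"
| "quote (Node l r) = NodeE (quote l) (quote r)"

lemma eval_quote: "\<exists>t. \<forall>P env. eval P env (quote v) v t"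
proof (induction v)
  case (Node l r)
  then obtain s t where "\<And>P env. eval P env (quote l) l s" "\<And>P env. eval P env (quote r) r t"
    by blast
  then show ?case
    by (auto intro!: exI[of _ "Suc (s + t)"] eval_Node)
qed (auto intro: eval_Leaf)

lemma poly_time_const [pt_intros]: "poly_time A (\<lambda>x. c)"
proof -
  obtain t where "\<And>P env. eval P env (quote (code c)) (code c) t"
    using eval_quote by blast
  then show ?thesis
    by (intro poly_time_expr[where e = "quote (code c)" and c = t] pb_intros) blast
qed

lemma size_left_right: "size (left t) \<le> size t" "size (right t) \<le> size t"
  by (cases t; simp)+

lemma poly_time_left:
  assumes "\<And>x. code (f x) = left (code x)"
  shows "poly_time A f"
proof (rule poly_time_expr[where e = "LeftE (Var 0)"])
  show "poly_bounded A (\<lambda>x. csize (f x))"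
    by (rule poly_bounded_mono[OF poly_bounded_csize]) (simp add: assms size_left_right)
  show "\<exists>t \<le> Suc 1. eval [LeftE (Var 0)] [code x] (LeftE (Var 0)) (code (f x)) t" for x
    unfolding assms by (intro exI[of _ "Suc 1"] conjI eval_Left eval_Var0 order_refl)
qed

lemma poly_time_right:
  assumes "\<And>x. code (f x) = right (code x)"
  shows "poly_time A f"
proof (rule poly_time_expr[where e = "RightE (Var 0)"])
  show "poly_bounded A (\<lambda>x. csize (f x))"
    by (rule poly_bounded_mono[OF poly_bounded_csize]) (simp add: assms size_left_right)
  show "\<exists>t \<le> Suc 1. eval [RightE (Var 0)] [code x] (RightE (Var 0)) (code (f x)) t" for x
    unfolding assms by (intro exI[of _ "Suc 1"] conjI eval_Right eval_Var0 order_refl)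
qed

lemma poly_time_same:
  assumes "\<And>x. code (f x) = code x"
  shows "poly_time A f"
proof (rule poly_time_expr[where e = "Var 0"])
  show "poly_bounded A (\<lambda>x. csize (f x))"
    unfolding assms by (rule poly_bounded_csize)
  show "\<exists>t \<le> 1. eval [Var 0] [code x] (Var 0) (code (f x)) t" for x
    unfolding assms by (intro exI[of _ 1] conjI eval_Var0 order_refl)
qed

lemma poly_time_comp': "poly_time (\<lambda>_. True) g \<Longrightarrow> poly_time A f \<Longrightarrow> poly_time A (\<lambda>x. g (f x))"
  by (rule poly_time_comp[of "\<lambda>_. True" g A f]) auto

lemma poly_time_comp2:
  assumes "poly_time (\<lambda>_. True) (\<lambda>p. g (fst p) (snd p))" "poly_time A f1" "poly_time A f2"
  shows "poly_time A (\<lambda>x. g (f1 x) (f2 x))"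
  using poly_time_comp'[OF assms(1) poly_time_Pair[OF assms(2,3)]] by simp

lemma poly_time_fst [pt_intros]: "poly_time A f \<Longrightarrow> poly_time A (\<lambda>x. fst (f x))"
  by (rule poly_time_comp'[of fst]) (auto intro!: poly_time_left simp: code_prod_def enc_prod_def)

lemma poly_time_snd [pt_intros]: "poly_time A f \<Longrightarrow> poly_time A (\<lambda>x. snd (f x))"
  by (rule poly_time_comp'[of snd]) (auto intro!: poly_time_right simp: code_prod_def enc_prod_def)

lemma poly_time_Cons [pt_intros]:
  assumes "poly_time A f" "poly_time A g"
  shows "poly_time A (\<lambda>x. f x # g x)"
  by (rule poly_time_comp'[OF _ poly_time_Pair[OF assms], where g = "\<lambda>p. fst p # snd p", simplified])
    (auto intro!: poly_time_same)

lemma poly_time_if [pt_intros]: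
  assumes "poly_time A b" "poly_time A f" "poly_time A g"
  shows "poly_time A (\<lambda>x. if b x then f x else g x)"
proof (rule poly_time_link[OF assms, where m = 0
      and es = "\<lambda>a b c. [IfE (Call a [Var 0]) (Call b [Var 0]) (Call c [Var 0])]"], goal_cases)
  case 2
  show ?case
    by (rule poly_bounded_mono[where g = "\<lambda>x. csize (f x) + csize (g x)"])
      (auto intro!: pb_intros assms)
next
  case (3 L c1 c2 c3 Tf Tg Th)
  show ?case
  proof (rule exI, intro conjI allI impI)
    show "poly_bounded A (\<lambda>x. Suc (Suc (1 + Tf x) + (Suc (1 + Tg x) + Suc (1 + Th x))))"
      by (intro pb_intros 3)
    fix x assume "A x"
    obtain s where s: "eval L [code x] (Call c1 [Var 0]) (code (b x)) s" "s \<le> Suc (1 + Tf x)"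
      using 3(4)[OF \<open>A x\<close> eval_Var0] by blast
    obtain t where t: "eval L [code x] (Call c2 [Var 0]) (code (f x)) t" "t \<le> Suc (1 + Tg x)"
      using 3(5)[OF \<open>A x\<close> eval_Var0] by blast
    obtain u where u: "eval L [code x] (Call c3 [Var 0]) (code (g x)) u" "u \<le> Suc (1 + Th x)"
      using 3(6)[OF \<open>A x\<close> eval_Var0] by blast
    show "\<exists>t \<le> Suc (Suc (1 + Tf x) + (Suc (1 + Tg x) + Suc (1 + Th x))).
      eval L [code x] ([IfE (Call c1 [Var 0]) (Call c2 [Var 0]) (Call c3 [Var 0])] ! 0)
        (code (if b x then f x else g x)) t"
    proof (cases "b x")
      case True
      then show ?thesis
        using eval_IfTrue[OF s(1) _ t(1)] s(2) t(2) by (auto intro!: exI[of _ "Suc (s + t)"])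
    next
      case False
      then show ?thesis
        using eval_IfFalse[OF _ u(1)] s u(2) by (auto intro!: exI[of _ "Suc (s + u)"])
    qed
  qed
qed auto

text \<open>A nonempty list has the same code as the pair of its head and tail, so the branch
  \<open>h\<close> receives \<open>l x\<close> unchanged. Head and tail are no larger than
  \<open>l x\<close>, which turns the bounds for \<open>h\<close> into bounds in
  \<open>x\<close>.\<close>

lemma poly_time_case_list [pt_intros]:
  assumes "poly_time A l" "poly_time A g"
    and "poly_time (\<lambda>z. A (fst z)) (\<lambda>z. h (fst z) (fst (snd z)) (snd (snd z)))"
  shows "poly_time A (\<lambda>x. case l x of [] \<Rightarrow> g x | y # ys \<Rightarrow> h x y ys)"
proof -
  obtain k where k: "\<And>x y ys. A x \<Longrightarrow> csize (h x y ys) \<le> (csize (x, (y, ys)) + 2) ^ k"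
    using assms(3) unfolding poly_time_def poly_bounded_def by fastforce
  show ?thesis
  proof (rule poly_time_link[OF assms, where m = 0
        and es = "\<lambda>a b c. [IfE (Call a [Var 0]) (Call c [NodeE (Var 0) (Call a [Var 0])]) (Call b [Var 0])]"], goal_cases)
    case 2
    show ?case
    proof (rule poly_bounded_mono)
      show "poly_bounded A (\<lambda>x. csize (g x) + (csize x + csize (l x) + 10) ^ k)"
        by (intro pb_intros assms)
      fix x assume "A x"
      show "csize (case l x of [] \<Rightarrow> g x | y # ys \<Rightarrow> h x y ys) \<le> csize (g x) + (csize x + csize (l x) + 10) ^ k"
      proof (cases "l x")
        case (Cons y ys)
        have "csize (h x y ys) \<le> (csize (x, (y, ys)) + 2) ^ k"
          by (rule k) fact
        also have "\<dots> \<le> (csize x + csize (l x) + 10) ^ k"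
          by (intro power_mono) (auto simp: Cons)
        finally show ?thesis
          by (simp add: Cons)
      qed auto
    qed
  next
    case (3 L c1 c2 c3 Tf Tg Th)
    obtain j where j: "\<And>x y ys. A x \<Longrightarrow> Th (x, (y, ys)) \<le> (csize (x, (y, ys)) + 2) ^ j"
      using 3(3) unfolding poly_bounded_def by fastforce
    let ?T = "\<lambda>x. Suc (Suc (1 + Tf x) + (Suc (1 + Tg x) + Suc (Suc (1 + (Suc (1 + Tf x))) + (csize x + csize (l x) + 10) ^ j)))"
    show ?case
    proof (rule exI, intro conjI allI impI)
      show "poly_bounded A ?T"
        by (intro pb_intros 3 assms)
      fix x assume "A x"
      obtain s where s: "eval L [code x] (Call c1 [Var 0]) (code (l x)) s" "s \<le> Suc (1 + Tf x)"
        using 3(4)[OF \<open>A x\<close> eval_Var0] by blast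
      obtain t where t: "eval L [code x] (Call c2 [Var 0]) (code (g x)) t" "t \<le> Suc (1 + Tg x)"
        using 3(5)[OF \<open>A x\<close> eval_Var0] by blast
      show "\<exists>t \<le> ?T x.
        eval L [code x] ([IfE (Call c1 [Var 0]) (Call c3 [NodeE (Var 0) (Call c1 [Var 0])]) (Call c2 [Var 0])] ! 0)
          (code (case l x of [] \<Rightarrow> g x | y # ys \<Rightarrow> h x y ys)) t"
      proof (cases "l x")
        case Nil
        then show ?thesis
          using eval_IfFalse[OF _ t(1)] s t(2) by (auto intro!: exI[of _ "Suc (s + t)"])
      next
        case (Cons y ys)
        have "eval L [code x] (NodeE (Var 0) (Call c1 [Var 0])) (code (x, y, ys)) (Suc (1 + s))"
          using eval_Node[OF eval_Var0 s(1)] Cons by simp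
        with 3(6)[of "(x, y, ys)"] \<open>A x\<close> obtain u where
          u: "eval L [code x] (Call c3 [NodeE (Var 0) (Call c1 [Var 0])]) (code (h x y ys)) u"
           "u \<le> Suc (Suc (1 + s) + Th (x, y, ys))"
          by fastforce
        have "Th (x, y, ys) \<le> (csize (x, (y, ys)) + 2) ^ j"
          by (rule j) fact
        also have "\<dots> \<le> (csize x + csize (l x) + 10) ^ j"
          by (intro power_mono) (auto simp: Cons)
        finally have "u \<le> Suc (Suc (1 + s) + (csize x + csize (l x) + 10) ^ j)"
          using u(2) by simp
        then show ?thesis
          using eval_IfTrue[OF s(1) _ u(1)] s(2) Cons by (auto intro!: exI[of _ "Suc (s + u)"])
      qed
    qed
  qed auto
qed

lemma csize_elem: "x \<in> set xs \<Longrightarrow> csize x \<le> csize xs"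
  by (induction xs) auto

lemma length_le_csize: "length xs \<le> csize xs"
  by (induction xs) auto

text \<open>Body 1 is the loop, with the input, the accumulator and the remaining list as arguments.
  The bound \<open>G\<close> on all intermediate accumulators has to be supplied: a step that is
  polynomial in the accumulator says nothing about its iterates.\<close>

lemma poly_time_foldl:
  assumes l: "poly_time A l" and i: "poly_time A i"
    and h: "poly_time (\<lambda>z. A (fst z)) (\<lambda>z. h (fst z) (fst (snd z)) (snd (snd z)))"
    and G: "poly_bounded A G"
      "\<And>x n. A x \<Longrightarrow> n \<le> length (l x) \<Longrightarrow> csize (foldl (h x) (i x) (take n (l x))) \<le> G x"
  shows "poly_time A (\<lambda>x. foldl (h x) (i x) (l x))"
proof (rule poly_time_link[OF l i h, where m = 1
      and es = "\<lambda>a b c. [Call 1 [Var 0, Call b [Var 0], Call a [Var 0]],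
        IfE (Var 2) (Call 1 [Var 0, Call c [NodeE (Var 0) (NodeE (Var 1) (LeftE (Var 2)))], RightE (Var 2)])
          (Var 1)]"], goal_cases)
  case 2
  show ?case
    by (rule poly_bounded_mono[OF G(1)]) (use G(2) in \<open>metis order_refl take_all\<close>)
next
  case (3 L c1 c2 c3 Tf Tg Th)
  obtain j where j: "\<And>x a y. A x \<Longrightarrow> Th (x, (a, y)) \<le> (csize (x, (a, y)) + 2) ^ j"
    using 3(3) unfolding poly_bounded_def by fastforce
  let ?step = "Call c3 [NodeE (Var 0) (NodeE (Var 1) (LeftE (Var 2)))]"
  let ?body = "IfE (Var 2) (Call 1 [Var 0, ?step, RightE (Var 2)]) (Var 1)"
  have L1: "L ! 1 = ?body"
    using 3(7)[of 1] by simp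
  \<comment> \<open>\<open>K\<close> bounds the cost of the step on the accumulators that actually
    occur; the \<open>20\<close> generously covers the fixed cost of one round and of the final
    test.\<close>
  have loop: "\<exists>t \<le> 20 + length ys * (20 + K).
      eval L [code x, code a, code ys] ?body (code (foldl (h x) a ys)) t"
    if "A x" "\<And>n. n < length ys \<Longrightarrow> Th (x, foldl (h x) a (take n ys), ys ! n) \<le> K" for x a ys K
    using that(2)
  proof (induction ys arbitrary: a)
    case Nil
    let ?env = "[code x, code a, Leaf]"
    have "eval L ?env (Var 2) Leaf 1" "eval L ?env (Var 1) (code a) 1"
      using eval_Var[of 1 ?env] eval_Var[of 2 ?env] by auto
    then have "eval L ?env ?body (code a) (Suc (1 + 1))"
      by (rule eval_IfFalse)
    then show ?case
      by (auto intro!: exI[of _ "Suc (1 + 1)"])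
  next
    case (Cons y ys)
    let ?env = "[code x, code a, code (y # ys)]"
    have var: "eval L ?env (Var 0) (code x) 1" "eval L ?env (Var 1) (code a) 1"
      "eval L ?env (Var 2) (code (y # ys)) 1"
      using eval_Var[of 0 ?env] eval_Var[of 1 ?env] eval_Var[of 2 ?env] by auto
    have left: "eval L ?env (LeftE (Var 2)) (code y) 2"
      using eval_Left[OF var(3)] by (simp add: numeral_2_eq_2)
    have right: "eval L ?env (RightE (Var 2)) (code ys) 2"
      using eval_Right[OF var(3)] by (simp add: numeral_2_eq_2)
    have "eval L ?env (NodeE (Var 0) (NodeE (Var 1) (LeftE (Var 2)))) (code (x, a, y)) 6"
      using eval_Node[OF var(1) eval_Node[OF var(2) left]] by simp
    with 3(6)[of "(x, a, y)"] \<open>A x\<close> obtain s where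
      s: "eval L ?env ?step (code (h x a y)) s" "s \<le> Suc (6 + Th (x, a, y))"
      by fastforce
    have "Th (x, a, y) \<le> K"
      using Cons.prems[of 0] by simp
    have "\<exists>t \<le> 20 + length ys * (20 + K).
      eval L [code x, code (h x a y), code ys] ?body (code (foldl (h x) (h x a y) ys)) t"
      by (rule Cons.IH) (use Cons.prems[of "Suc _"] in auto)
    then obtain t where t: "t \<le> 20 + length ys * (20 + K)"
      "eval L [code x, code (h x a y), code ys] ?body (code (foldl (h x) (h x a y) ys)) t"
      by blast
    have "evals L ?env [Var 0, ?step, RightE (Var 2)] [code x, code (h x a y), code ys] (1 + (s + (2 + 0)))"
      by (intro evals_Cons evals_Nil var right s)
    then have "eval L ?env (Call 1 [Var 0, ?step, RightE (Var 2)])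
       (code (foldl (h x) (h x a y) ys)) (Suc (1 + (s + (2 + 0)) + t))"
      by (rule eval_Call[rotated]) (use t(2) 3(8) L1 in auto)
    then have "eval L ?env ?body (code (foldl (h x) (h x a y) ys)) (Suc (1 + (Suc (1 + (s + (2 + 0)) + t))))"
      by (rule eval_IfTrue[OF var(3), rotated]) simp
    moreover have "Suc (1 + (Suc (1 + (s + (2 + 0)) + t))) \<le> 20 + length (y # ys) * (20 + K)"
      using s(2) t(1) \<open>Th (x, a, y) \<le> K\<close> by simp
    ultimately show ?case
      unfolding foldl_Cons by blast
  qed
  let ?T = "\<lambda>x. Suc (1 + (Suc (1 + Tg x) + Suc (1 + Tf x)) +
     (20 + csize (l x) * (20 + (csize x + G x + csize (l x) + 10) ^ j)))"
  show ?case
  proof (rule exI, intro conjI allI impI)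
    show "poly_bounded A ?T"
      by (intro pb_intros 3 l G)
    fix x assume "A x"
    obtain s where s: "eval L [code x] (Call c1 [Var 0]) (code (l x)) s" "s \<le> Suc (1 + Tf x)"
      using 3(4)[OF \<open>A x\<close> eval_Var0] by blast
    obtain t where t: "eval L [code x] (Call c2 [Var 0]) (code (i x)) t" "t \<le> Suc (1 + Tg x)"
      using 3(5)[OF \<open>A x\<close> eval_Var0] by blast
    have "\<exists>t \<le> 20 + length (l x) * (20 + (csize x + G x + csize (l x) + 10) ^ j).
      eval L [code x, code (i x), code (l x)] ?body (code (foldl (h x) (i x) (l x))) t"
    proof (rule loop[OF \<open>A x\<close>])
      fix n assume n: "n < length (l x)"
      let ?z = "(x, foldl (h x) (i x) (take n (l x)), l x ! n)"
      have "Th ?z \<le> (csize ?z + 2) ^ j"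
        by (rule j) fact
      also have "\<dots> \<le> (csize x + G x + csize (l x) + 10) ^ j"
        using G(2)[OF \<open>A x\<close>, of n] csize_elem[of "l x ! n" "l x"] n
        by (intro power_mono) auto
      finally show "Th ?z \<le> (csize x + G x + csize (l x) + 10) ^ j" .
    qed
    then obtain u where u: "u \<le> 20 + length (l x) * (20 + (csize x + G x + csize (l x) + 10) ^ j)"
      "eval L [code x, code (i x), code (l x)] ?body (code (foldl (h x) (i x) (l x))) u"
      by blast
    have "evals L [code x] [Var 0, Call c2 [Var 0], Call c1 [Var 0]] [code x, code (i x), code (l x)] (1 + (t + (s + 0)))"
      by (intro evals_Cons evals_Nil s t eval_Var0)
    then have "eval L [code x] (Call 1 [Var 0, Call c2 [Var 0], Call c1 [Var 0]])
        (code (foldl (h x) (i x) (l x))) (Suc (1 + (t + (s + 0)) + u))"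
      by (rule eval_Call[rotated]) (use u 3(8) L1 in auto)
    moreover have "length (l x) * (20 + (csize x + G x + csize (l x) + 10) ^ j) \<le>
       csize (l x) * (20 + (csize x + G x + csize (l x) + 10) ^ j)"
      by (rule mult_right_mono[OF length_le_csize]) simp
    then have "Suc (1 + (t + (s + 0)) + u) \<le> ?T x"
      using s(2) t(2) u(1) by linarith
    ultimately show "\<exists>t \<le> ?T x. eval L [code x]
        ([Call 1 [Var 0, Call c2 [Var 0], Call c1 [Var 0]], ?body] ! 0) (code (foldl (h x) (i x) (l x))) t"
      unfolding nth_Cons_0 by blast
  qed
qed auto

declare One_nat_def [simp]

section \<open>Boolean and list operations\<close>

lemma poly_time_conj [pt_intros]:
  "poly_time A b \<Longrightarrow> poly_time A c \<Longrightarrow> poly_time A (\<lambda>x. b x \<and> c x)"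
  using poly_time_if[OF _ _ poly_time_const, of A b c False] by (simp only: if_bool_eq_disj simp_thms)

lemma poly_time_Not [pt_intros]: "poly_time A b \<Longrightarrow> poly_time A (\<lambda>x. \<not> b x)"
  using poly_time_if[OF _ poly_time_const poly_time_const, of A b False True]
  by (simp only: if_bool_eq_disj simp_thms)

lemma poly_time_disj [pt_intros]:
  "poly_time A b \<Longrightarrow> poly_time A c \<Longrightarrow> poly_time A (\<lambda>x. b x \<or> c x)"
  using poly_time_if[OF _ poly_time_const, of A b c True]
  by (simp only: if_bool_eq_conj simp_thms imp_conv_disj not_not)

lemma poly_time_Let [pt_intros]:
  assumes "poly_time A f" "poly_time (\<lambda>z. A (fst z)) (\<lambda>z. h (fst z) (snd z))"
  shows "poly_time A (\<lambda>x. let y = f x in h x y)"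
  using poly_time_comp[OF assms(2) poly_time_Pair[OF poly_time_id assms(1)]] by simp

lemma poly_time_eq_Nil [pt_intros]:
  fixes f :: "'a::encodable \<Rightarrow> 'b::encodable list"
  assumes "poly_time A f"
  shows "poly_time A (\<lambda>x. f x = [])"
proof -
  have "(case xs of [] \<Rightarrow> True | _ # _ \<Rightarrow> False) = (xs = [])" for xs :: "'b list"
    by (cases xs) auto
  then show ?thesis
    using poly_time_case_list[OF assms poly_time_const poly_time_const, of True False] by simp
qed

text \<open>When one step adds at most \<open>G x\<close>, regardless of the accumulator, the growth
  over the whole fold is at most \<open>csize (l x) * G x\<close>.\<close>

lemma poly_time_foldl_add:
  assumes l: "poly_time A l" and i: "poly_time A i"
    and h: "poly_time (\<lambda>z. A (fst z)) (\<lambda>z. h (fst z) (fst (snd z)) (snd (snd z)))"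
    and G: "poly_bounded A G"
      "\<And>x acc y. A x \<Longrightarrow> y \<in> set (l x) \<Longrightarrow> csize (h x acc y) \<le> csize acc + G x"
  shows "poly_time A (\<lambda>x. foldl (h x) (i x) (l x))"
proof (rule poly_time_foldl[OF l i h])
  show "poly_bounded A (\<lambda>x. csize (i x) + csize (l x) * G x)"
    by (intro pb_intros l i G)
  fix x n assume A: "A x" "n \<le> length (l x)"
  have "csize (foldl (h x) (i x) (take n (l x))) \<le> csize (i x) + n * G x"
    using A(2)
  proof (induction n)
    case (Suc n)
    then have "csize (foldl (h x) (i x) (take (Suc n) (l x))) \<le>
        csize (foldl (h x) (i x) (take n (l x))) + G x"
      using G(2)[OF A(1)] by (simp add: take_Suc_conv_app_nth)
    with Suc show ?case
      by simp
  qed simp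
  also have "n * G x \<le> csize (l x) * G x"
    using A(2) length_le_csize[of "l x"] by (intro mult_right_mono) auto
  finally show "csize (foldl (h x) (i x) (take n (l x))) \<le> csize (i x) + csize (l x) * G x"
    by simp
qed

lemma csize_append [simp]: "csize (xs @ ys) = csize xs + csize ys"
  by (induction xs) auto

lemma poly_time_rev_append:
  assumes "poly_time A f" "poly_time A g"
  shows "poly_time A (\<lambda>x. rev (f x) @ g x)"
proof -
  have "foldl (\<lambda>acc y. y # acc) ys xs = rev xs @ ys" for xs ys :: "'b list"
    by (induction xs arbitrary: ys) auto
  moreover have "poly_time A (\<lambda>x. foldl (\<lambda>acc y. y # acc) (g x) (f x))"
    by (rule poly_time_foldl_add[where G = "\<lambda>x. csize (f x) + 1"])
      (auto intro!: pt_intros pb_intros assms csize_elem)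
  ultimately show ?thesis
    by simp
qed

lemma poly_time_rev [pt_intros]: "poly_time A f \<Longrightarrow> poly_time A (\<lambda>x. rev (f x))"
  using poly_time_rev_append[OF _ poly_time_const, of A f "[]"] by simp

lemma poly_time_append [pt_intros]:
  "poly_time A f \<Longrightarrow> poly_time A g \<Longrightarrow> poly_time A (\<lambda>x. f x @ g x)"
  using poly_time_rev_append[OF poly_time_rev, of A f g] by simp

lemma poly_time_map [pt_intros]:
  assumes l: "poly_time A l" and h: "poly_time (\<lambda>z. A (fst z)) (\<lambda>z. h (fst z) (snd z))"
  shows "poly_time A (\<lambda>x. map (h x) (l x))"
proof -
  have "foldl (\<lambda>acc y. k y # acc) ys xs = rev (map k xs) @ ys" for k :: "'b \<Rightarrow> 'c" and xs ys
    by (induction xs arbitrary: ys) auto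
  moreover obtain k where k: "\<And>x y. A x \<Longrightarrow> csize (h x y) \<le> (csize (x, y) + 2) ^ k"
    using h unfolding poly_time_def poly_bounded_def by fastforce
  have "poly_time A (\<lambda>x. foldl (\<lambda>acc y. h x y # acc) [] (l x))"
  proof (rule poly_time_foldl_add[where G = "\<lambda>x. (csize x + csize (l x) + 3) ^ k + 1"])
    show "poly_time (\<lambda>z. A (fst z)) (\<lambda>z. h (fst z) (snd (snd z)) # fst (snd z))"
    proof (intro pt_intros)
      show "poly_time (\<lambda>z :: 'a \<times> 'c list \<times> 'b. A (fst z)) (\<lambda>z. h (fst z) (snd (snd z)))"
        using poly_time_comp[OF h, of "\<lambda>z :: 'a \<times> 'c list \<times> 'b. A (fst z)" "\<lambda>z. (fst z, snd (snd z))"]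
        by (simp add: poly_time_Pair poly_time_fst poly_time_snd poly_time_id)
    qed
    fix x acc y assume x: "A x" "y \<in> set (l x)"
    have "csize (h x y) \<le> (csize (x, y) + 2) ^ k"
      by (rule k) fact
    also have "\<dots> \<le> (csize x + csize (l x) + 3) ^ k"
      using csize_elem[OF x(2)] by (intro power_mono) auto
    finally show "csize (h x y # acc) \<le> csize acc + ((csize x + csize (l x) + 3) ^ k + 1)"
      by simp
  qed (intro pb_intros pt_intros l)+
  ultimately show ?thesis
    using poly_time_rev[of A "\<lambda>x. foldl (\<lambda>acc y. h x y # acc) [] (l x)"] by simp
qed

lemma poly_time_concat [pt_intros]:
  assumes "poly_time A f"
  shows "poly_time A (\<lambda>x. concat (f x))"
proof -
  have "foldl (@) ys xs = ys @ concat xs" for xs :: "'b list list" and ys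
    by (induction xs arbitrary: ys) auto
  moreover have "poly_time A (\<lambda>x. foldl (@) [] (f x))"
    by (rule poly_time_foldl_add[where G = "\<lambda>x. csize (f x)"])
      (auto intro!: pt_intros pb_intros assms csize_elem)
  ultimately show ?thesis
    by simp
qed

lemma poly_time_filter [pt_intros]:
  assumes l: "poly_time A l" and h: "poly_time (\<lambda>z. A (fst z)) (\<lambda>z. h (fst z) (snd z))"
  shows "poly_time A (\<lambda>x. filter (h x) (l x))"
proof -
  have "concat (map (\<lambda>y. if k y then [y] else []) xs) = filter k xs" for k :: "'b \<Rightarrow> bool" and xs
    by (induction xs) auto
  moreover have "poly_time A (\<lambda>x. concat (map (\<lambda>y. if h x y then [y] else []) (l x)))"
    by (intro pt_intros l h)
  ultimately show ?thesis
    by simp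
qed


section \<open>Arithmetic in binary notation\<close>

text \<open>The bit list has the very code of the number, so the conversion is free and arithmetic
  becomes list processing.\<close>

function bits :: "nat \<Rightarrow> bool list" where
  "bits n = (if n = 0 then [] else odd n # bits (n div 2))"
  by auto
termination
  by (relation "measure id") auto

declare bits.simps [simp del]

lemma bits_0 [simp]: "bits 0 = []"
  by (simp add: bits.simps)

lemma code_bits: "code (bits n) = code n"
proof (induction n rule: less_induct)
  case (less n)
  then show ?case
    by (cases "n = 0") (auto simp: bits.simps[of n] code_nat_def enc_nat.simps[of n] enc_nat.simps[of 0] code_bool_def enc_bool_def)
qed

lemma poly_time_bits [pt_intros]: "poly_time A f \<Longrightarrow> poly_time A (\<lambda>x. bits (f x))"
  by (rule poly_time_comp'[of bits]) (auto intro!: poly_time_same simp: code_bits)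

lemma poly_time_eq_0 [pt_intros]: "poly_time A f \<Longrightarrow> poly_time A (\<lambda>x. f x = (0::nat))"
proof -
  have "(bits n = []) = (n = 0)" for n
    by (cases "n = 0") (auto simp: bits.simps[of n])
  then show "poly_time A f \<Longrightarrow> poly_time A (\<lambda>x. f x = (0::nat))"
    using poly_time_eq_Nil[OF poly_time_bits, of A f] by simp
qed

lemma poly_time_div2 [pt_intros]: "poly_time A f \<Longrightarrow> poly_time A (\<lambda>x. f x div (2::nat))"
  by (rule poly_time_comp'[of "\<lambda>n. n div 2"], rule poly_time_right)
    (auto simp: code_nat_def enc_nat.simps[of 0] enc_nat.simps)

lemma poly_time_odd [pt_intros]: "poly_time A f \<Longrightarrow> poly_time A (\<lambda>x. odd (f x :: nat))"
proof (rule poly_time_comp'[of "\<lambda>n. odd n"], rule poly_time_left)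
  show "code (odd n) = left (code n)" for n :: nat
    by (subst code_nat_def, subst enc_nat.simps) (auto simp: code_bool_def enc_bool_def)
qed

lemma code_double: "n \<noteq> 0 \<Longrightarrow> code (2 * n :: nat) = Node Leaf (code n)"
  "code (Suc (2 * n)) = Node (Node Leaf Leaf) (code n)"
  by (subst code_nat_def, subst enc_nat.simps, simp add: code_nat_def enc_bool_def)+

lemma code_0 [simp]: "code (0::nat) = Leaf"
  by (simp add: code_nat_def enc_nat.simps)

lemma code_nat_eq_Leaf_iff [simp]: "code (n::nat) = Leaf \<longleftrightarrow> n = 0"
  by (subst code_nat_def, subst enc_nat.simps) auto

lemma csize_double: "csize (2 * n :: nat) \<le> csize n + 1" "csize (Suc (2 * n)) = csize n + 2"
  by (cases "n = 0") (auto simp: code_double)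

lemma poly_time_double [pt_intros]:
  assumes "poly_time A f"
  shows "poly_time A (\<lambda>x. 2 * f x :: nat)"
proof (rule poly_time_comp'[OF _ assms], rule poly_time_expr)
  let ?e = "IfE (Var 0) (NodeE LeafE (Var 0)) (Var 0)"
  show "poly_bounded (\<lambda>_. True) (\<lambda>n::nat. csize (2 * n))"
    by (rule poly_bounded_mono[OF _ csize_double(1)]) (intro pb_intros)
  show "\<exists>t \<le> 5. eval [?e] [code n] ?e (code (2 * n)) t" for n :: nat
  proof (cases "n = 0")
    case True
    then show ?thesis
      using eval_IfFalse[OF eval_Var0 eval_Var0, of "[?e]" "[]" "NodeE LeafE (Var 0)"]
      by (auto intro!: exI[of _ "Suc (1 + 1)"])
  next
    case False
    then show ?thesis
      using eval_IfTrue[OF eval_Var0 _ eval_Node[OF eval_Leaf eval_Var0], of "code n" "[?e]" "[]" "Var 0"]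
      by (auto intro!: exI[of _ "Suc (1 + Suc (1 + 1))"] simp: code_double)
  qed
qed

lemma poly_time_Suc_double [pt_intros]:
  assumes "poly_time A f"
  shows "poly_time A (\<lambda>x. Suc (2 * f x))"
proof (rule poly_time_comp'[OF _ assms], rule poly_time_expr)
  let ?e = "NodeE (NodeE LeafE LeafE) (Var 0)"
  show "poly_bounded (\<lambda>_. True) (\<lambda>n::nat. csize (Suc (2 * n)))"
    unfolding csize_double by (intro pb_intros)
  show "\<exists>t \<le> 5. eval [?e] [code n] ?e (code (Suc (2 * n))) t" for n :: nat
    unfolding code_double
    by (intro exI[of _ "Suc (Suc (1 + 1) + 1)"] conjI eval_Node eval_Leaf eval_Var0) simp
qed

text \<open>Reads the most significant bit first, in contrast to \<open>bits\<close>; this is the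
  order in which a fold over low bits piles up its output.\<close>

definition append_bit :: "nat \<Rightarrow> bool \<Rightarrow> nat" where
  "append_bit r b = (if b then Suc (2 * r) else 2 * r)"

lemma poly_time_unbits [pt_intros]:
  assumes "poly_time A f"
  shows "poly_time A (\<lambda>x. foldl append_bit 0 (f x))"
proof (rule poly_time_foldl_add[where G = "\<lambda>_. 2"])
  show "csize (append_bit acc y) \<le> csize acc + 2" for acc y
    using csize_double[of acc] by (auto simp: append_bit_def)
qed (unfold append_bit_def, (intro pt_intros pb_intros assms)+)

lemma length_bits_le_csize: "length (bits n) \<le> csize n"
  using length_le_csize[of "bits n"] by (simp add: code_bits)

lemma csize_le_length_bits: "csize n \<le> 2 * length (bits n)"
proof -
  have "csize (xs :: bool list) \<le> 2 * length xs" for xs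
  proof (induction xs)
    case (Cons x xs)
    then show ?case
      by (cases x) auto
  qed simp
  then show ?thesis
    by (metis code_bits)
qed

lemma length_bits_mono: "m \<le> n \<Longrightarrow> length (bits m) \<le> length (bits n)"
proof (induction n arbitrary: m rule: less_induct)
  case (less n)
  show ?case
  proof (cases "m = 0")
    case False
    with less.prems have "length (bits (m div 2)) \<le> length (bits (n div 2))"
      by (intro less.IH div_le_mono) auto
    with False less.prems show ?thesis
      by (simp add: bits.simps[of m] bits.simps[of n])
  qed simp
qed

text \<open>A zero bit has a smaller code than a one bit, so \<open>csize\<close> itself is not
  monotone. The number of bits is, and it agrees with \<open>csize\<close> up to a factor of
  2.\<close>

lemma csize_nat_mono: "m \<le> n \<Longrightarrow> csize m \<le> 2 * csize (n :: nat)"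
  using csize_le_length_bits[of m] length_bits_mono[of m n] length_bits_le_csize[of n] by linarith

lemma less_power_length_bits: "n < 2 ^ length (bits n)"
proof (induction n rule: less_induct)
  case (less n)
  show ?case
  proof (cases "n = 0")
    case False
    then have "n div 2 < 2 ^ length (bits (n div 2))"
      by (intro less.IH) auto
    with False show ?thesis
      by (simp add: bits.simps[of n])
  qed simp
qed

text \<open>A full adder. The state holds the unread parts of both summands, the carry, and the sum
  bits so far with the most significant one in front.\<close>

definition add_step :: "nat \<times> nat \<times> bool \<times> bool list \<Rightarrow> nat \<times> nat \<times> bool \<times> bool list" where
  "add_step = (\<lambda>(m, n, c, out). (m div 2, n div 2,
     (odd m \<and> odd n) \<or> (c \<and> (odd m \<or> odd n)),
     (if odd m then if odd n then c else \<not> c else if odd n then \<not> c else c) # out))"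

text \<open>The list \<open>bits m @ bits n @ [True]\<close> is only a clock. It may tick too often,
  since surplus zeros at the front do not change the value read by
  \<open>append_bit\<close>.\<close>

definition add_bits :: "nat \<Rightarrow> nat \<Rightarrow> nat" where
  "add_bits m n = foldl append_bit 0
     (snd (snd (snd (foldl (\<lambda>acc _. add_step acc) (m, n, False, []) (bits m @ bits n @ [True])))))"

text \<open>The value \<open>S\<close> of the unread sum followed by the output bits is invariant,
  while the unread sum \<open>R\<close>, carry included, is halved in each step. The clock is long
  enough to bring \<open>R\<close> to 0, and then \<open>S\<close> is the value of the output
  alone.\<close>

lemma add_bits_eq: "add_bits m n = m + n"
proof -
  define S where "S = (\<lambda>(m, n, c, out). foldl append_bit (m + n + of_bool c) out)"
  define R where "R = (\<lambda>(m :: nat, n :: nat, c, out :: bool list). m + n + of_bool c :: nat)"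
  have step: "S (add_step z) = S z" "R (add_step z) = R z div 2" for z
  proof -
    obtain m n c out where z: "z = (m, n, c, out)"
      by (metis prod_cases4)
    show "S (add_step z) = S z"
      unfolding S_def z add_step_def append_bit_def
      by (cases c; cases "odd m"; cases "odd n") (auto elim!: oddE evenE intro!: arg_cong[of _ _ "\<lambda>x. foldl _ x _"])
    show "R (add_step z) = R z div 2"
      unfolding R_def z add_step_def
      by (cases c; cases "odd m"; cases "odd n") (auto elim!: oddE evenE)
  qed
  have fold: "S (foldl (\<lambda>acc _. add_step acc) z xs) = S z"
    "R (foldl (\<lambda>acc _. add_step acc) z xs) = R z div 2 ^ length xs" for z and xs :: "bool list"
    by (induction xs arbitrary: z) (auto simp: step div_mult2_eq)
  let ?z = "foldl (\<lambda>acc _. add_step acc) (m, n, False, []) (bits m @ bits n @ [True])"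
  have "m + n < 2 ^ length (bits m) + 2 ^ length (bits n)"
    using less_power_length_bits[of m] less_power_length_bits[of n] by linarith
  also have "\<dots> \<le> 2 ^ (length (bits m) + length (bits n)) + 2 ^ (length (bits m) + length (bits n))"
    by (intro add_mono power_increasing) auto
  finally have "R ?z = 0"
    unfolding fold by (simp add: R_def)
  then have "S ?z = add_bits m n"
    unfolding add_bits_def S_def R_def by (auto simp: case_prod_beta split: if_splits)
  then show ?thesis
    unfolding fold by (simp add: S_def)
qed

lemma csize_div2: "csize (n div 2) \<le> csize (n :: nat)"
  by (cases "n = 0") (simp_all add: code_nat_def enc_nat.simps[of n])

lemma csize_bool: "csize b \<le> csize c + 1" for b c :: bool
  by (cases b; cases c) auto

lemma poly_time_plus [pt_intros]:
  assumes "poly_time A f" "poly_time A g"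
  shows "poly_time A (\<lambda>x. f x + g x :: nat)"
  unfolding add_bits_eq[symmetric] add_bits_def
proof (intro pt_intros, rule poly_time_foldl_add[where G = "\<lambda>_. 3"])
  show "csize (add_step acc) \<le> csize acc + 3" for acc
  proof -
    obtain m n c out where acc: "acc = (m, n, c, out)"
      by (metis prod_cases4)
    have "csize (m div 2, n div 2, c', b # out) \<le> csize (m, n, c, out) + 3" for b c' :: bool
      using csize_div2[of m] csize_div2[of n] csize_bool[of c' c] by (cases b) simp_all
    then show ?thesis
      unfolding acc add_step_def split_conv .
  qed
qed (unfold add_step_def case_prod_beta, (intro pt_intros pb_intros assms)+)

text \<open>Bits of the left number are read from the low end; the flag tells whether its part read
  so far is at most that of the right number. A nonzero rest of the right number at the end decides
  the comparison by itself.\<close>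

definition le_step :: "nat \<times> bool \<Rightarrow> bool \<Rightarrow> nat \<times> bool" where
  "le_step p b = (fst p div 2, if b then odd (fst p) \<and> snd p else odd (fst p) \<or> snd p)"

definition le_bits :: "nat \<Rightarrow> nat \<Rightarrow> bool" where
  "le_bits m n = (let p = foldl le_step (n, True) (bits m) in fst p \<noteq> 0 \<or> snd p)"

text \<open>The flag \<open>r\<close> stands for the comparison of lower bits read earlier, which
  counts only if the unread parts agree.\<close>

lemma foldl_le_step:
  "fst (foldl le_step (n, r) (bits m)) \<noteq> 0 \<or> snd (foldl le_step (n, r) (bits m)) \<longleftrightarrow> m < n \<or> m = n \<and> r"
proof (induction m arbitrary: n r rule: less_induct)
  case (less m)
  show ?case
  proof (cases "m = 0")
    case False
    define r' where "r' = (if odd m then odd n \<and> r else odd n \<or> r)"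
    have "fst (foldl le_step (n, r) (bits m)) \<noteq> 0 \<or> snd (foldl le_step (n, r) (bits m)) \<longleftrightarrow>
        m div 2 < n div 2 \<or> m div 2 = n div 2 \<and> r'"
    proof -
      have "le_step (n, r) (odd m) = (n div 2, r')"
        by (simp add: le_step_def r'_def)
      with False have "foldl le_step (n, r) (bits m) = foldl le_step (n div 2, r') (bits (m div 2))"
        by (simp only: bits.simps[of m] if_False foldl_Cons)
      then show ?thesis
        using less[of "m div 2" "n div 2" r'] False by simp
    qed
    moreover have "a < b \<or> a = b \<and> (if p then q \<and> r else q \<or> r) \<longleftrightarrow>
        2 * a + of_bool p < 2 * b + of_bool q \<or> 2 * a + of_bool p = 2 * b + of_bool q \<and> r"
      for a b :: nat and p q
      by (cases p; cases q; cases r) (auto simp: less_Suc_eq_le le_less dest: arg_cong[of _ _ odd])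
    from this[of "m div 2" "n div 2" "odd m" "odd n"]
    have "m div 2 < n div 2 \<or> m div 2 = n div 2 \<and> r' \<longleftrightarrow> m < n \<or> m = n \<and> r"
      unfolding r'_def by (simp add: mod_2_eq_odd[symmetric] del: of_bool_odd_eq_mod_2)
    ultimately show ?thesis
      by blast
  qed auto
qed

lemma le_bits_eq: "le_bits m n \<longleftrightarrow> m \<le> n"
  unfolding le_bits_def Let_def foldl_le_step by auto

lemma poly_time_le [pt_intros]:
  assumes "poly_time A f" "poly_time A g"
  shows "poly_time A (\<lambda>x. f x \<le> (g x :: nat))"
  unfolding le_bits_eq[symmetric] le_bits_def
proof (rule poly_time_Let, rule poly_time_foldl_add[where G = "\<lambda>_. 1"])
  show "csize (le_step acc y) \<le> csize acc + 1" for acc y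
    using csize_div2[of "fst acc"] csize_bool[of "snd (le_step acc y)" "snd acc"]
    by (cases acc) (simp add: le_step_def)
qed (unfold le_step_def, (intro pt_intros pb_intros assms)+)

lemma poly_time_eq_nat [pt_intros]:
  "poly_time A f \<Longrightarrow> poly_time A g \<Longrightarrow> poly_time A (\<lambda>x. f x = (g x :: nat))"
  unfolding eq_iff by (intro pt_intros)

lemma poly_time_max [pt_intros]:
  "poly_time A f \<Longrightarrow> poly_time A g \<Longrightarrow> poly_time A (\<lambda>x. max (f x) (g x :: nat))"
  unfolding max_def by (intro pt_intros)

definition mult_step :: "nat \<times> nat \<Rightarrow> bool \<Rightarrow> nat \<times> nat" where
  "mult_step p b = (2 * fst p, if b then snd p + fst p else snd p)"

lemma foldl_mult_step: "snd (foldl mult_step (n, s) (bits m)) = s + m * n"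
proof (induction m arbitrary: n s rule: less_induct)
  case (less m)
  show ?case
  proof (cases "m = 0")
    case False
    then have "snd (foldl mult_step (n, s) (bits m)) = (if odd m then s + n else s) + (m div 2) * (2 * n)"
    proof -
      have "mult_step (n, s) (odd m) = (2 * n, if odd m then s + n else s)"
        by (simp add: mult_step_def)
      with False have "foldl mult_step (n, s) (bits m) =
          foldl mult_step (2 * n, if odd m then s + n else s) (bits (m div 2))"
        by (simp only: bits.simps[of m] if_False foldl_Cons)
      then show ?thesis
        using less[of "m div 2"] False by simp
    qed
    also have "\<dots> = s + m * n"
      by (auto elim!: oddE evenE simp: algebra_simps)
    finally show ?thesis .
  qed simp
qed

text \<open>Size control for shift-and-add: \<open>s \<le> n\<close> gives
  \<open>s + n \<le> 2 * n\<close>, so the partial sum never overtakes the shifted factor.\<close>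

lemma foldl_mult_step_le:
  "s \<le> n \<Longrightarrow> fst (foldl mult_step (n, s) xs) = n * 2 ^ length xs \<and>
     snd (foldl mult_step (n, s) xs) \<le> n * 2 ^ length xs"
proof (induction xs arbitrary: n s)
  case (Cons b xs)
  have "foldl mult_step (n, s) (b # xs) = foldl mult_step (2 * n, if b then s + n else s) xs"
    by (simp add: mult_step_def)
  moreover have "(if b then s + n else s) \<le> 2 * n"
    using Cons.prems by simp
  ultimately show ?case
    using Cons.IH[of "if b then s + n else s" "2 * n"] by (simp only: list.size mult_ac power_add power_one_right) simp
qed simp

lemma csize_mult_power: "csize (n * 2 ^ k :: nat) \<le> csize n + k"
proof (induction k)
  case (Suc k)
  then show ?case
    using csize_double(1)[of "n * 2 ^ k"] by (simp add: mult_ac)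
qed simp

lemma poly_time_times [pt_intros]:
  assumes "poly_time A f" "poly_time A g"
  shows "poly_time A (\<lambda>x. f x * g x :: nat)"
proof -
  have "poly_time A (\<lambda>x. snd (foldl mult_step (g x, 0) (bits (f x))))"
  proof (intro pt_intros, rule poly_time_foldl)
    show "poly_bounded A (\<lambda>x. 1 + (csize (g x) + csize (f x)) + 2 * (csize (g x) + csize (f x)))"
      by (intro pb_intros assms)
    fix x k assume "k \<le> length (bits (f x))"
    moreover obtain a s where z: "foldl mult_step (g x, 0) (take k (bits (f x))) = (a, s)"
      by fastforce
    ultimately have "a = g x * 2 ^ k" "s \<le> a"
      using foldl_mult_step_le[of 0 "g x" "take k (bits (f x))"] by (auto simp: min_absorb2)
    then have "csize a \<le> csize (g x) + csize (f x)" "csize s \<le> 2 * csize a"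
      using csize_mult_power[of "g x" k] \<open>k \<le> _\<close> length_bits_le_csize[of "f x"] csize_nat_mono[of s a]
      by auto
    then show "csize (foldl mult_step (g x, 0) (take k (bits (f x)))) \<le>
        1 + (csize (g x) + csize (f x)) + 2 * (csize (g x) + csize (f x))"
      unfolding z by simp
  qed (unfold mult_step_def, (intro pt_intros assms)+)
  then show ?thesis
    by (simp add: foldl_mult_step)
qed

section \<open>Rational inputs and minimal elements\<close>

lemma poly_time_numerator [pt_intros]:
  "poly_time A f \<Longrightarrow> poly_time A (\<lambda>x. nat (fst (quotient_of (f x))))"
  by (rule poly_time_comp'[of "\<lambda>r. nat (fst (quotient_of r))"])
    (auto intro!: poly_time_left simp: code_rat_def code_nat_def enc_rat_def case_prod_beta)

lemma poly_time_denominator [pt_intros]: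
  "poly_time A f \<Longrightarrow> poly_time A (\<lambda>x. nat (snd (quotient_of (f x))))"
  by (rule poly_time_comp'[of "\<lambda>r. nat (snd (quotient_of r))"])
    (auto intro!: poly_time_right simp: code_rat_def code_nat_def enc_rat_def case_prod_beta)

text \<open>An optional minimum, represented by a list of at most one element so that its code is
  already available.\<close>

definition best :: "(nat \<times> 'b) list \<Rightarrow> (nat \<times> 'b) list" where
  "best = foldl (\<lambda>acc p. case acc of [] \<Rightarrow> [p] | q # _ \<Rightarrow> if fst q \<le> fst p then acc else [p]) []"

lemma best_cases:
  obtains "xs = []" "best xs = []" |
    q where "best xs = [q]" "q \<in> set xs" "\<And>p. p \<in> set xs \<Longrightarrow> fst q \<le> fst p"
proof -
  have "(xs = [] \<and> best xs = []) \<or> (\<exists>q. best xs = [q] \<and> q \<in> set xs \<and> (\<forall>p \<in> set xs. fst q \<le> fst p))"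
  proof (induction xs rule: rev_induct)
    case (snoc x xs)
    have b: "best (xs @ [x]) = (case best xs of [] \<Rightarrow> [x] | q # _ \<Rightarrow> if fst q \<le> fst x then best xs else [x])"
      by (simp only: best_def foldl_append foldl_Cons foldl_Nil)
    show ?case
    proof (cases "best xs = []")
      case True
      with b have "best (xs @ [x]) = [x]"
        by simp
      with snoc True show ?thesis
        by (intro disjI2 exI[of _ x]) auto
    next
      case False
      then obtain q where q: "best xs = [q]" "q \<in> set xs" "\<forall>p \<in> set xs. fst q \<le> fst p"
        using snoc by auto
      show ?thesis
      proof (cases "fst q \<le> fst x")
        case True
        with q b have "best (xs @ [x]) = [q]"
          by simp
        with q True show ?thesis
          by auto
      next
        case False
        then have "best (xs @ [x]) = [x]" "\<forall>p \<in> set (xs @ [x]). fst x \<le> fst p"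
          using q b by (auto intro: order_trans)
        then show ?thesis
          by simp
      qed
    qed
  qed (simp add: best_def)
  then show thesis
    using that by blast
qed

lemma poly_time_best [pt_intros]:
  assumes "poly_time A f"
  shows "poly_time A (\<lambda>x. best (f x))"
  unfolding best_def
proof (rule poly_time_foldl_add[where G = "\<lambda>x. csize (f x) + 1"])
  fix x acc and y :: "nat \<times> 'b"
  assume "y \<in> set (f x)"
  then show "csize (case acc of [] \<Rightarrow> [y] | q # _ \<Rightarrow> if fst q \<le> fst y then acc else [y]) \<le> csize acc + (csize (f x) + 1)"
    using csize_elem[of y "f x"] by (auto split: list.split)
qed (intro pt_intros pb_intros assms)+

section \<open>Walks and their delays\<close>

text \<open>Walks reduced to their ends and their total delay. The empty walk exists at every point,
  also outside \<open>Field A\<close>, so isolated vertices need no special treatment.\<close>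

inductive reach :: "('a \<times> 'a) set \<Rightarrow> ('a \<times> 'a \<Rightarrow> nat) \<Rightarrow> 'a \<Rightarrow> nat \<Rightarrow> 'a \<Rightarrow> bool"
  for A w where
  reach_refl: "reach A w u 0 u"
| reach_step: "reach A w u x v \<Longrightarrow> (v, z) \<in> A \<Longrightarrow> reach A w u (x + w (v, z)) z"

lemma reach_arc: "(u, v) \<in> A \<Longrightarrow> reach A w u (w (u, v)) v"
  using reach_step[OF reach_refl] by fastforce

lemma reach_trans: "reach A w v y z \<Longrightarrow> reach A w u x v \<Longrightarrow> reach A w u (x + y) z"
proof (induction rule: reach.induct)
  case (reach_step v y z z')
  then show ?case
    using reach.reach_step[of A w u "x + y" z z'] by (simp add: add.assoc)
qed simp

lemma reach_mono:
  "reach A w u x v \<Longrightarrow> A \<subseteq> A' \<Longrightarrow> (\<And>e. e \<in> A \<Longrightarrow> w' e = w e) \<Longrightarrow> reach A' w' u x v"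
proof (induction rule: reach.induct)
  case (reach_step u x v z)
  then have "reach A' w' u (x + w' (v, z)) z"
    by (intro reach.reach_step) auto
  with reach_step show ?case
    by simp
qed (rule reach_refl)

lemma reach_trancl: "reach A w u x v \<Longrightarrow> x = 0 \<and> u = v \<or> (u, v) \<in> A\<^sup>+"
  by (induction rule: reach.induct) (auto intro: trancl_into_trancl)

lemma reach_Field: "reach A w u x v \<Longrightarrow> x = 0 \<and> u = v \<or> u \<in> Field A \<and> v \<in> Field A"
  by (induction rule: reach.induct) (auto simp: Field_def)

lemma reach_closed: "acyclic A \<Longrightarrow> reach A w u x u \<Longrightarrow> x = 0"
  by (auto simp: acyclic_def dest: reach_trancl)

text \<open>The arc \<open>(s, r)\<close> is the only link between the two parts and cannot be used
  backwards, so a walk stays on one side or crosses exactly once.\<close>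

lemma reach_join:
  assumes disj: "Field S \<inter> Field R = {}" "s \<notin> Field R" "r \<notin> Field S" "s \<noteq> r"
  assumes "reach (insert (s, r) (S \<union> R)) w u x z"
  shows "reach R w u x z \<or> reach S w u x z \<or>
    (\<exists>y y'. reach S w u y s \<and> reach R w r y' z \<and> x = y + w (s, r) + y')"
  using assms(5)
proof (induction rule: reach.induct)
  case (reach_refl u)
  then show ?case
    by (simp add: reach.reach_refl)
next
  case (reach_step u x y z)
  from reach_step(2) consider "(y, z) \<in> R" | "(y, z) \<in> S" | "y = s" "z = r"
    by auto
  then show ?case
  proof cases
    case 1
    then have y: "y \<in> Field R" "y \<notin> Field S"
      using disj by (auto simp: Field_def)
    from reach_step.IH show ?thesis
    proof (elim disjE exE conjE)
      fix y1 y2 assume 2: "reach S w u y1 s" "reach R w r y2 y" "x = y1 + w (s, r) + y2"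
      then have "x + w (y, z) = y1 + w (s, r) + (y2 + w (y, z))"
        by simp
      with 2(1) reach.reach_step[OF 2(2) 1] show ?thesis
        by blast
    next
      assume "reach R w u x y"
      from reach.reach_step[OF this 1] show ?thesis
        by blast
    next
      assume "reach S w u x y"
      \<comment> \<open>A walk of \<open>S\<close> that ends outside \<open>Field S\<close> is
        empty.\<close>
      then have "x = 0" "u = y"
        using y reach_Field[of S w u x y] by auto
      then show ?thesis
        using reach_arc[OF 1, of w] by simp
    qed
  next
    case 2
    then have y: "y \<in> Field S" "y \<notin> Field R" "y \<noteq> r"
      using disj by (auto simp: Field_def)
    from reach_step.IH show ?thesis
    proof (elim disjE exE conjE)
      fix y1 y2 assume "reach R w r y2 y"
      then show ?thesis
        using y reach_Field[of R w r y2 y] by auto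
    next
      assume "reach R w u x y"
      then have "x = 0" "u = y"
        using y reach_Field[of R w u x y] by auto
      then show ?thesis
        using reach_arc[OF 2, of w] by simp
    next
      assume "reach S w u x y"
      from reach.reach_step[OF this 2] show ?thesis
        by blast
    qed
  next
    case 3
    from reach_step.IH show ?thesis
    proof (elim disjE exE conjE)
      fix y1 y2 assume "reach R w r y2 y"
      then show ?thesis
        using 3 disj reach_Field[of R w r y2 y] by auto
    next
      assume "reach R w u x y"
      then have "x = 0" "u = y"
        using 3 disj reach_Field[of R w u x y] by auto
      then show ?thesis
        using 3 reach_refl[of S w s] reach_refl[of R w r] by fastforce
    next
      assume "reach S w u x y"
      then show ?thesis
        using 3 reach_refl[of R w r] by fastforce
    qed
  qed
qed

definition feasible :: "('a \<times> 'a) set \<Rightarrow> ('a \<times> 'a \<Rightarrow> nat) \<Rightarrow> nat \<Rightarrow> bool" where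
  "feasible A w T \<longleftrightarrow> (\<forall>u x v. reach A w u x v \<longrightarrow> x \<le> T)"

text \<open>Upper bounds rather than maxima: soundness of a choice asks for no more, and that the
  recorded delays are not too large is expressed by witness walks in
  \<open>choices_complete\<close>.\<close>

definition in_bound :: "('a \<times> 'a) set \<Rightarrow> ('a \<times> 'a \<Rightarrow> nat) \<Rightarrow> 'a \<Rightarrow> nat \<Rightarrow> bool" where
  "in_bound A w v a \<longleftrightarrow> (\<forall>u x. reach A w u x v \<longrightarrow> x \<le> a)"

definition out_bound :: "('a \<times> 'a) set \<Rightarrow> ('a \<times> 'a \<Rightarrow> nat) \<Rightarrow> 'a \<Rightarrow> nat \<Rightarrow> bool" where
  "out_bound A w v b \<longleftrightarrow> (\<forall>u x. reach A w v x u \<longrightarrow> x \<le> b)"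

lemma bounds_cong:
  assumes "\<And>e. e \<in> A \<Longrightarrow> w' e = w e"
  shows "feasible A w' T = feasible A w T" "in_bound A w' v a = in_bound A w v a"
    "out_bound A w' v b = out_bound A w v b"
proof -
  have "reach A w' u x v = reach A w u x v" for u x v
    using reach_mono[of A w u x v A w'] reach_mono[of A w' u x v A w] assms by auto
  then show "feasible A w' T = feasible A w T" "in_bound A w' v a = in_bound A w v a"
    "out_bound A w' v b = out_bound A w v b"
    unfolding feasible_def in_bound_def out_bound_def by simp_all
qed

text \<open>A walk of the joined part that crosses the arc consists of a walk into \<open>s\<close>,
  the arc and a walk out of \<open>r\<close>. If it starts at \<open>s\<close> or ends at
  \<open>r\<close>, one of these pieces is closed, and acyclicity gives it delay 0. That is why the
  bounds at either end of the arc change in one direction only.\<close>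

lemma bounds_join:
  assumes disj: "Field S \<inter> Field R = {}" "s \<notin> Field R" "r \<notin> Field S" "s \<noteq> r"
  assumes acyc: "acyclic S" "acyclic R"
  assumes S: "in_bound S w s a" "out_bound S w s b" "feasible S w T"
  assumes R: "in_bound R w r a'" "out_bound R w r b'" "feasible R w T"
  assumes T: "a + w (s, r) + b' \<le> T"
  defines "J \<equiv> insert (s, r) (S \<union> R)"
  shows "in_bound J w r (max a' (a + w (s, r)))" "out_bound J w r b'"
    "in_bound J w s a" "out_bound J w s (max b (b' + w (s, r)))" "feasible J w T"
proof -
  note split = reach_join[OF disj, of w, folded J_def]
  have F: "reach S w u x r \<longleftrightarrow> x = 0 \<and> u = r" "reach S w r x u \<longleftrightarrow> x = 0 \<and> u = r"
    "reach R w u x s \<longleftrightarrow> x = 0 \<and> u = s" "reach R w s x u \<longleftrightarrow> x = 0 \<and> u = s" for u x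
    using disj reach_Field[of S w u x r] reach_Field[of S w r x u]
      reach_Field[of R w u x s] reach_Field[of R w s x u] reach_refl by auto
  have bounds: "reach S w u x s \<Longrightarrow> x \<le> a" "reach S w s x u \<Longrightarrow> x \<le> b" "reach S w u x v \<Longrightarrow> x \<le> T"
    "reach R w u x r \<Longrightarrow> x \<le> a'" "reach R w r x u \<Longrightarrow> x \<le> b'" "reach R w u x v \<Longrightarrow> x \<le> T" for u x v
    using S R unfolding in_bound_def out_bound_def feasible_def by metis+
  have closed: "reach S w s x s \<Longrightarrow> x = 0" "reach R w r x r \<Longrightarrow> x = 0" for x
    using acyc by (auto dest: reach_closed)
  have "x \<le> max a' (a + w (s, r))" if "reach J w u x r" for u x
    using split[OF that]
  proof (elim disjE exE conjE)
    fix y y' assume "reach S w u y s" "reach R w r y' r" "x = y + w (s, r) + y'"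
    then show ?thesis
      using bounds(1)[of u y] closed(2)[of y'] by simp
  next
    assume "reach R w u x r"
    then show ?thesis
      using bounds(4)[of u x] by simp
  qed (simp add: F)
  then show "in_bound J w r (max a' (a + w (s, r)))"
    by (simp add: in_bound_def)
  have "x \<le> b'" if "reach J w r x u" for u x
    using split[OF that]
  proof (elim disjE exE conjE)
    fix y y' assume "reach S w r y s"
    then show ?thesis
      using disj(3,4) reach_Field[of S w r y s] by auto
  next
    assume "reach R w r x u"
    then show ?thesis
      using bounds(5)[of x u] by simp
  qed (simp add: F)
  then show "out_bound J w r b'"
    by (simp add: out_bound_def)
  have "x \<le> a" if "reach J w u x s" for u x
    using split[OF that]
  proof (elim disjE exE conjE)
    fix y y' assume "reach R w r y' s"
    then show ?thesis
      using disj(2,4) reach_Field[of R w r y' s] by auto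
  next
    assume "reach S w u x s"
    then show ?thesis
      using bounds(1)[of u x] by simp
  qed (simp add: F)
  then show "in_bound J w s a"
    by (simp add: in_bound_def)
  have "x \<le> max b (b' + w (s, r))" if "reach J w s x u" for u x
    using split[OF that]
  proof (elim disjE exE conjE)
    fix y y' assume "reach S w s y s" "reach R w r y' u" "x = y + w (s, r) + y'"
    then show ?thesis
      using bounds(5)[of y' u] closed(1)[of y] by simp
  next
    assume "reach S w s x u"
    then show ?thesis
      using bounds(2)[of x u] by simp
  qed (simp add: F)
  then show "out_bound J w s (max b (b' + w (s, r)))"
    by (simp add: out_bound_def)
  show "feasible J w T"
    unfolding feasible_def
  proof (intro allI impI)
    fix u x z assume "reach J w u x z"
    from split[OF this] show "x \<le> T"
    proof (elim disjE exE conjE)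
      fix y y' assume "reach S w u y s" "reach R w r y' z" "x = y + w (s, r) + y'"
      then show "x \<le> T"
        using bounds(1)[of u y] bounds(5)[of y' z] T by linarith
    qed (use bounds(3)[of u x z] bounds(6)[of u x z] in auto)
  qed
qed

text \<open>Consecutive arcs share a vertex, so a walk cannot change between blocks with disjoint
  fields.\<close>

lemma reach_Union:
  assumes "\<And>v v'. v \<noteq> v' \<Longrightarrow> Field (B v) \<inter> Field (B v') = {}"
  assumes "reach (\<Union>v. B v) w u x z"
  shows "x = 0 \<and> u = z \<or> (\<exists>v. reach (B v) w u x z)"
  using assms(2)
proof (induction rule: reach.induct)
  case (reach_step u x y z)
  from reach_step(2) obtain v where v: "(y, z) \<in> B v"
    by auto
  from reach_step.IH show ?case
  proof (elim disjE exE)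
    fix v' assume v': "reach (B v') w u x y"
    show ?thesis
    proof (cases "v' = v")
      case True
      with v v' show ?thesis
        by (auto intro: reach.reach_step)
    next
      case False
      then have "y \<notin> Field (B v')"
        using assms(1)[of v' v] v by (auto simp: Field_def)
      with reach_Field[OF v'] v show ?thesis
        by (auto intro: reach_arc)
    qed
  qed (use v in \<open>auto intro: reach_arc\<close>)
qed auto


section \<open>The algorithm\<close>

definition matching :: "('a \<times> 'a) set \<Rightarrow> bool" where
  "matching N \<longleftrightarrow> (\<forall>e \<in> N. \<forall>f \<in> N. e \<noteq> f \<longrightarrow> {fst e, snd e} \<inter> {fst f, snd f} = {})"

definition delay_of :: "nat \<Rightarrow> nat \<Rightarrow> ('a \<times> 'a) set \<Rightarrow> 'a \<times> 'a \<Rightarrow> nat" where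
  "delay_of d D N e = (if e \<in> N then d else D)"

type_synonym choice = "bool \<times> nat \<times> nat \<times> nat list list"

abbreviation "matched \<equiv> (fst :: choice \<Rightarrow> _)"
abbreviation "delay_in (z :: choice) \<equiv> fst (snd z)"
abbreviation "delay_out (z :: choice) \<equiv> fst (snd (snd z))"
abbreviation "pairs (z :: choice) \<equiv> snd (snd (snd z))"

text \<open>A vertex without an entry has absorbed nothing, and its default is the one choice of an
  isolated vertex. This differs from an empty entry, which means that no matching of the absorbed
  part meets the bound.\<close>

definition lookup :: "(nat \<times> choice list) list \<Rightarrow> nat \<Rightarrow> choice list" where
  "lookup tab v = (case filter (\<lambda>p. fst p = v) tab of [] \<Rightarrow> [(False, 0, 0, [])] | p # _ \<Rightarrow> snd p)"

text \<open>The flag \<open>b\<close> tells whether the arc points from the leaf to its neighbour.\<close>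

definition join :: "bool \<Rightarrow> nat \<Rightarrow> bool \<Rightarrow> nat list list \<Rightarrow> choice \<Rightarrow> choice \<Rightarrow> choice" where
  "join b w m E z q = (matched z \<or> m,
     if b then max (delay_in z) (delay_in q + w) else delay_in z,
     if b then delay_out z else max (delay_out z) (delay_out q + w),
     E @ pairs z @ pairs q)"

definition cheapest :: "bool \<Rightarrow> choice list \<Rightarrow> choice list" where
  "cheapest b zs = map snd (best (map (\<lambda>z. (if b then delay_in z else delay_out z, z)) zs))"

text \<open>Every walk that crosses the new arc passes through the surviving end. Hence the test on
  the sum of the two delays there checks all new walks at once, while walks inside either part were
  checked before.\<close>

definition join_choices :: "nat \<Rightarrow> nat \<Rightarrow> nat \<Rightarrow> bool \<Rightarrow> nat list \<Rightarrow> choice list \<Rightarrow> choice list \<Rightarrow> choice list" where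
  "join_choices T d D b E zs qs = filter (\<lambda>z. delay_in z + delay_out z \<le> T)
     (concat (map (\<lambda>z. map (\<lambda>q. join b D False [] z q) (cheapest b qs) @
       (if matched z then [] else
         map (\<lambda>q. join b d True [E] z q) (cheapest b (filter (\<lambda>q. \<not> matched q) qs)))) zs))"

definition other_end :: "nat \<Rightarrow> nat \<times> nat \<Rightarrow> nat" where
  "other_end c a = (if c = fst a then snd a else fst a)"

text \<open>
  Newer table entries shadow older ones. Resetting the absorbed leaf \<open>c\<close> to the choice of an isolated
  vertex moves its whole part to \<open>p\<close>, so that in the end all vertices can be treated alike.
\<close>

definition absorb :: "nat \<Rightarrow> nat \<Rightarrow> nat \<Rightarrow> (nat \<times> choice list) list \<Rightarrow> nat \<times> nat \<times> nat \<Rightarrow> (nat \<times> choice list) list" where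
  "absorb T d D tab e = (let c = fst e; a = snd e; p = other_end c a in
     (c, [(False, 0, 0, [])]) #
     (p, join_choices T d D (c = fst a) [fst a, snd a] (lookup tab p) (lookup tab c)) # tab)"

definition table :: "nat \<Rightarrow> nat \<Rightarrow> nat \<Rightarrow> (nat \<times> nat \<times> nat) list \<Rightarrow> (nat \<times> choice list) list" where
  "table T d D es = foldl (absorb T d D) [] es"

text \<open>All choices that survive in the table respect \<open>T\<close>, so the first one at each
  vertex will do; an empty entry refutes \<open>T\<close>. The result carries \<open>T\<close> as
  the key by which \<open>best\<close> compares.\<close>

definition collect :: "nat \<Rightarrow> nat list \<Rightarrow> (nat \<times> choice list) list \<Rightarrow> (nat \<times> nat list list) list" where
  "collect T vs tab = (let zss = map (lookup tab) vs in
     if filter (\<lambda>zs. zs = []) zss = []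
     then [(T, concat (map (\<lambda>zs. case zs of [] \<Rightarrow> [] | z # _ \<Rightarrow> pairs z) zss))] else [])"

definition incident :: "'a \<Rightarrow> 'a \<times> 'a \<Rightarrow> bool" where
  "incident v a \<longleftrightarrow> fst a = v \<or> snd a = v"

text \<open>An entry \<open>(c, a)\<close> removes the vertex \<open>c\<close> together with
  \<open>a\<close>, its only remaining arc: leaf pruning of a forest in list form.\<close>

primrec elimination :: "('a \<times> 'a \<times> 'a) list \<Rightarrow> bool" where
  "elimination [] = True"
| "elimination (e # es) \<longleftrightarrow> incident (fst e) (snd e) \<and> fst (snd e) \<noteq> snd (snd e) \<and>
     (\<forall>e' \<in> set es. \<not> incident (fst e) (snd e')) \<and> elimination es"

section \<open>Elementary properties of table entries and joined choices\<close>

lemma lookup_Nil: "lookup [] v = [(False, 0, 0, [])]"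
  by (simp add: lookup_def)

lemma lookup_absorb:
  "lookup (absorb T d D tab (c, a)) v = (if v = c then [(False, 0, 0, [])]
     else if v = other_end c a
     then join_choices T d D (c = fst a) [fst a, snd a] (lookup tab (other_end c a)) (lookup tab c)
     else lookup tab v)"
  by (simp add: lookup_def absorb_def Let_def)

lemma cheapest_cases:
  obtains "zs = []" "cheapest b zs = []" |
    q where "cheapest b zs = [q]" "q \<in> set zs"
      "\<And>z. z \<in> set zs \<Longrightarrow> (if b then delay_in q else delay_out q) \<le> (if b then delay_in z else delay_out z)"
proof (cases rule: best_cases[of "map (\<lambda>z. (if b then delay_in z else delay_out z, z)) zs"])
  case (2 q)
  then show ?thesis
    using that(2)[of "snd q"] unfolding cheapest_def by fastforce
qed (use that(1) in \<open>simp add: cheapest_def\<close>)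

lemma set_cheapest: "set (cheapest b zs) \<subseteq> set zs"
  by (rule cheapest_cases[of zs b]) auto

text \<open>The flag \<open>m\<close> tells whether the new arc is made cheap; with it both kinds of
  joined choices are handled by one formula.\<close>

lemma join_choices_elim:
  assumes "z' \<in> set (join_choices T d D b E zs qs)"
  obtains z q m where "z \<in> set zs" "q \<in> set qs" "m \<Longrightarrow> \<not> matched z \<and> \<not> matched q"
    "z' = join b (if m then d else D) m (if m then [E] else []) z q" "delay_in z' + delay_out z' \<le> T"
proof -
  from assms obtain z where z: "z \<in> set zs" "delay_in z' + delay_out z' \<le> T"
    "z' \<in> set (map (\<lambda>q. join b D False [] z q) (cheapest b qs)) \<or>
     \<not> matched z \<and> z' \<in> set (map (\<lambda>q. join b d True [E] z q) (cheapest b (filter (\<lambda>q. \<not> matched q) qs)))"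
    by (auto simp: join_choices_def split: if_splits)
  from z(3) show thesis
  proof
    assume "z' \<in> set (map (\<lambda>q. join b D False [] z q) (cheapest b qs))"
    then show thesis
      using that[of z _ False] z set_cheapest[of b qs] by auto
  next
    assume "\<not> matched z \<and> z' \<in> set (map (\<lambda>q. join b d True [E] z q) (cheapest b (filter (\<lambda>q. \<not> matched q) qs)))"
    then show thesis
      using that[of z _ True] z set_cheapest[of b "filter (\<lambda>q. \<not> matched q) qs"] by auto
  qed
qed

text \<open>An arbitrary choice \<open>q\<close> of the leaf can be exchanged for a retained one
  that is at least as good in the only delay that counts beyond the arc. For a cheap arc the
  retained choice is taken among the unmatched ones.\<close>

lemma join_choices_intro:
  assumes "z \<in> set zs" "q \<in> set qs" "m \<Longrightarrow> \<not> matched z \<and> \<not> matched q"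
  obtains q' where "q' \<in> set qs" "(if b then delay_in q' else delay_out q') \<le> (if b then delay_in q else delay_out q)"
    "\<And>z'. z' = join b (if m then d else D) m (if m then [E] else []) z q' \<Longrightarrow>
       delay_in z' + delay_out z' \<le> T \<Longrightarrow> z' \<in> set (join_choices T d D b E zs qs)"
proof (cases m)
  case True
  then have "q \<in> set (filter (\<lambda>q. \<not> matched q) qs)"
    using assms by auto
  then obtain q' where "q' \<in> set (cheapest b (filter (\<lambda>q. \<not> matched q) qs))" "q' \<in> set qs"
    "(if b then delay_in q' else delay_out q') \<le> (if b then delay_in q else delay_out q)"
    by (cases rule: cheapest_cases[of "filter (\<lambda>q. \<not> matched q) qs" b]) auto
  then show thesis
    using that[of q'] assms True by (fastforce simp: join_choices_def)
next
  case False
  obtain q' where "q' \<in> set (cheapest b qs)" "q' \<in> set qs"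
    "(if b then delay_in q' else delay_out q') \<le> (if b then delay_in q else delay_out q)"
    using assms(2) by (cases rule: cheapest_cases[of qs b]) auto
  then show thesis
    using that[of q'] assms False by (fastforce simp: join_choices_def)
qed

section \<open>Correctness of the dynamic program\<close>

definition arcs_of :: "nat list list \<Rightarrow> (nat \<times> nat) set" where
  "arcs_of ps = {(u, v). [u, v] \<in> set ps}"

text \<open>A matching already in output form: its arcs are two-element clusters, tail first, and
  distinctness of the concatenation makes them disjoint.\<close>

definition pairing :: "(nat \<times> nat) set \<Rightarrow> nat list list \<Rightarrow> bool" where
  "pairing A ps \<longleftrightarrow> distinct (concat ps) \<and> (\<forall>l \<in> set ps. \<exists>u v. l = [u, v] \<and> (u, v) \<in> A)"

definition choice_shape :: "(nat \<times> nat) set \<Rightarrow> nat \<Rightarrow> choice \<Rightarrow> bool" where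
  "choice_shape A v z \<longleftrightarrow> pairing A (pairs z) \<and> (v \<in> set (concat (pairs z)) \<longrightarrow> matched z)"

definition choice_sound :: "nat \<Rightarrow> nat \<Rightarrow> nat \<Rightarrow> (nat \<times> nat) set \<Rightarrow> nat \<Rightarrow> choice \<Rightarrow> bool" where
  "choice_sound T d D A v z \<longleftrightarrow> (let w = delay_of d D (arcs_of (pairs z)) in
     in_bound A w v (delay_in z) \<and> out_bound A w v (delay_out z) \<and> feasible A w T)"

text \<open>Dominance: the choice \<open>z\<close> need not realize \<open>N\<close>, but it blocks
  \<open>v\<close> only if \<open>N\<close> does, and each of its delays is matched by a walk under
  \<open>N\<close> that is at least as long. Witness walks take the place of maxima.\<close>

definition choices_complete :: "nat \<Rightarrow> nat \<Rightarrow> nat \<Rightarrow> (nat \<times> nat) set \<Rightarrow> nat \<Rightarrow> choice list \<Rightarrow> bool" where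
  "choices_complete T d D A v zs \<longleftrightarrow> (\<forall>N. N \<subseteq> A \<longrightarrow> matching N \<longrightarrow> feasible A (delay_of d D N) T \<longrightarrow>
     (\<exists>z \<in> set zs. (matched z \<longrightarrow> v \<in> Field N) \<and>
        (\<exists>u x. reach A (delay_of d D N) u x v \<and> delay_in z \<le> x) \<and>
        (\<exists>u x. reach A (delay_of d D N) v x u \<and> delay_out z \<le> x)))"

section \<open>Joining two parts of the tree along an arc\<close>

lemma pairing_Field: "pairing A ps \<Longrightarrow> x \<in> set (concat ps) \<Longrightarrow> x \<in> Field A"
  unfolding pairing_def Field_def by fastforce

lemma pairing_arcs_of: "pairing A ps \<Longrightarrow> arcs_of ps \<subseteq> A"
  unfolding pairing_def arcs_of_def by fastforce

lemma pairing_mono: "pairing A ps \<Longrightarrow> A \<subseteq> A' \<Longrightarrow> pairing A' ps"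
  unfolding pairing_def by (meson subsetD)

lemma arcs_of_append: "arcs_of (xs @ ys) = arcs_of xs \<union> arcs_of ys"
  by (auto simp: arcs_of_def)

lemma matching_subset: "matching N \<Longrightarrow> M \<subseteq> N \<Longrightarrow> matching M"
  unfolding matching_def by blast

text \<open>The arc \<open>(s, t)\<close> connects the leaf \<open>c\<close>, which has absorbed
  \<open>C\<close>, to its neighbour \<open>p\<close>, which has absorbed \<open>P\<close>. The
  first assumption admits both orientations.\<close>

locale junction =
  fixes s t c p :: nat and P C :: "(nat \<times> nat) set"
  assumes ends: "c = s \<and> p = t \<or> c = t \<and> p = s" and ne: "s \<noteq> t"
    and disj: "Field P \<inter> Field C = {}" "c \<notin> Field P" "p \<notin> Field C"
begin

abbreviation "J \<equiv> insert (s, t) (P \<union> C)"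

lemma arc_notin: "(s, t) \<notin> P" "(s, t) \<notin> C" "P \<inter> C = {}"
  using ends disj by (auto simp: Field_def)

lemma shape_join:
  assumes z: "choice_shape P p z" and q: "choice_shape C c q"
    and m: "m \<Longrightarrow> \<not> matched z \<and> \<not> matched q"
  shows "choice_shape J p (join b w m (if m then [[s, t]] else []) z q)"
proof -
  have Fz: "x \<in> Field P" if "x \<in> set (concat (pairs z))" for x
    using that z unfolding choice_shape_def by (blast intro: pairing_Field)
  have Fq: "x \<in> Field C" if "x \<in> set (concat (pairs q))" for x
    using that q unfolding choice_shape_def by (blast intro: pairing_Field)
  have "set (concat (pairs z)) \<inter> set (concat (pairs q)) = {}"
    using Fz Fq disj by blast
  moreover have "m \<Longrightarrow> {s, t} \<inter> set (concat (pairs z)) = {} \<and> {s, t} \<inter> set (concat (pairs q)) = {}"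
    using m ends Fz Fq disj z q by (auto simp: choice_shape_def)
  ultimately have "distinct (concat ((if m then [[s, t]] else []) @ pairs z @ pairs q))"
    using z q ne by (auto simp: choice_shape_def pairing_def)
  moreover have "\<exists>u v. l = [u, v] \<and> (u, v) \<in> J"
    if "l \<in> set ((if m then [[s, t]] else []) @ pairs z @ pairs q)" for l
    using that z q by (auto simp: choice_shape_def pairing_def split: if_splits)
  moreover have "p \<notin> set (concat (pairs q))"
    using Fq disj by blast
  ultimately show ?thesis
    using z by (auto simp: choice_shape_def pairing_def join_def)
qed

text \<open>The pairs of each choice lie within its own part, so the delays there do not change in
  the joined part. Since \<open>bounds_join\<close> is oriented along the arc, the two orientations
  exchange the roles of \<open>P\<close> and \<open>C\<close>.\<close>

lemma sound_join:
  assumes acyc: "acyclic P" "acyclic C"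
  assumes z: "choice_sound T d D P p z" "choice_shape P p z"
    and q: "choice_sound T d D C c q" "choice_shape C c q"
    and z'_def: "z' = join (c = s) (if m then d else D) m (if m then [[s, t]] else []) z q"
    and T: "delay_in z' + delay_out z' \<le> T"
  shows "choice_sound T d D J p z'"
proof -
  define w where "w = delay_of d D (arcs_of (pairs z'))"
  have arcs: "arcs_of (pairs z') = (if m then {(s, t)} else {}) \<union> arcs_of (pairs z) \<union> arcs_of (pairs q)"
    by (auto simp: z'_def join_def arcs_of_append) (auto simp: arcs_of_def split: if_splits)
  have sub: "arcs_of (pairs z) \<subseteq> P" "arcs_of (pairs q) \<subseteq> C"
    using z(2) q(2) by (auto simp: choice_shape_def dest: pairing_arcs_of)
  have wP: "e \<in> P \<Longrightarrow> w e = delay_of d D (arcs_of (pairs z)) e" for e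
    using arc_notin sub unfolding w_def delay_of_def arcs by auto
  have wC: "e \<in> C \<Longrightarrow> w e = delay_of d D (arcs_of (pairs q)) e" for e
    using arc_notin sub unfolding w_def delay_of_def arcs by auto
  have wa: "w (s, t) = (if m then d else D)"
    using arc_notin sub unfolding w_def delay_of_def arcs by auto
  have P: "in_bound P w p (delay_in z)" "out_bound P w p (delay_out z)" "feasible P w T"
    using z(1) bounds_cong[where A = P and w' = w and w = "delay_of d D (arcs_of (pairs z))", OF wP]
    by (auto simp: choice_sound_def Let_def)
  have C: "in_bound C w c (delay_in q)" "out_bound C w c (delay_out q)" "feasible C w T"
    using q(1) bounds_cong[where A = C and w' = w and w = "delay_of d D (arcs_of (pairs q))", OF wC]
    by (auto simp: choice_sound_def Let_def)
  show ?thesis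
  proof (cases "c = s")
    case True
    then have c: "c = s" "p = t"
      using ends ne by auto
    have "delay_in q + w (s, t) + delay_out z \<le> T"
      using T c by (simp add: z'_def join_def wa)
    note * = bounds_join[of C P s t w, unfolded Un_commute[of C P], OF _ _ _ ne acyc(2,1) C[unfolded c] P[unfolded c] this]
    show ?thesis
      unfolding choice_sound_def Let_def w_def[symmetric]
      using * disj c by (auto simp: z'_def join_def wa[symmetric] Int_commute)
  next
    case False
    then have c: "c = t" "p = s"
      using ends ne by auto
    have "delay_in z + w (s, t) + delay_out q \<le> T"
      using T c ne by (simp add: z'_def join_def wa)
    note * = bounds_join[of P C s t w, OF _ _ _ ne acyc P[unfolded c] C[unfolded c] this]
    show ?thesis
      unfolding choice_sound_def Let_def w_def[symmetric]
      using * disj c ne by (auto simp: z'_def join_def wa[symmetric])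
  qed
qed

text \<open>The exchange argument. Restricting \<open>N\<close> to both parts yields dominating
  choices \<open>z0\<close> and \<open>q0\<close>; replacing \<open>q0\<close> by the retained
  \<open>q1\<close> may worsen the other delay of the leaf, but that delay is invisible at
  \<open>p\<close>. The joined choice passes the test against \<open>T\<close> because the witness
  walks into and out of \<open>p\<close> concatenate to a walk under \<open>N\<close>.\<close>

lemma complete_join:
  assumes z: "choices_complete T d D P p zs" and q: "choices_complete T d D C c qs"
  shows "choices_complete T d D J p (join_choices T d D (c = s) [s, t] zs qs)"
  unfolding choices_complete_def
proof (intro allI impI)
  fix N assume N: "N \<subseteq> J" "matching N" and feas: "feasible J (delay_of d D N) T"
  define w where "w = delay_of d D N"
  define m where "m \<longleftrightarrow> (s, t) \<in> N"
  have wP: "e \<in> P \<Longrightarrow> w e = delay_of d D (N \<inter> P) e" for e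
    by (simp add: w_def delay_of_def)
  have wC: "e \<in> C \<Longrightarrow> w e = delay_of d D (N \<inter> C) e" for e
    by (simp add: w_def delay_of_def)
  have wa: "w (s, t) = (if m then d else D)"
    by (simp add: w_def delay_of_def m_def)
  have inP: "reach P (delay_of d D (N \<inter> P)) u x v \<Longrightarrow> reach J w u x v" for u x v
    by (rule reach_mono[of P "delay_of d D (N \<inter> P)" u x v J w]) (auto simp: wP)
  have inC: "reach C (delay_of d D (N \<inter> C)) u x v \<Longrightarrow> reach J w u x v" for u x v
    by (rule reach_mono[of C "delay_of d D (N \<inter> C)" u x v J w]) (auto simp: wC)
  have J_le: "reach J w u x v \<Longrightarrow> x \<le> T" for u x v
    using feas unfolding feasible_def w_def by blast
  have sub_feasible: "feasible P (delay_of d D (N \<inter> P)) T" "feasible C (delay_of d D (N \<inter> C)) T"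
    unfolding feasible_def by (intro allI impI, drule inP inC, erule J_le)+
  have sub_matching: "matching (N \<inter> P)" "matching (N \<inter> C)"
    using N(2) by (auto intro: matching_subset)
  have choices:
    "\<exists>z \<in> set zs. (matched z \<longrightarrow> p \<in> Field (N \<inter> P)) \<and>
      (\<exists>u x. reach P (delay_of d D (N \<inter> P)) u x p \<and> delay_in z \<le> x) \<and>
      (\<exists>u x. reach P (delay_of d D (N \<inter> P)) p x u \<and> delay_out z \<le> x)"
    "\<exists>z \<in> set qs. (matched z \<longrightarrow> c \<in> Field (N \<inter> C)) \<and>
      (\<exists>u x. reach C (delay_of d D (N \<inter> C)) u x c \<and> delay_in z \<le> x) \<and>
      (\<exists>u x. reach C (delay_of d D (N \<inter> C)) c x u \<and> delay_out z \<le> x)"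
    using z[unfolded choices_complete_def, rule_format, OF Int_lower2 sub_matching(1) sub_feasible(1)]
      q[unfolded choices_complete_def, rule_format, OF Int_lower2 sub_matching(2) sub_feasible(2)] .
  from choices(1) obtain z0 where
    z0: "z0 \<in> set zs" "matched z0 \<longrightarrow> p \<in> Field (N \<inter> P)"
      "\<exists>u x. reach P (delay_of d D (N \<inter> P)) u x p \<and> delay_in z0 \<le> x"
      "\<exists>u x. reach P (delay_of d D (N \<inter> P)) p x u \<and> delay_out z0 \<le> x"
    by (elim bexE conjE) (rule that)
  from choices(2) obtain q0 where
    q0: "q0 \<in> set qs" "matched q0 \<longrightarrow> c \<in> Field (N \<inter> C)"
      "\<exists>u x. reach C (delay_of d D (N \<inter> C)) u x c \<and> delay_in q0 \<le> x"
      "\<exists>u x. reach C (delay_of d D (N \<inter> C)) c x u \<and> delay_out q0 \<le> x"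
    by (elim bexE conjE) (rule that)
  \<comment> \<open>If \<open>N\<close> contains the new arc, it has no other arc at
    \<open>c\<close> or \<open>p\<close>, so dominance forces both choices to be unmatched.\<close>
  have nm: "\<not> matched z0 \<and> \<not> matched q0" if m
  proof -
    have "x \<notin> Field (N \<inter> X)" if "x = s \<or> x = t" "(s, t) \<notin> X" for x X
    proof
      assume "x \<in> Field (N \<inter> X)"
      then obtain e where e: "e \<in> N" "e \<in> X" "x = fst e \<or> x = snd e"
        by (auto simp: Field_def)
      then have "e \<noteq> (s, t)"
        using that by auto
      then have "{fst e, snd e} \<inter> {s, t} = {}"
        using N(2)[unfolded matching_def, rule_format, OF e(1), of "(s, t)"] \<open>m\<close> by (simp add: m_def)
      with e(3) that show False
        by auto
    qed
    from this[of p P] this[of c C] show ?thesis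
      using z0(2) q0(2) arc_notin ends by auto
  qed
  obtain q1 where q1: "(if c = s then delay_in q1 else delay_out q1) \<le> (if c = s then delay_in q0 else delay_out q0)"
    "\<And>z'. z' = join (c = s) (if m then d else D) m (if m then [[s, t]] else []) z0 q1 \<Longrightarrow>
       delay_in z' + delay_out z' \<le> T \<Longrightarrow> z' \<in> set (join_choices T d D (c = s) [s, t] zs qs)"
    by (rule join_choices_intro[OF z0(1) q0(1) nm, where b = "c = s" and T = T and d = d and D = D and E = "[s, t]"])
      (assumption | rule that)+
  define z' where "z' = join (c = s) (if m then d else D) m (if m then [[s, t]] else []) z0 q1"
  \<comment> \<open>From here on walks are prolonged across the arc to turn witnesses at
    \<open>c\<close> into witnesses at \<open>p\<close>.\<close>
  have arc: "reach J w s (w (s, t)) t"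
    by (rule reach_arc) simp
  obtain u1 x1 where "reach J w u1 x1 p" "delay_in z0 \<le> x1"
    using z0(3) inP by blast
  moreover obtain u2 x2 where "reach J w p x2 u2" "delay_out z0 \<le> x2"
    using z0(4) inP by blast
  ultimately have zr: "reach J w u1 x1 p" "delay_in z0 \<le> x1" "reach J w p x2 u2" "delay_out z0 \<le> x2"
    by auto
  obtain u3 x3 where "reach J w u3 x3 c" "delay_in q0 \<le> x3"
    using q0(3) inC by blast
  moreover obtain u4 x4 where "reach J w c x4 u4" "delay_out q0 \<le> x4"
    using q0(4) inC by blast
  ultimately have qr: "reach J w u3 x3 c" "delay_in q0 \<le> x3" "reach J w c x4 u4" "delay_out q0 \<le> x4"
    by auto
  have witness: "\<exists>u x. R u x \<and> max a b \<le> x" if "R u x" "a \<le> x" "R v y" "b \<le> y"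
    for R :: "nat \<Rightarrow> nat \<Rightarrow> bool" and a b u v x y
  proof (cases "a \<le> b")
    case True
    then have "max a b \<le> y"
      using that(4) by simp
    with that(3) show ?thesis
      by blast
  next
    case False
    then have "max a b \<le> x"
      using that(2) by simp
    with that(1) show ?thesis
      by blast
  qed
  have reach': "(\<exists>u x. reach J w u x p \<and> delay_in z' \<le> x) \<and> (\<exists>u x. reach J w p x u \<and> delay_out z' \<le> x)"
  proof (cases "c = s")
    case True
    then have c: "c = s" "p = t"
      using ends ne by auto
    have "reach J w u3 (x3 + w (s, t)) p"
      using reach_trans[OF arc qr(1)[unfolded c]] c by simp
    moreover have "delay_in q1 + w (s, t) \<le> x3 + w (s, t)"
      using q1(1) qr(2) True by simp
    moreover have "delay_in z' = max (delay_in z0) (delay_in q1 + w (s, t))" "delay_out z' = delay_out z0"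
      using c by (simp_all add: z'_def join_def wa)
    ultimately show ?thesis
      using witness[where R = "\<lambda>u x. reach J w u x p", OF zr(1,2)] zr(3,4) by metis
  next
    case False
    then have c: "c = t" "p = s"
      using ends ne by auto
    have "reach J w p (w (s, t) + x4) u4"
      using reach_trans[OF qr(3)[unfolded c] arc] c by simp
    moreover have "delay_out q1 + w (s, t) \<le> w (s, t) + x4"
      using q1(1) qr(4) False by simp
    moreover have "delay_out z' = max (delay_out z0) (delay_out q1 + w (s, t))" "delay_in z' = delay_in z0"
      using c ne by (simp_all add: z'_def join_def wa)
    ultimately show ?thesis
      using witness[where R = "\<lambda>u x. reach J w p x u", OF zr(3,4)] zr(1,2) by metis
  qed
  then obtain u x v y where xy: "reach J w u x p" "delay_in z' \<le> x" "reach J w p y v" "delay_out z' \<le> y"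
    by blast
  \<comment> \<open>The two witness walks meet at \<open>p\<close>; their concatenation is subject
    to the feasibility of \<open>N\<close>.\<close>
  have "x + y \<le> T"
    by (rule J_le[OF reach_trans[OF xy(3,1)]])
  with xy have "z' \<in> set (join_choices T d D (c = s) [s, t] zs qs)"
    by (intro q1(2)) (auto simp: z'_def)
  moreover have "matched z' \<longrightarrow> p \<in> Field N"
    using z0(2) ends by (auto simp: z'_def join_def m_def Field_def)
  ultimately show "\<exists>z \<in> set (join_choices T d D (c = s) [s, t] zs qs). (matched z \<longrightarrow> p \<in> Field N) \<and>
        (\<exists>u x. reach J (delay_of d D N) u x p \<and> delay_in z \<le> x) \<and>
        (\<exists>u x. reach J (delay_of d D N) p x u \<and> delay_out z \<le> x)"
    using reach' unfolding w_def by blast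
qed

end

section \<open>Arc sets absorbed along an elimination order\<close>

definition absorb_arcs :: "(nat \<Rightarrow> (nat \<times> nat) set) \<Rightarrow> nat \<times> nat \<times> nat \<Rightarrow> nat \<Rightarrow> (nat \<times> nat) set" where
  "absorb_arcs B e = (let c = fst e; p = other_end c (snd e) in
     B(p := insert (snd e) (B p \<union> B c), c := {}))"

text \<open>The second clause says that an end of a pending arc can occur in no block but its own,
  which keeps both sides of the next junction apart. By the third, the owner of a nonempty block is
  among its vertices, so it is found again when the table is read off.\<close>

definition separated :: "(nat \<times> nat \<times> nat) list \<Rightarrow> (nat \<Rightarrow> (nat \<times> nat) set) \<Rightarrow> bool" where
  "separated es B \<longleftrightarrow> (\<forall>v v'. v \<noteq> v' \<longrightarrow> Field (B v) \<inter> Field (B v') = {}) \<and>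
     (\<forall>e \<in> set es. \<forall>x v. incident x (snd e) \<longrightarrow> x \<in> Field (B v) \<longrightarrow> x = v) \<and>
     (\<forall>v. B v \<noteq> {} \<longrightarrow> v \<in> Field (B v))"

lemma junction_separated:
  assumes "elimination ((c, s, t) # es)" "separated ((c, s, t) # es) B"
  shows "junction s t c (other_end c (s, t)) (B (other_end c (s, t))) (B c)"
proof
  let ?p = "other_end c (s, t)"
  show "c = s \<and> ?p = t \<or> c = t \<and> ?p = s" "s \<noteq> t"
    using assms(1) by (auto simp: incident_def other_end_def)
  then have "?p \<noteq> c" "incident c (s, t)" "incident ?p (s, t)"
    by (auto simp: incident_def)
  with assms(2) show "Field (B ?p) \<inter> Field (B c) = {}" "c \<notin> Field (B ?p)" "?p \<notin> Field (B c)"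
    unfolding separated_def by (auto 0 4)
qed

text \<open>The merged block gains at most \<open>s\<close> and \<open>t\<close> as new vertices,
  and these are the owners of the two blocks merged. Pending arcs avoid the eliminated end, so only
  the surviving end can meet them.\<close>

lemma separated_absorb:
  assumes "elimination (e # es)" "separated (e # es) B"
  shows "separated es (absorb_arcs B e)" "(\<Union>v. absorb_arcs B e v) = insert (snd e) (\<Union>v. B v)"
proof -
  obtain c s t where e: "e = (c, s, t)"
    by (cases e) auto
  let ?p = "other_end c (s, t)"
  interpret junction s t c ?p "B ?p" "B c"
    using assms unfolding e by (rule junction_separated)
  have pc: "?p \<noteq> c" and p: "?p \<in> {s, t}" "c \<in> {s, t}"
    using ends ne by auto
  have B': "absorb_arcs B e = B(?p := J, c := {})"
    by (simp add: absorb_arcs_def e Let_def)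
  have FJ: "Field J = {s, t} \<union> Field (B ?p) \<union> Field (B c)"
    by (auto simp: Field_def)
  have st: "x \<in> {s, t} \<Longrightarrow> x \<in> Field (B v) \<Longrightarrow> x = v" for x v
    using assms(2) unfolding separated_def e incident_def by auto
  have st': "{s, t} = {?p, c}"
    using ends by auto
  have dis: "v \<noteq> v' \<Longrightarrow> Field (B v) \<inter> Field (B v') = {}" for v v'
    using assms(2) by (auto simp: separated_def)
  have "Field (absorb_arcs B e v) \<inter> Field (absorb_arcs B e v') = {}" if "v \<noteq> v'" for v v'
  proof -
    have *: "Field J \<inter> Field (B v) = {}" if "v \<noteq> ?p" "v \<noteq> c" for v
      using dis[of v ?p] dis[of v c] st[of _ v] that unfolding FJ st' by auto
    show ?thesis
      using that dis[OF that] *[of v] *[of v'] pc unfolding B' by (auto simp: fun_upd_def)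
  qed
  moreover have "x = v" if "e' \<in> set es" "incident x (snd e')" "x \<in> Field (absorb_arcs B e v)" for e' x v
  proof -
    have x: "x \<in> Field (B y) \<Longrightarrow> x = y" for y
      using assms(2) that(1,2) unfolding separated_def by auto
    have "x \<noteq> c"
      using assms(1) that(1,2) unfolding e by auto
    then show ?thesis
      using that(3) st' unfolding B'
      by (auto simp: FJ[unfolded st'] split: if_splits dest: x)
  qed
  moreover have "v \<in> Field (absorb_arcs B e v)" if "absorb_arcs B e v \<noteq> {}" for v
    using that assms(2) p(1) unfolding B' separated_def by (auto simp: FJ split: if_splits)
  ultimately show "separated es (absorb_arcs B e)"
    unfolding separated_def by blast
  show "(\<Union>v. absorb_arcs B e v) = insert (snd e) (\<Union>v. B v)"
  proof
    have "B v \<subseteq> (\<Union>v. absorb_arcs B e v)" for v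
    proof (cases "v = ?p \<or> v = c")
      case True
      then have "B v \<subseteq> absorb_arcs B e ?p"
        using pc by (auto simp: B')
      then show ?thesis
        by blast
    next
      case False
      then have "B v = absorb_arcs B e v"
        by (simp add: B')
      then show ?thesis
        by blast
    qed
    moreover have "(s, t) \<in> absorb_arcs B e ?p"
      using pc by (simp add: B')
    ultimately show "insert (snd e) (\<Union>v. B v) \<subseteq> (\<Union>v. absorb_arcs B e v)"
      unfolding e by auto
  qed (auto simp: B'[unfolded e] e split: if_splits)
qed

lemma separated_foldl:
  assumes "elimination (es @ es')" "separated (es @ es') B"
  shows "separated es' (foldl absorb_arcs B es)"
    "(\<Union>v. foldl absorb_arcs B es v) = snd ` set es \<union> (\<Union>v. B v)"
proof -
  have "separated es' (foldl absorb_arcs B es) \<and>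
    (\<Union>v. foldl absorb_arcs B es v) = snd ` set es \<union> (\<Union>v. B v)"
    using assms
  proof (induction es arbitrary: B)
    case (Cons e es)
    then have "elimination (e # es @ es')" "separated (e # es @ es') B"
      by auto
    from separated_absorb[OF this] Cons show ?case
      by auto
  qed simp
  then show "separated es' (foldl absorb_arcs B es)"
    "(\<Union>v. foldl absorb_arcs B es v) = snd ` set es \<union> (\<Union>v. B v)"
    by auto
qed

text \<open>The set of arcs that the table entry of each vertex accounts for after the steps
  \<open>es\<close>.\<close>

definition absorbed :: "(nat \<times> nat \<times> nat) list \<Rightarrow> nat \<Rightarrow> (nat \<times> nat) set" where
  "absorbed es = foldl absorb_arcs (\<lambda>_. {}) es"

lemma separated_absorbed:
  assumes "elimination (es @ es')"
  shows "separated es' (absorbed es)" "(\<Union>v. absorbed es v) = snd ` set es"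
proof -
  have "separated (es @ es') (\<lambda>_. {})"
    by (simp add: separated_def)
  from separated_foldl[OF assms this] show "separated es' (absorbed es)" "(\<Union>v. absorbed es v) = snd ` set es"
    by (simp_all add: absorbed_def)
qed

lemma elimination_appendD: "elimination (es @ es') \<Longrightarrow> elimination es"
  by (induction es) auto

text \<open>In \<open>Q A v zs\<close>, the table entry \<open>zs\<close> of \<open>v\<close> is related to the arcs \<open>A\<close> absorbed into \<open>v\<close>.\<close>

lemma table_induct:
  assumes es: "elimination (es @ es')"
    and init: "\<And>v. Q {} v [(False, 0, 0, [])]"
    and step: "\<And>s t c p P C zs qs. junction s t c p P C \<Longrightarrow>
      insert (s, t) (P \<union> C) \<subseteq> snd ` set es \<Longrightarrow> Q P p zs \<Longrightarrow> Q C c qs \<Longrightarrow>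
      Q (insert (s, t) (P \<union> C)) p (join_choices T d D (c = s) [s, t] zs qs)"
  shows "Q (absorbed es v) v (lookup (table T d D es) v)"
  using es step
proof (induction es arbitrary: v es' rule: rev_induct)
  case Nil
  then show ?case
    using init by (simp add: absorbed_def table_def lookup_Nil)
next
  case (snoc e es)
  obtain c s t where e: "e = (c, s, t)"
    by (cases e) auto
  let ?p = "other_end c (s, t)"
  have el: "elimination (es @ e # es')"
    using snoc.prems(1) by simp
  note sep = separated_absorbed[OF el]
  have "elimination (e # es')"
    using el by (induction es) auto
  then have j: "junction s t c ?p (absorbed es ?p) (absorbed es c)"
    using sep(1) unfolding e by (rule junction_separated)
  have IH: "Q (absorbed es v) v (lookup (table T d D es) v)" for v
    by (rule snoc.IH[OF el snoc.prems(2)]) auto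
  have "insert (s, t) (absorbed es ?p \<union> absorbed es c) \<subseteq> snd ` set (es @ [e])"
    using sep(2) e by auto
  from snoc.prems(2)[OF j this IH IH] show ?case
    using init IH
    by (simp add: absorbed_def table_def absorb_arcs_def lookup_absorb e Let_def)
qed

lemma table_shape:
  assumes "elimination (es @ es')" "z \<in> set (lookup (table T d D es) v)"
  shows "choice_shape (absorbed es v) v z"
proof -
  have "\<forall>z \<in> set (lookup (table T d D es) v). choice_shape (absorbed es v) v z"
    using assms(1)
  proof (rule table_induct[where Q = "\<lambda>A v zs. \<forall>z \<in> set zs. choice_shape A v z"], goal_cases)
    case (2 s t c p P C zs qs)
    then show ?case
      by (blast elim: join_choices_elim intro: junction.shape_join[OF 2(1)])
  qed (simp add: choice_shape_def pairing_def)
  with assms(2) show ?thesis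
    by blast
qed

text \<open>The shape is carried through the induction, because soundness of a join relies on the
  pairs of a choice lying in its own part.\<close>

lemma table_sound:
  assumes "elimination es" "acyclic (snd ` set es)" "z \<in> set (lookup (table T d D es) v)"
  shows "choice_sound T d D (absorbed es v) v z"
proof -
  have "\<forall>z \<in> set (lookup (table T d D es) v). choice_shape (absorbed es v) v z \<and> choice_sound T d D (absorbed es v) v z"
  proof (rule table_induct[where Q = "\<lambda>A v zs. \<forall>z \<in> set zs. choice_shape A v z \<and> choice_sound T d D A v z" and es' = "[]"], goal_cases)
    case 1
    then show ?case
      using assms(1) by simp
  next
    case (2 v)
    have "reach {} w u x v \<Longrightarrow> x = 0" for w u x and v :: nat
      using reach_Field[of "{}" w u x v] by simp
    then show ?case
      by (auto simp: choice_sound_def choice_shape_def pairing_def in_bound_def out_bound_def feasible_def)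
  next
    case (3 s t c p P C zs qs)
    have "acyclic P" "acyclic C"
      using assms(2) 3(2) by (auto intro: acyclic_subset)
    then show ?case
      using 3(3,4) by (blast elim: join_choices_elim intro: junction.shape_join[OF 3(1)] junction.sound_join[OF 3(1)])
  qed
  with assms(3) show ?thesis
    by blast
qed

lemma table_complete:
  assumes "elimination es"
  shows "choices_complete T d D (absorbed es v) v (lookup (table T d D es) v)"
proof (rule table_induct[where Q = "choices_complete T d D" and es' = "[]"], goal_cases)
  case (2 v)
  show ?case
    unfolding choices_complete_def using reach_refl by fastforce
next
  case (3 s t c p P C zs qs)
  then show ?case
    by (intro junction.complete_join)
qed (use assms in simp)

section \<open>From the table to a matching of the whole tree\<close>

lemma collect_cases:
  obtains "collect T vs tab = []" "\<exists>v \<in> set vs. lookup tab v = []"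
  | f where "\<And>v. v \<in> set vs \<Longrightarrow> f v \<in> set (lookup tab v)"
    "collect T vs tab = [(T, concat (map (\<lambda>v. pairs (f v)) vs))]"
proof (cases "\<exists>v \<in> set vs. lookup tab v = []")
  case True
  then have "filter (\<lambda>zs. zs = []) (map (lookup tab) vs) \<noteq> []"
    by (auto simp: filter_empty_conv)
  with True show thesis
    by (intro that(1)) (auto simp: collect_def Let_def)
next
  case False
  define f where "f v = hd (lookup tab v)" for v
  have "concat (map (\<lambda>zs. case zs of [] \<Rightarrow> [] | z # _ \<Rightarrow> pairs z) (map (lookup tab) vs)) =
      concat (map (\<lambda>v. pairs (f v)) vs)"
    using False by (auto simp: f_def split: list.split intro!: arg_cong[of _ _ concat])
  moreover have "filter (\<lambda>zs. zs = []) (map (lookup tab) vs) = []"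
    using False by (auto simp: filter_empty_conv)
  ultimately show thesis
    using False by (intro that(2)[of f]) (auto simp: f_def collect_def Let_def)
qed

text \<open>The blocks have disjoint fields, so the pairings chosen at the individual vertices
  combine into one, and no walk passes from one block to another.\<close>

lemma collect_sound:
  assumes es: "elimination es" "acyclic (snd ` set es)" "Field (snd ` set es) \<subseteq> set vs" "distinct vs"
    and ps: "(T', ps) \<in> set (collect T vs (table T d D es))"
  shows "T' = T" "pairing (snd ` set es) ps" "feasible (snd ` set es) (delay_of d D (arcs_of ps)) T"
proof -
  let ?B = "absorbed es" and ?A = "snd ` set es"
  from ps obtain f where f: "\<And>v. v \<in> set vs \<Longrightarrow> f v \<in> set (lookup (table T d D es) v)"
    "T' = T" "ps = concat (map (\<lambda>v. pairs (f v)) vs)"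
    by (cases rule: collect_cases[of T vs "table T d D es"]) auto
  show "T' = T"
    by fact
  have sep: "separated [] ?B" "(\<Union>v. ?B v) = ?A"
    using separated_absorbed[of es "[]"] es(1) by simp_all
  have disj: "v \<noteq> v' \<Longrightarrow> Field (?B v) \<inter> Field (?B v') = {}" for v v'
    using sep(1) unfolding separated_def by blast
  have shape: "v \<in> set vs \<Longrightarrow> pairing (?B v) (pairs (f v))" for v
    using table_shape[of es "[]" "f v" T d D v] f(1)[of v] es(1) by (simp add: choice_shape_def)
  have sub: "?B v \<subseteq> ?A" for v
    using sep(2) by blast
  have "set ws \<subseteq> set vs \<Longrightarrow> distinct ws \<Longrightarrow> pairing ?A (concat (map (\<lambda>v. pairs (f v)) ws))" for ws
  proof (induction ws)
    case (Cons v ws)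
    have F: "set (concat (pairs (f v))) \<subseteq> Field (?B v)" if "v \<in> set vs" for v
      using pairing_Field[OF shape[OF that]] by blast
    have "set (concat (pairs (f v))) \<inter> set (concat (pairs (f v'))) = {}" if "v' \<in> set ws" for v'
    proof -
      have "v \<in> set vs" "v' \<in> set vs" "v \<noteq> v'"
        using Cons.prems that by auto
      then show ?thesis
        using F[of v] F[of v'] disj[of v v'] by blast
    qed
    moreover have "set (concat (concat (map (\<lambda>v. pairs (f v)) ws))) = (\<Union>v \<in> set ws. set (concat (pairs (f v))))"
      by simp
    ultimately have "set (concat (pairs (f v))) \<inter> set (concat (concat (map (\<lambda>v. pairs (f v)) ws))) = {}"
      by blast
    moreover have "pairing ?A (pairs (f v))"
      using pairing_mono[OF shape sub] Cons.prems(1) by simp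
    ultimately show ?case
      using Cons unfolding pairing_def by auto
  qed (simp add: pairing_def)
  from this[of vs] show "pairing ?A ps"
    using es(4) f(3) by simp
  let ?w = "delay_of d D (arcs_of ps)"
  \<comment> \<open>Pairs chosen at other vertices lie in other blocks, so on the block of
    \<open>v\<close> only the choice \<open>f v\<close> decides which arcs are cheap.\<close>
  have w: "?w e = delay_of d D (arcs_of (pairs (f v))) e" if "v \<in> set vs" "e \<in> ?B v" for e v
  proof -
    have "e \<notin> arcs_of (pairs (f v'))" if "v' \<in> set vs" "v' \<noteq> v" for v'
    proof
      assume "e \<in> arcs_of (pairs (f v'))"
      then have "e \<in> ?B v'"
        using pairing_arcs_of[OF shape[OF that(1)]] by blast
      then have "fst e \<in> Field (?B v) \<inter> Field (?B v')"
        using \<open>e \<in> ?B v\<close> by (cases e) (auto simp: Field_def)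
      with disj[of v' v] that show False
        by auto
    qed
    moreover have "arcs_of ps = (\<Union>v \<in> set vs. arcs_of (pairs (f v)))"
      by (auto simp: arcs_of_def f(3))
    ultimately show ?thesis
      using that(1) by (auto simp: delay_of_def)
  qed
  have "x \<le> T" if "reach ?A ?w u x z" for u x z
  proof -
    from that have "reach (\<Union>v. ?B v) ?w u x z"
      by (simp add: sep(2))
    with disj have "x = 0 \<and> u = z \<or> (\<exists>v. reach (?B v) ?w u x z)"
      by (intro reach_Union) auto
    then have "x = 0 \<or> (\<exists>v. ?B v \<noteq> {} \<and> reach (?B v) ?w u x z)"
    proof (elim disjE exE)
      fix v assume "reach (?B v) ?w u x z"
      then show ?thesis
        using reach_Field[of "?B v" ?w u x z] by (cases "?B v = {}") auto
    qed auto
    then show ?thesis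
    proof (elim disjE exE conjE)
      fix v assume v: "?B v \<noteq> {}" "reach (?B v) ?w u x z"
      \<comment> \<open>A nonempty block contains its owner; this places \<open>v\<close> in
        \<open>vs\<close>, where a choice has been made.\<close>
      then have "v \<in> Field (?B v)"
        using sep(1) unfolding separated_def by blast
      then have "v \<in> set vs"
        using es(3) mono_Field[OF sub[of v]] by blast
      then have "choice_sound T d D (?B v) v (f v)"
        using table_sound[OF es(1,2)] f(1) by blast
      then have "feasible (?B v) ?w T"
        using bounds_cong(1)[where A = "?B v" and w' = ?w and w = "delay_of d D (arcs_of (pairs (f v)))", OF w] \<open>v \<in> set vs\<close>
        by (simp add: choice_sound_def Let_def)
      then show "x \<le> T"
        using v(2) unfolding feasible_def by blast
    qed simp
  qed
  then show "feasible ?A ?w T"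
    unfolding feasible_def by blast
qed

text \<open>An empty entry would contradict completeness, applied to the restriction of
  \<open>N\<close> to the block of that vertex.\<close>

lemma collect_complete:
  assumes es: "elimination es"
    and N: "N \<subseteq> snd ` set es" "matching N" "feasible (snd ` set es) (delay_of d D N) T"
  shows "collect T vs (table T d D es) \<noteq> []"
proof (cases rule: collect_cases[of T vs "table T d D es"])
  case 1
  then obtain v where v: "lookup (table T d D es) v = []"
    by blast
  let ?B = "absorbed es v"
  have sub: "?B \<subseteq> snd ` set es"
    using separated_absorbed(2)[of es "[]"] es by auto
  have "feasible ?B (delay_of d D (N \<inter> ?B)) T"
    unfolding feasible_def
  proof (intro allI impI)
    fix u x z assume "reach ?B (delay_of d D (N \<inter> ?B)) u x z"
    then have "reach (snd ` set es) (delay_of d D N) u x z"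
      by (rule reach_mono[of ?B "delay_of d D (N \<inter> ?B)"]) (use sub in \<open>auto simp: delay_of_def\<close>)
    with N(3) show "x \<le> T"
      unfolding feasible_def by blast
  qed
  moreover have "matching (N \<inter> ?B)"
    using N(2) by (rule matching_subset) auto
  ultimately have "\<exists>z \<in> set (lookup (table T d D es) v). True"
    using table_complete[OF es, of T d D v, unfolded choices_complete_def, rule_format, of "N \<inter> ?B"]
    by blast
  then show ?thesis
    by (simp add: v)
qed auto

section \<open>Running time of the algorithm\<close>

text \<open>Each function of several arguments is analysed once, on the projections of a tuple, and
  then composed with arbitrary arguments; its definition is not unfolded at compound terms.\<close>

lemma poly_time_comp3:
  assumes "poly_time (\<lambda>_. True) (\<lambda>p. g (fst p) (fst (snd p)) (snd (snd p)))"
    and "poly_time A f1" "poly_time A f2" "poly_time A f3"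
  shows "poly_time A (\<lambda>x. g (f1 x) (f2 x) (f3 x))"
  using poly_time_comp'[OF assms(1) poly_time_Pair[OF assms(2) poly_time_Pair[OF assms(3,4)]]] by simp

lemma poly_time_comp5:
  assumes "poly_time (\<lambda>_. True) (\<lambda>p. g (fst p) (fst (snd p)) (fst (snd (snd p)))
      (fst (snd (snd (snd p)))) (snd (snd (snd (snd p)))))"
    and "poly_time A f1" "poly_time A f2" "poly_time A f3" "poly_time A f4" "poly_time A f5"
  shows "poly_time A (\<lambda>x. g (f1 x) (f2 x) (f3 x) (f4 x) (f5 x))"
  using poly_time_comp'[OF assms(1) poly_time_Pair[OF assms(2) poly_time_Pair[OF assms(3)
    poly_time_Pair[OF assms(4) poly_time_Pair[OF assms(5,6)]]]]] by simp

lemma poly_time_comp6: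
  assumes "poly_time (\<lambda>_. True) (\<lambda>p. g (fst p) (fst (snd p)) (fst (snd (snd p)))
      (fst (snd (snd (snd p)))) (fst (snd (snd (snd (snd p))))) (snd (snd (snd (snd (snd p))))))"
    and "poly_time A f1" "poly_time A f2" "poly_time A f3" "poly_time A f4" "poly_time A f5" "poly_time A f6"
  shows "poly_time A (\<lambda>x. g (f1 x) (f2 x) (f3 x) (f4 x) (f5 x) (f6 x))"
  using poly_time_comp'[OF assms(1) poly_time_Pair[OF assms(2) poly_time_Pair[OF assms(3)
    poly_time_Pair[OF assms(4) poly_time_Pair[OF assms(5) poly_time_Pair[OF assms(6,7)]]]]]] by simp

lemma poly_time_comp7:
  assumes "poly_time (\<lambda>_. True) (\<lambda>p. g (fst p) (fst (snd p)) (fst (snd (snd p)))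
      (fst (snd (snd (snd p)))) (fst (snd (snd (snd (snd p))))) (fst (snd (snd (snd (snd (snd p))))))
      (snd (snd (snd (snd (snd (snd p)))))))"
    and "poly_time A f1" "poly_time A f2" "poly_time A f3" "poly_time A f4" "poly_time A f5" "poly_time A f6" "poly_time A f7"
  shows "poly_time A (\<lambda>x. g (f1 x) (f2 x) (f3 x) (f4 x) (f5 x) (f6 x) (f7 x))"
  using poly_time_comp'[OF assms(1) poly_time_Pair[OF assms(2) poly_time_Pair[OF assms(3)
    poly_time_Pair[OF assms(4) poly_time_Pair[OF assms(5) poly_time_Pair[OF assms(6) poly_time_Pair[OF assms(7,8)]]]]]]] by simp

lemma poly_time_incident [pt_intros]:
  "poly_time A v \<Longrightarrow> poly_time A a \<Longrightarrow> poly_time A (\<lambda>x. incident (v x :: nat) (a x))"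
  unfolding incident_def by (intro pt_intros)

lemma poly_time_other_end [pt_intros]:
  "poly_time A c \<Longrightarrow> poly_time A a \<Longrightarrow> poly_time A (\<lambda>x. other_end (c x) (a x))"
  unfolding other_end_def by (intro pt_intros)

lemma poly_time_lookup [pt_intros]:
  "poly_time A tab \<Longrightarrow> poly_time A v \<Longrightarrow> poly_time A (\<lambda>x. lookup (tab x) (v x))"
  by (rule poly_time_comp2[of lookup]) (unfold lookup_def, (intro pt_intros)+)

lemma poly_time_join [pt_intros]:
  "poly_time A b \<Longrightarrow> poly_time A w \<Longrightarrow> poly_time A m \<Longrightarrow> poly_time A E \<Longrightarrow> poly_time A z \<Longrightarrow> poly_time A q \<Longrightarrow>
    poly_time A (\<lambda>x. join (b x) (w x) (m x) (E x) (z x) (q x))"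
  by (rule poly_time_comp6[of join]) (unfold join_def, (intro pt_intros)+)

lemma poly_time_cheapest [pt_intros]:
  "poly_time A b \<Longrightarrow> poly_time A zs \<Longrightarrow> poly_time A (\<lambda>x. cheapest (b x) (zs x))"
  by (rule poly_time_comp2[of cheapest]) (unfold cheapest_def, (intro pt_intros)+)

lemma poly_time_join_choices [pt_intros]:
  "poly_time A T \<Longrightarrow> poly_time A d \<Longrightarrow> poly_time A D \<Longrightarrow> poly_time A b \<Longrightarrow> poly_time A E \<Longrightarrow>
    poly_time A zs \<Longrightarrow> poly_time A qs \<Longrightarrow>
    poly_time A (\<lambda>x. join_choices (T x) (d x) (D x) (b x) (E x) (zs x) (qs x))"
  by (rule poly_time_comp7[of join_choices]) (unfold join_choices_def, (intro pt_intros)+)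

lemma poly_time_absorb [pt_intros]:
  "poly_time A T \<Longrightarrow> poly_time A d \<Longrightarrow> poly_time A D \<Longrightarrow> poly_time A tab \<Longrightarrow> poly_time A e \<Longrightarrow>
    poly_time A (\<lambda>x. absorb (T x) (d x) (D x) (tab x) (e x))"
  by (rule poly_time_comp5[of absorb]) (unfold absorb_def Let_def, (intro pt_intros)+)

lemma poly_time_collect [pt_intros]:
  "poly_time A T \<Longrightarrow> poly_time A vs \<Longrightarrow> poly_time A tab \<Longrightarrow>
    poly_time A (\<lambda>x. collect (T x) (vs x) (tab x))"
  by (rule poly_time_comp3[of collect]) (unfold collect_def Let_def, (intro pt_intros)+)

section \<open>Size of the table\<close>

lemma length_filter_concat_map:
  "(\<And>x. length (filter Q (g x)) \<le> (if R x then 1 else 0)) \<Longrightarrow>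
    length (filter Q (concat (map g xs))) \<le> length (filter R xs)"
proof (induction xs)
  case (Cons x xs)
  show ?case
    using add_mono[OF Cons.prems[of x] Cons.IH[OF Cons.prems]] by (cases "R x") simp_all
qed simp

lemma length_concat_map:
  "(\<And>x. length (g x) \<le> (if R x then 2 else 1)) \<Longrightarrow>
    length (concat (map g xs)) \<le> length xs + length (filter R xs)"
proof (induction xs)
  case (Cons x xs)
  show ?case
    using add_mono[OF Cons.prems[of x] Cons.IH[OF Cons.prems]] by (cases "R x") simp_all
qed simp

text \<open>Since \<open>cheapest\<close> retains at most one choice, a matched \<open>z\<close>
  yields at most one joined choice and an unmatched \<open>z\<close> at most two, only one of them
  unmatched. So the number of unmatched choices does not increase, and the list grows by at most
  that number.\<close>

lemma length_unmatched_join_choices: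
  "length (filter (\<lambda>z. \<not> matched z) zs) \<le> 1 \<Longrightarrow> length (filter (\<lambda>z. \<not> matched z) (join_choices T d D b E zs qs)) \<le> 1"
  "length (join_choices T d D b E zs qs) \<le> length zs + length (filter (\<lambda>z. \<not> matched z) zs)"
proof -
  let ?g = "\<lambda>z. map (\<lambda>q. join b D False [] z q) (cheapest b qs) @
       (if matched z then [] else map (\<lambda>q. join b d True [E] z q) (cheapest b (filter (\<lambda>q. \<not> matched q) qs)))"
  have ch: "length (cheapest b qs) \<le> 1" for qs
    by (rule cheapest_cases[of qs b]) auto
  have "length (filter (\<lambda>z. \<not> matched z) (concat (map ?g zs))) \<le> length (filter (\<lambda>z. \<not> matched z) zs)"
  proof (rule length_filter_concat_map)
    fix z
    show "length (filter (\<lambda>z. \<not> matched z) (?g z)) \<le> (if \<not> matched z then 1 else 0)"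
    proof -
      have "filter (\<lambda>z. \<not> matched z) (map (\<lambda>q. join b d True [E] z q) qs') = []" for qs'
        by (auto simp: filter_empty_conv join_def)
      moreover have "filter (\<lambda>z. \<not> matched z) (map (\<lambda>q. join b D False [] z q) qs') = []" if "matched z" for qs'
        using that by (auto simp: filter_empty_conv join_def)
      moreover have "length (filter (\<lambda>z. \<not> matched z) (map (\<lambda>q. join b D False [] z q) (cheapest b qs))) \<le> 1"
        using length_filter_le[of "\<lambda>z. \<not> matched z" "map (\<lambda>q. join b D False [] z q) (cheapest b qs)"] ch[of qs]
        unfolding length_map by linarith
      ultimately show ?thesis
        by (cases "matched z") (simp_all only: not_True_eq_False filter_append if_True if_False append_Nil2 filter.simps(1) list.size not_False_eq_True)
    qed
  qed
  then show "length (filter (\<lambda>z. \<not> matched z) (join_choices T d D b E zs qs)) \<le> 1"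
    if "length (filter (\<lambda>z. \<not> matched z) zs) \<le> 1"
  proof -
    have "length (filter (\<lambda>z. \<not> matched z) (join_choices T d D b E zs qs)) \<le>
        length (filter (\<lambda>z. \<not> matched z) (concat (map ?g zs)))"
      unfolding join_choices_def filter_filter
      by (subst conj_commute, subst filter_filter[symmetric]) (rule length_filter_le)
    also note \<open>\<dots> \<le> length (filter (\<lambda>z. \<not> matched z) zs)\<close>
    finally show ?thesis
      using that by linarith
  qed
  have "length (concat (map ?g zs)) \<le> length zs + length (filter (\<lambda>z. \<not> matched z) zs)"
  proof (rule length_concat_map)
    show "length (?g z) \<le> (if \<not> matched z then 2 else 1)" for z
      using ch[of qs] ch[of "filter (\<lambda>q. \<not> matched q) qs"] by simp
  qed
  then show "length (join_choices T d D b E zs qs) \<le> length zs + length (filter (\<lambda>z. \<not> matched z) zs)"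
    unfolding join_choices_def using length_filter_le order_trans by blast
qed

lemma length_pairing:
  assumes "pairing A ps" "finite A"
  shows "length ps \<le> card A"
proof -
  have "[] \<notin> set ps"
    using assms(1) by (auto simp: pairing_def)
  then have "distinct ps"
    using assms(1) by (auto simp: pairing_def distinct_concat_iff)
  then have "length ps = card (set ps)"
    by (simp add: distinct_card)
  also have "\<dots> \<le> card ((\<lambda>(u, v). [u, v]) ` A)"
    using assms by (intro card_mono) (auto simp: pairing_def)
  also have "\<dots> \<le> card A"
    using assms(2) by (rule card_image_le)
  finally show ?thesis .
qed

lemma csize_list_le: "(\<And>x. x \<in> set xs \<Longrightarrow> csize x \<le> k) \<Longrightarrow> csize xs \<le> length xs * (k + 1)"
proof (induction xs)
  case (Cons x xs)
  then have "csize x \<le> k" "csize xs \<le> length xs * (k + 1)"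
    by auto
  then show ?case
    by simp
qed simp

lemma csize_snd_le: "csize (snd p) \<le> csize p" and csize_fst_le: "csize (fst p) \<le> csize p"
  by (cases p; simp)+

lemma csize_bool_le: "csize (b :: bool) \<le> 1"
  by (cases b) auto

text \<open>At most \<open>k + 1\<close> choices. In each, two numbers of size at most
  \<open>2 * n\<close>, the flag and three pair nodes make up \<open>n * 4 + 4\<close>; then there
  are at most \<open>k\<close> clusters of size at most \<open>2 * k + 4\<close>, plus one list node
  each. The final 1 is the list node of the choice itself.\<close>

definition choice_bound :: "nat \<Rightarrow> nat \<Rightarrow> nat" where
  "choice_bound n k = (k + 1) * (n * 4 + 4 + k * (2 * k + 5) + 1)"

text \<open>The test in \<open>join_choices\<close> keeps the recorded delays below
  \<open>T\<close>. The number of choices grows by at most one with each new arc of the block, and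
  the pairs of a choice are distinct arcs of the block.\<close>

lemma csize_lookup_table:
  assumes "elimination es"
  shows "csize (lookup (table T d D es) v) \<le> choice_bound (csize T) (csize es)"
proof -
  let ?A = "absorbed es v"
  define zs where "zs = lookup (table T d D es) v"
  have sub: "?A \<subseteq> snd ` set es"
    using separated_absorbed(2)[of es "[]"] assms by auto
  then have fin: "finite ?A"
    by (rule finite_subset) simp
  have "card ?A \<le> card (snd ` set es)"
    using sub by (intro card_mono) auto
  also have "\<dots> \<le> length es"
    by (meson List.finite_set card_image_le card_length order_trans)
  also have "\<dots> \<le> csize es"
    by (rule length_le_csize)
  finally have card: "card ?A \<le> csize es" .
  have inv: "(\<forall>z \<in> set zs. delay_in z + delay_out z \<le> T) \<and> length (filter (\<lambda>z. \<not> matched z) zs) \<le> 1 \<and>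
      length zs \<le> card ?A + 1"
    unfolding zs_def
  proof (rule table_induct[where es' = "[]" and Q = "\<lambda>A v zs. (\<forall>z \<in> set zs. delay_in z + delay_out z \<le> T) \<and>
      length (filter (\<lambda>z. \<not> matched z) zs) \<le> 1 \<and> length zs \<le> card A + 1"], goal_cases)
    case 1
    then show ?case
      using assms by simp
  next
    case (3 s t c p P C zs qs)
    have "finite (insert (s, t) (P \<union> C))"
      by (rule finite_subset[OF 3(2)]) simp
    moreover have "(s, t) \<notin> P"
      using junction.arc_notin[OF 3(1)] by blast
    moreover have "card (insert (s, t) P) \<le> card (insert (s, t) (P \<union> C))"
      using calculation(1) by (intro card_mono) auto
    ultimately have "card P + 1 \<le> card (insert (s, t) (P \<union> C))"
      by simp
    then show ?case
      using 3(3) length_unmatched_join_choices(1)[of zs T d D "c = s" "[s, t]" qs]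
        length_unmatched_join_choices(2)[of T d D "c = s" "[s, t]" zs qs]
      by (auto simp: join_choices_def)
  qed auto
  have "csize z \<le> csize T * 4 + 4 + csize es * (2 * csize es + 5)" if z: "z \<in> set zs" for z
  proof -
    obtain m a b ps where z_eq: "z = (m, a, b, ps)"
      by (metis prod_cases4)
    have ps: "pairing ?A ps"
    proof -
      have "choice_shape ?A v z"
        using assms z unfolding zs_def by (intro table_shape[of es "[]"]) simp_all
      then show ?thesis
        by (simp add: choice_shape_def z_eq)
    qed
    have "csize l \<le> 2 * csize es + 4" if l_in: "l \<in> set ps" for l
    proof -
      obtain u w where l: "l = [u, w]" "(u, w) \<in> ?A"
        using ps l_in unfolding pairing_def by blast
      then obtain e where "e \<in> set es" "snd e = (u, w)"
        using sub by (metis imageE subsetD)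
      then have "csize (u, w) \<le> csize es"
        using csize_elem[of e es] csize_snd_le[of e] by simp
      then show ?thesis
        by (simp add: l)
    qed
    then have "csize ps \<le> length ps * (2 * csize es + 4 + 1)"
      by (rule csize_list_le)
    also have "\<dots> \<le> csize es * (2 * csize es + 5)"
      using length_pairing[OF ps fin] card by (intro mult_mono) auto
    finally have "csize ps \<le> csize es * (2 * csize es + 5)" .
    moreover have "a \<le> T" "b \<le> T"
      using bspec[OF conjunct1[OF inv] z] by (simp_all add: z_eq)
    ultimately show ?thesis
      using csize_nat_mono[of a T] csize_nat_mono[of b T] csize_bool_le[of m] by (simp add: z_eq)
  qed
  then have "csize zs \<le> length zs * (csize T * 4 + 4 + csize es * (2 * csize es + 5) + 1)"
    by (rule csize_list_le)
  also have "\<dots> \<le> choice_bound (csize T) (csize es)"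
    unfolding choice_bound_def using inv card by (intro mult_mono) auto
  finally show ?thesis
    by (simp add: zs_def)
qed

lemma choice_bound_mono: "k \<le> k' \<Longrightarrow> choice_bound n k \<le> choice_bound n k'"
  unfolding choice_bound_def by (intro mult_mono add_mono) auto

text \<open>The bound is stated for a prefix of the elimination order in terms of the whole order,
  as the fold needs a common bound for all its intermediate tables.\<close>

lemma csize_table:
  assumes "elimination (es @ es')"
  shows "csize (table T d D es) \<le> length es * (2 * csize (es @ es') + choice_bound (csize T) (csize (es @ es')) + 20)"
  using assms
proof (induction es arbitrary: es' rule: rev_induct)
  case (snoc e es)
  obtain c a where e: "e = (c, a)"
    by (cases e)
  let ?n = "csize (es @ [e] @ es')"
  have "csize e \<le> csize (es @ [e] @ es')"
    by simp
  moreover have "csize (other_end c a) \<le> csize a" "csize a \<le> csize e" "csize c \<le> csize e"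
    using csize_fst_le[of a] csize_snd_le[of a] by (auto simp: other_end_def e)
  ultimately have ce: "csize c \<le> ?n" "csize (other_end c a) \<le> ?n"
    by linarith+
  have tab: "table T d D (es @ [e]) = absorb T d D (table T d D es) (c, a)"
    by (simp add: table_def e)
  have "csize (join_choices T d D (c = fst a) [fst a, snd a] (lookup (table T d D es) (other_end c a))
      (lookup (table T d D es) c)) \<le> choice_bound (csize T) ?n" (is "csize ?zs \<le> _")
  proof (cases "other_end c a = c")
    case True
    have "elimination (e # es')"
      using snoc.prems by (induction es) auto
    then show ?thesis
      using True by (auto simp: e other_end_def incident_def split: if_splits)
  next
    case False
    have "elimination (es @ [e])"
      using snoc.prems by (rule elimination_appendD)
    \<comment> \<open>The new list of choices is what a lookup in the enlarged table returns, so the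
      bound for lookups applies to it.\<close>
    from csize_lookup_table[OF this, of T d D "other_end c a"] False
    have "csize ?zs \<le> choice_bound (csize T) (csize (es @ [e]))"
      unfolding tab lookup_absorb by simp
    also have "\<dots> \<le> choice_bound (csize T) ?n"
      by (intro choice_bound_mono) simp
    finally show ?thesis .
  qed
  moreover have "csize (table T d D es) \<le> length es * (2 * ?n + choice_bound (csize T) ?n + 20)"
    using snoc.IH[of "[e] @ es'"] snoc.prems by simp
  ultimately show ?case
    using ce unfolding tab absorb_def Let_def by (simp add: code_simps(1))
qed (simp add: table_def)

lemma poly_time_table:
  assumes pt: "poly_time A T" "poly_time A d" "poly_time A D" "poly_time A es"
    and el: "\<And>x. A x \<Longrightarrow> elimination (es x)"
  shows "poly_time A (\<lambda>x. table (T x) (d x) (D x) (es x))"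
proof -
  have "poly_time (\<lambda>p. elimination (snd (snd (snd p))))
     (\<lambda>p. table (fst p) (fst (snd p)) (fst (snd (snd p))) (snd (snd (snd p))))"
    unfolding table_def
  proof (rule poly_time_foldl)
    let ?G = "\<lambda>p :: nat \<times> nat \<times> nat \<times> (nat \<times> nat \<times> nat) list. csize (snd (snd (snd p))) *
      (2 * csize (snd (snd (snd p))) + choice_bound (csize (fst p)) (csize (snd (snd (snd p)))) + 20)"
    show "poly_bounded (\<lambda>p. elimination (snd (snd (snd p)))) ?G"
      unfolding choice_bound_def by (intro pb_intros pt_intros)
    fix p :: "nat \<times> nat \<times> nat \<times> (nat \<times> nat \<times> nat) list" and n
    assume "elimination (snd (snd (snd p)))"
    then have "csize (table (fst p) (fst (snd p)) (fst (snd (snd p))) (take n (snd (snd (snd p))))) \<le>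
      length (take n (snd (snd (snd p)))) * (2 * csize (snd (snd (snd p))) + choice_bound (csize (fst p)) (csize (snd (snd (snd p)))) + 20)"
      using csize_table[of "take n (snd (snd (snd p)))" "drop n (snd (snd (snd p)))"] by simp
    also have "\<dots> \<le> ?G p"
      using length_le_csize[of "snd (snd (snd p))"] by (intro mult_right_mono) auto
    finally show "csize (foldl (absorb (fst p) (fst (snd p)) (fst (snd (snd p)))) [] (take n (snd (snd (snd p))))) \<le> ?G p"
      unfolding table_def .
  qed (intro pt_intros)+
  then show ?thesis
    using poly_time_comp[where f = "\<lambda>x. (T x, d x, D x, es x)" and A = A] pt el
    by (fastforce intro: poly_time_Pair)
qed

section \<open>Computing an elimination order\<close>

definition leaf_arcs :: "(nat \<times> nat) list \<Rightarrow> (nat \<times> nat \<times> nat) list" where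
  "leaf_arcs rem = filter (\<lambda>e. case filter (incident (fst e)) rem of [] \<Rightarrow> False | _ # as \<Rightarrow> as = [])
     (concat (map (\<lambda>a. [(fst a, a), (snd a, a)]) rem))"

definition elim_step :: "(nat \<times> nat) list \<times> (nat \<times> nat \<times> nat) list \<Rightarrow> (nat \<times> nat) list \<times> (nat \<times> nat \<times> nat) list" where
  "elim_step s = (case leaf_arcs (fst s) of [] \<Rightarrow> s
     | e # _ \<Rightarrow> (filter (\<lambda>a. \<not> incident (fst e) a) (fst s), e # snd s))"

text \<open>The arc list serves as a clock: as long as leaves can be found, each round removes an
  arc, so this many rounds suffice. Steps are collected last first, hence the reversal.\<close>

definition elim_list :: "(nat \<times> nat) list \<Rightarrow> (nat \<times> nat \<times> nat) list" where
  "elim_list as = rev (snd (foldl (\<lambda>s _. elim_step s) (as, []) as))"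

text \<open>Every nonempty forest has a leaf, in hereditary form: closure under subsets lets the
  elimination continue with whatever arcs remain.\<close>

definition leafy :: "('a \<times> 'a) set \<Rightarrow> bool" where
  "leafy A \<longleftrightarrow> (\<forall>B \<subseteq> A. B \<noteq> {} \<longrightarrow> (\<exists>v a. {b \<in> B. incident v b} = {a}))"

lemma leaf_arcsD:
  assumes "e \<in> set (leaf_arcs rem)"
  shows "snd e \<in> set rem" "incident (fst e) (snd e)" "filter (incident (fst e)) rem = [snd e]"
proof -
  show e: "snd e \<in> set rem" "incident (fst e) (snd e)"
    using assms by (auto simp: leaf_arcs_def incident_def)
  have "snd e \<in> set (filter (incident (fst e)) rem)"
    using e by simp
  show "filter (incident (fst e)) rem = [snd e]"
  proof -
    have "case filter (incident (fst e)) rem of [] \<Rightarrow> False | _ # as \<Rightarrow> as = []"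
      using assms unfolding leaf_arcs_def set_filter by blast
    with \<open>snd e \<in> set (filter (incident (fst e)) rem)\<close> show ?thesis
      by (cases "filter (incident (fst e)) rem") (simp_all del: set_filter)
  qed
qed

lemma leaf_arcs_nonempty:
  assumes "leafy A" "set rem \<subseteq> A" "rem \<noteq> []" "distinct rem"
  shows "leaf_arcs rem \<noteq> []"
proof -
  obtain v a where va: "{b \<in> set rem. incident v b} = {a}"
    using assms(1)[unfolded leafy_def, rule_format, of "set rem"] assms(2,3) by auto
  then have "set (filter (incident v) rem) = {a}"
    by auto
  moreover have "distinct (filter (incident v) rem)"
    using assms(4) by simp
  ultimately have "length (filter (incident v) rem) = 1"
    using distinct_card[of "filter (incident v) rem"] by simp
  then obtain a' where "filter (incident v) rem = [a']"
    by (auto simp: length_Suc_conv)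
  moreover from this \<open>set (filter (incident v) rem) = {a}\<close> have "a' = a"
    by (simp only: list.set) simp
  ultimately have "filter (incident v) rem = [a]"
    by simp
  moreover have "a \<in> set rem" "incident v a"
    using va by auto
  ultimately have "(v, a) \<in> set (leaf_arcs rem)"
  proof -
    have "(v, a) \<in> set (concat (map (\<lambda>a. [(fst a, a), (snd a, a)]) rem))"
      using \<open>a \<in> set rem\<close> \<open>incident v a\<close> by (force simp: incident_def)
    with \<open>filter (incident v) rem = [a]\<close> show ?thesis
      unfolding leaf_arcs_def by simp
  qed
  then show ?thesis
    by auto
qed

lemma elimination_snoc:
  "elimination (es @ [e]) \<longleftrightarrow> elimination es \<and> (\<forall>e' \<in> set es. \<not> incident (fst e') (snd e)) \<and>
     incident (fst e) (snd e) \<and> fst (snd e) \<noteq> snd (snd e)"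
  by (induction es) auto

text \<open>In the invariant \<open>n\<close> counts the remaining rounds. Eliminated vertices touch
  no remaining arc, which is exactly what allows the next step to be appended to the order.\<close>

lemma elim_list_correct:
  assumes "leafy (set as)" "distinct as" "\<And>a. a \<in> set as \<Longrightarrow> fst a \<noteq> snd a"
  shows "elimination (elim_list as)" "snd ` set (elim_list as) = set as"
proof -
  define inv where "inv n s \<longleftrightarrow> distinct (fst s) \<and> set (fst s) \<union> snd ` set (snd s) = set as \<and>
    elimination (rev (snd s)) \<and> (\<forall>e \<in> set (snd s). \<forall>a \<in> set (fst s). \<not> incident (fst e) a) \<and>
    length (fst s) \<le> n" for n and s :: "(nat \<times> nat) list \<times> (nat \<times> nat \<times> nat) list"
  have step: "inv n (elim_step s)" if "inv (Suc n) s" for n s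
  proof (cases "leaf_arcs (fst s)")
    case Nil
    then have "fst s = []"
      using leaf_arcs_nonempty[OF assms(1), of "fst s"] that unfolding inv_def by auto
    with that Nil show ?thesis
      by (simp add: inv_def elim_step_def)
  next
    case (Cons e es)
    have e: "snd e \<in> set (fst s)" "incident (fst e) (snd e)" "filter (incident (fst e)) (fst s) = [snd e]"
      using leaf_arcsD[of e "fst s"] Cons by auto
    let ?rem = "filter (\<lambda>a. \<not> incident (fst e) a) (fst s)"
    have "set (fst s) = insert (snd e) (set ?rem)"
      using arg_cong[OF e(3), of set] by auto
    moreover have "length ?rem < length (fst s)"
      using e(1,2) by (auto intro: length_filter_less)
    moreover have "fst (snd e) \<noteq> snd (snd e)"
      using that e(1) unfolding inv_def by (intro assms(3)) blast
    moreover have "elim_step s = (?rem, e # snd s)"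
      by (simp add: elim_step_def Cons)
    ultimately show ?thesis
      using that e unfolding inv_def by (auto simp: elimination_snoc)
  qed
  have "inv 0 (foldl (\<lambda>s _. elim_step s) s xs)" if "inv (length xs) s" for s and xs :: "(nat \<times> nat) list"
    using that
  proof (induction xs arbitrary: s)
    case (Cons y xs)
    then have "inv (length xs) (elim_step s)"
      by (intro step) simp
    from Cons.IH[OF this] show ?case
      by simp
  qed simp
  moreover have "inv (length as) (as, [])"
    using assms(2) by (simp add: inv_def)
  ultimately have F: "inv 0 (foldl (\<lambda>s _. elim_step s) (as, []) as)" (is "inv 0 ?F")
    by blast
  then have "elim_list as = rev (snd ?F)" "fst ?F = []"
    by (simp_all add: elim_list_def inv_def)
  with F show "elimination (elim_list as)" "snd ` set (elim_list as) = set as"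
    unfolding inv_def by auto
qed

lemma csize_filter_removed:
  "x \<in> set xs \<Longrightarrow> \<not> Q x \<Longrightarrow> csize (filter Q xs) + csize x + 1 \<le> csize xs"
proof (induction xs)
  case (Cons y xs)
  have "csize (filter Q xs) \<le> csize xs"
    by (induction xs) auto
  with Cons show ?case
    by auto
qed simp

text \<open>The removed arc pays for the pair of a leaf and that arc, whose code is at most twice as large.\<close>

lemma csize_elim_step:
  "2 * csize (fst (elim_step s)) + csize (snd (elim_step s)) \<le> 2 * csize (fst s) + csize (snd s)"
proof (cases "leaf_arcs (fst s)")
  case (Cons e es)
  have e: "snd e \<in> set (fst s)" "incident (fst e) (snd e)"
    using leaf_arcsD[of e "fst s"] Cons by auto
  then have "csize (fst e) \<le> csize (snd e)"
    using csize_fst_le[of "snd e"] csize_snd_le[of "snd e"] by (auto simp: incident_def)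
  moreover have "csize (filter (\<lambda>a. \<not> incident (fst e) a) (fst s)) + csize (snd e) + 1 \<le> csize (fst s)"
    using e by (intro csize_filter_removed) auto
  moreover have "csize e = csize (fst e) + csize (snd e) + 1"
    by (cases e) simp
  ultimately show ?thesis
    by (simp add: elim_step_def Cons)
qed (simp add: elim_step_def)

lemma poly_time_elim_list [pt_intros]:
  assumes "poly_time A f"
  shows "poly_time A (\<lambda>x. elim_list (f x))"
  unfolding elim_list_def
proof (intro pt_intros, rule poly_time_foldl)
  show "poly_bounded A (\<lambda>x. 2 * csize (f x) + 1)"
    by (intro pb_intros assms)
  fix x n
  have "2 * csize (fst (foldl (\<lambda>s _. elim_step s) s xs)) + csize (snd (foldl (\<lambda>s _. elim_step s) s xs))
      \<le> 2 * csize (fst s) + csize (snd s)" for s and xs :: "(nat \<times> nat) list"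
  proof (induction xs arbitrary: s)
    case (Cons y xs)
    show ?case
      using Cons[of "elim_step s"] csize_elim_step[of s] by simp
  qed simp
  from this[of "(f x, [])" "take n (f x)"]
  show "csize (foldl (\<lambda>s _. elim_step s) (f x, []) (take n (f x))) \<le> 2 * csize (f x) + 1"
    by (cases "foldl (\<lambda>s _. elim_step s) (f x, []) (take n (f x))") simp
qed (unfold elim_step_def leaf_arcs_def, (intro pt_intros assms)+)

text \<open>Produces the multiplicities from 0 to the length of the list. The empty case never
  arises, as the accumulator starts with \<open>[0]\<close>.\<close>

definition count_down :: "'a list \<Rightarrow> nat list" where
  "count_down = foldl (\<lambda>ns _. case ns of [] \<Rightarrow> [0] | n # _ \<Rightarrow> (n + 1) # ns) [0]"

lemma count_down_eq: "count_down xs = rev [0..<Suc (length xs)]"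
proof (induction xs rule: rev_induct)
  case (snoc x xs)
  have "count_down (xs @ [x]) = (case count_down xs of [] \<Rightarrow> [0] | n # _ \<Rightarrow> (n + 1) # count_down xs)"
    by (simp only: count_down_def foldl_append foldl_Cons foldl_Nil)
  with snoc show ?case
    by simp
qed (simp add: count_down_def)

lemma poly_time_count_down [pt_intros]:
  fixes f :: "'a::encodable \<Rightarrow> 'b::encodable list"
  assumes "poly_time A f"
  shows "poly_time A (\<lambda>x. count_down (f x))"
  unfolding count_down_def
proof (rule poly_time_foldl)
  show "poly_bounded A (\<lambda>x. (csize (f x) + 1) * (2 * csize (f x) + 1))"
    by (intro pb_intros assms)
  fix x n
  define m where "m = length (take n (f x))"
  have m: "m \<le> csize (f x)"
    using length_le_csize[of "f x"] by (simp add: m_def)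
  have "length (bits k) \<le> k" for k
  proof (induction k rule: less_induct)
    case (less k)
    show ?case
    proof (cases "k = 0")
      case False
      with less[of "k div 2"] show ?thesis
        by (simp add: bits.simps[of k])
    qed simp
  qed
  then have *: "csize k \<le> 2 * k" for k :: nat
    using csize_le_length_bits[of k] by (meson le_trans mult_le_mono2)
  have "csize (count_down (take n (f x))) \<le> length (count_down (take n (f x))) * (2 * m + 1)"
  proof (rule csize_list_le)
    fix k assume "k \<in> set (count_down (take n (f x)))"
    then have "k \<le> m"
      unfolding count_down_eq by (auto simp: m_def)
    with *[of k] show "csize k \<le> 2 * m"
      by simp
  qed
  also have "\<dots> \<le> (csize (f x) + 1) * (2 * csize (f x) + 1)"
    using m by (intro mult_mono) (auto simp: count_down_eq m_def)
  finally show "csize (foldl (\<lambda>ns _. case ns of [] \<Rightarrow> [0] | n # _ \<Rightarrow> (n + 1) # ns) [0::nat] (take n (f x))) \<le>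
      (csize (f x) + 1) * (2 * csize (f x) + 1)"
    unfolding count_down_def .
qed (intro pt_intros assms)+

section \<open>From digraphs to relations\<close>

lemma pawalk_zip:
  "ys \<noteq> [] \<Longrightarrow> pcas (hd ys) (zip ys (tl ys)) (last ys) \<and> pawalk_verts (hd ys) (zip ys (tl ys)) = ys"
proof (induction ys)
  case (Cons y ys)
  then show ?case
    by (cases ys) auto
qed simp

lemma set_zip_successively: "successively (\<lambda>u v. (u, v) \<in> S) ys \<Longrightarrow> set (zip ys (tl ys)) \<subseteq> S"
proof (induction ys)
  case (Cons y ys)
  then show ?case
    by (cases ys) auto
qed simp

text \<open>Longest path argument. If \<open>B\<close> had no leaf, the first vertex
  \<open>x\<close> of a longest path would have a second arc, to some \<open>w\<close>. By
  maximality \<open>w\<close> lies on the path, and the segment up to \<open>w\<close> closes to an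
  undirected cycle of length at least 3.\<close>

lemma leafyI:
  assumes fin: "finite A" and wf: "Field A \<subseteq> pverts H" and sym: "A \<union> A\<inverse> \<subseteq> parcs H"
    and acyc: "acyclic A"
    and no_cycle: "\<And>p. pre_digraph.cycle (with_proj H) p \<Longrightarrow> length p < 3"
  shows "leafy A"
  unfolding leafy_def
proof (intro allI impI)
  fix B assume B: "B \<subseteq> A" "B \<noteq> {}"
  show "\<exists>v a. {b \<in> B. incident v b} = {a}"
  proof (rule ccontr)
    assume no_leaf: "\<not> ?thesis"
    define P where "P xs \<longleftrightarrow> distinct xs \<and> successively (\<lambda>u v. (u, v) \<in> B \<union> B\<inverse>) xs \<and>
      set xs \<subseteq> Field B \<and> 2 \<le> length xs" for xs
    have irr: "(u, u) \<notin> B" and asym: "(u, v) \<in> B \<Longrightarrow> (v, u) \<notin> B" for u v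
      using acyclic_subset[OF acyc B(1)] unfolding acyclic_def by (blast intro: trancl_into_trancl)+
    obtain u v where "(u, v) \<in> B"
      using B(2) by auto
    then have P0: "P [u, v]"
      using irr by (auto simp: P_def Field_def)
    have "finite (Field B)"
      using finite_subset[OF B(1) fin] by (rule finite_Field)
    then have P_le: "length xs \<le> card (Field B)" if "P xs" for xs
      using that distinct_card[of xs] card_mono[of "Field B" "set xs"] by (auto simp: P_def)
    \<comment> \<open>Paths are distinct vertex lists in the finite field of \<open>B\<close>, so
      their lengths are bounded.\<close>
    have "\<exists>xs. P xs \<and> (\<forall>ys. P ys \<longrightarrow> length ys \<le> length xs)"
      using ex_has_greatest_nat[of P, OF P0, of length "Suc (card (Field B))"] P_le by (simp add: less_Suc_eq_le)
    then obtain xs where xs: "P xs" "\<And>ys. P ys \<Longrightarrow> length ys \<le> length xs"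
      by auto
    then obtain x y zs where xs_eq: "xs = x # y # zs"
      unfolding P_def by (cases xs; cases "tl xs") auto
    have xy: "(x, y) \<in> B \<union> B\<inverse>"
      using xs(1) by (simp add: P_def xs_eq)
    define a where "a = (if (x, y) \<in> B then (x, y) else (y, x))"
    have a: "a \<in> {b \<in> B. incident x b}"
      using xy by (auto simp: a_def incident_def)
    then obtain b where b: "b \<in> B" "incident x b" "b \<noteq> a"
      using no_leaf by blast
    obtain w where w: "(w, x) \<in> B \<union> B\<inverse>" "b = (w, x) \<or> b = (x, w)"
      using b(1,2) by (cases b) (auto simp: incident_def)
    have "w \<noteq> x"
      using w irr by auto
    \<comment> \<open>Otherwise \<open>a\<close> and \<open>b\<close> would be two arcs between
      \<open>x\<close> and \<open>y\<close>, hence antiparallel, against acyclicity.\<close>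
    have "w \<noteq> y"
      using w(2) b(1,3) asym[of x y] asym[of y x] xy by (auto simp: a_def)
    have "w \<in> set xs"
    proof (rule ccontr)
      assume "w \<notin> set xs"
      then have "P (w # xs)"
        using xs(1) w b(1) by (auto simp: P_def xs_eq Field_def)
      from xs(2)[OF this] show False
        by simp
    qed
    then obtain us vs where split: "zs = us @ w # vs"
      using \<open>w \<noteq> x\<close> \<open>w \<noteq> y\<close> by (auto simp: xs_eq dest: split_list)
    \<comment> \<open>The vertices of the closed walk. It visits the three distinct vertices
      \<open>x\<close>, \<open>y\<close> and \<open>w\<close>, so it has at least 3 arcs.\<close>
    define ys where "ys = (x # y # us @ [w]) @ [x]"
    have "successively (\<lambda>u v. (u, v) \<in> B \<union> B\<inverse>) ((x # y # us @ [w]) @ vs)"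
      using xs(1) by (simp add: P_def xs_eq split)
    then have "successively (\<lambda>u v. (u, v) \<in> B \<union> B\<inverse>) (x # y # us @ [w])"
      by (simp only: successively_append_iff)
    then have "successively (\<lambda>u v. (u, v) \<in> B \<union> B\<inverse>) ys"
      using w(1) unfolding ys_def by (subst successively_append_iff) auto
    then have "set (zip ys (tl ys)) \<subseteq> B \<union> B\<inverse>"
      by (rule set_zip_successively)
    moreover have "B \<union> B\<inverse> \<subseteq> parcs H"
      using sym B(1) by blast
    moreover have "x \<in> pverts H"
      using xs(1) wf mono_Field[OF B(1)] by (auto simp: P_def xs_eq)
    moreover have "pcas x (zip ys (tl ys)) x" "pawalk_verts x (zip ys (tl ys)) = ys"
      using pawalk_zip[of ys] by (simp_all add: ys_def)
    moreover have "distinct (tl ys)"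
      using xs(1) by (auto simp: ys_def P_def xs_eq split)
    moreover have "3 \<le> length (zip ys (tl ys))"
      by (simp add: ys_def)
    ultimately have "pre_digraph.cycle (with_proj H) (zip ys (tl ys))"
      unfolding pre_digraph.cycle_def pre_digraph.awalk_def cas_with_proj_eq awalk_verts_with_proj_eq
      by (intro exI[of _ x]) auto
    from no_cycle[OF this] \<open>3 \<le> length (zip ys (tl ys))\<close> show False
      by simp
  qed
qed

text \<open>Uncovered vertices become singletons. Membership is expressed through
  \<open>filter\<close>, for which a time bound is at hand.\<close>

definition clusters_of :: "nat list \<Rightarrow> nat list list \<Rightarrow> nat list list" where
  "clusters_of vs ps = ps @ map (\<lambda>v. [v]) (filter (\<lambda>v. filter (\<lambda>w. w = v) (concat ps) = []) vs)"

locale tree_digraph =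
  fixes vs :: "nat list" and as :: "(nat \<times> nat) list"
  assumes distinct_lists: "distinct vs" "distinct as"
    and dag: "dag (list_digraph vs as)" and tree: "underlying_tree (list_digraph vs as)"
begin

abbreviation "G \<equiv> list_digraph vs as"

sublocale pair_fin_digraph G
  using dag by (simp add: dag_def)

lemma G_simps [simp]: "pverts G = set vs" "parcs G = set as"
  by (simp_all add: list_digraph_def)

lemma Field_arcs: "Field (set as) \<subseteq> set vs"
  using arc_fst_in_verts arc_snd_in_verts by (fastforce simp: Field_def)

lemma no_closed_walk: "awalk u p u \<Longrightarrow> p = []"
  using dag closed_w_imp_cycle by (auto simp: dag_def closed_w_def)

lemma acyclic_arcs: "acyclic (set as)"
  unfolding acyclic_def
proof (intro allI notI)
  fix u assume "(u, u) \<in> (set as)\<^sup>+"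
  then have "\<exists>p. awalk u p u \<and> p \<noteq> []"
    unfolding reachable1_awalk[symmetric] by simp
  then show False
    using no_closed_walk by blast
qed

lemma loopfree: "a \<in> set as \<Longrightarrow> fst a \<noteq> snd a"
  using acyclic_arcs unfolding acyclic_def by (metis prod.collapse r_into_trancl')

lemma asymmetric: "(u, v) \<in> set as \<Longrightarrow> (v, u) \<notin> set as"
  using acyclic_arcs unfolding acyclic_def by (meson r_into_trancl' trancl_trans)

lemma leafy_arcs: "leafy (set as)"
proof (rule leafyI[where H = "mk_symmetric (with_proj G)"])
  show "length p < 3" if "pre_digraph.cycle (with_proj (mk_symmetric (with_proj G))) p" for p
    using tree that by (auto simp: underlying_tree_def not_le)
  show "Field (set as) \<subseteq> pverts (mk_symmetric (with_proj G))"
    using Field_arcs by simp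
  show "set as \<union> (set as)\<inverse> \<subseteq> parcs (mk_symmetric (with_proj G))"
    by (auto simp: parcs_mk_symmetric)
qed (use acyclic_arcs in auto)

lemma verts_nonempty: "vs \<noteq> []"
  using tree by (auto simp: underlying_tree_def connected_def strongly_connected_def)

section \<open>Walks of the digraph and source-sink paths\<close>

lemma awalk_reach: "awalk u p v \<Longrightarrow> reach (set as) w u (sum_list (map w p)) v"
proof (induction p arbitrary: u)
  case Nil
  then show ?case
    by (auto simp: awalk_Nil_iff intro: reach_refl)
next
  case (Cons e p)
  then have "reach (set as) w (snd e) (sum_list (map w p)) v" "reach (set as) w u (w e) (snd e)"
    using reach_arc[of u "snd e" "set as" w] by (auto simp: awalk_Cons_iff)
  from reach_trans[OF this] show ?case
    by simp
qed

lemma reach_awalk: "reach (set as) w u x v \<Longrightarrow> u \<in> set vs \<Longrightarrow> \<exists>p. awalk u p v \<and> sum_list (map w p) = x"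
proof (induction rule: reach.induct)
  case (reach_refl u)
  then show ?case
    by (intro exI[of _ "[]"]) (simp add: awalk_Nil_iff)
next
  case (reach_step u x v z)
  then obtain p where p: "awalk u p v" "sum_list (map w p) = x"
    by blast
  moreover have "awalk v [(v, z)] z"
    using arc_implies_awalk[of "(v, z)"] reach_step by simp
  ultimately have "awalk u (p @ [(v, z)]) z"
    by (intro awalk_appendI)
  with p(2) show ?case
    by (intro exI[of _ "p @ [(v, z)]"]) simp
qed

text \<open>A repeated vertex would enclose a nonempty closed walk; so in the network delay it makes
  no difference whether paths or walks are considered.\<close>

lemma awalk_apath: "awalk u p v \<Longrightarrow> apath u p v"
  unfolding apath_def using awalk_not_distinct_decomp[of u p v] no_closed_walk by fastforce

lemma in_degree_0: "in_degree (with_proj G) u = 0 \<longleftrightarrow> (\<forall>x. (x, u) \<notin> set as)"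
proof -
  have "finite (in_arcs (with_proj G) u)"
    by (rule finite_subset[of _ "set as"]) (auto simp: in_arcs_def)
  then show ?thesis
    unfolding in_degree_def by (auto simp: in_arcs_def)
qed

lemma out_degree_0: "out_degree (with_proj G) u = 0 \<longleftrightarrow> (\<forall>x. (u, x) \<notin> set as)"
proof -
  have "finite (out_arcs (with_proj G) u)"
    by (rule finite_subset[of _ "set as"]) (auto simp: out_arcs_def)
  then show ?thesis
    unfolding out_degree_def by (auto simp: out_arcs_def)
qed

lemma reach_from_source: "\<exists>s x. reach (set as) w s x u \<and> in_degree (with_proj G) s = 0"
proof -
  have "wf (set as)"
    by (rule finite_acyclic_wf) (use acyclic_arcs in auto)
  then show ?thesis
  proof (induction u rule: wf_induct_rule)
    case (less u)
    show ?case
    proof (cases "in_degree (with_proj G) u = 0")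
      case True
      then show ?thesis
        by (intro exI[of _ u] exI[of _ 0] conjI reach_refl)
    next
      case False
      then obtain z where z: "(z, u) \<in> set as"
        by (auto simp: in_degree_0)
      with less obtain s x where "reach (set as) w s x z" "in_degree (with_proj G) s = 0"
        by blast
      with z show ?thesis
        by (blast intro: reach_step)
    qed
  qed
qed

lemma reach_to_sink: "\<exists>t x. reach (set as) w u x t \<and> out_degree (with_proj G) t = 0"
proof -
  have "wf ((set as)\<inverse>)"
    by (rule finite_acyclic_wf_converse) (use acyclic_arcs in auto)
  then show ?thesis
  proof (induction u rule: wf_induct_rule)
    case (less u)
    show ?case
    proof (cases "out_degree (with_proj G) u = 0")
      case True
      then show ?thesis
        by (intro exI[of _ u] exI[of _ 0] conjI reach_refl)
    next
      case False
      then obtain z where z: "(u, z) \<in> set as"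
        by (auto simp: out_degree_0)
      with less obtain t x where "reach (set as) w z x t" "out_degree (with_proj G) t = 0"
        by blast
      with z reach_trans[OF this(1) reach_arc[OF z]] show ?thesis
        by blast
    qed
  qed
qed

text \<open>Every walk extends backwards to a source and forwards to a sink, and natural delays
  cannot lower the total. Bounding source-sink paths therefore bounds all walks, which is what
  \<open>feasible\<close> speaks about.\<close>

lemma source_sink_extension:
  assumes "reach (set as) w u x v" "u \<in> set vs"
  shows "\<exists>p. source_sink_path G p \<and> x \<le> sum_list (map w p)"
proof -
  obtain s x1 where s: "reach (set as) w s x1 u" "in_degree (with_proj G) s = 0"
    using reach_from_source by blast
  obtain t x2 where t: "reach (set as) w v x2 t" "out_degree (with_proj G) t = 0"
    using reach_to_sink by blast
  have "s \<in> set vs"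
    using reach_Field[OF s(1)] Field_arcs assms(2) by auto
  then obtain p where "awalk s p t" "sum_list (map w p) = x1 + x + x2"
    using reach_awalk[OF reach_trans[OF t(1) reach_trans[OF assms(1) s(1)]]] by blast
  then show ?thesis
    using s(2) t(2) awalk_apath[of s p t] unfolding source_sink_path_def
    by (intro exI[of _ p] conjI exI[of _ s] exI[of _ t]) auto
qed

lemma finite_source_sink: "finite {p. source_sink_path G p}"
proof (rule finite_subset)
  show "finite ((\<lambda>(u, p, v). p) ` {(u, p, v). apath u p v})"
    by (intro finite_imageI apaths_finite_triple)
  show "{p. source_sink_path G p} \<subseteq> (\<lambda>(u, p, v). p) ` {(u, p, v). apath u p v}"
    by (force simp: source_sink_path_def)
qed

lemma ex_source_sink: "\<exists>p. source_sink_path G p"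
proof -
  have "hd vs \<in> set vs"
    using verts_nonempty by simp
  with source_sink_extension[OF reach_refl] show ?thesis
    by blast
qed

section \<open>Scaled delays, and clusterings as matchings\<close>

definition intra :: "nat set set \<Rightarrow> (nat \<times> nat) set" where
  "intra \<C> = {e \<in> set as. \<exists>C \<in> \<C>. fst e \<in> C \<and> snd e \<in> C}"

lemma source_sink_arcs: "source_sink_path G p \<Longrightarrow> set p \<subseteq> set as \<and> distinct p"
  unfolding source_sink_path_def
  by (metis G_simps(2) apath_def awalkE' awalk_def distinct_verts_imp_distinct with_proj_simps(2))

text \<open>A positive factor \<open>k\<close> turns both delays into the natural numbers
  \<open>m\<close> and \<open>M\<close>; the comparison of clusterings is unaffected.\<close>

context
  fixes d D k :: rat and m M :: nat
  assumes k: "0 < k" "d * k = of_nat m" "D * k = of_nat M"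
begin

lemma path_delay_scaled:
  assumes "source_sink_path G p"
  shows "path_delay d D \<C> p * k = of_nat (sum_list (map (delay_of m M (intra \<C>)) p))"
proof -
  have "set p \<subseteq> set as \<Longrightarrow> ?thesis"
    by (induction p) (auto simp: path_delay_def arc_delay_def delay_of_def intra_def distrib_right k)
  with source_sink_arcs[OF assms] show ?thesis
    by blast
qed

lemma network_delay_scaled:
  obtains p where "source_sink_path G p"
    "network_delay G d D \<C> * k = of_nat (sum_list (map (delay_of m M (intra \<C>)) p))"
    "\<And>q. source_sink_path G q \<Longrightarrow> sum_list (map (delay_of m M (intra \<C>)) q) \<le> sum_list (map (delay_of m M (intra \<C>)) p)"
proof -
  let ?S = "{path_delay d D \<C> p |p. source_sink_path G p}"
  have fin: "finite ?S" "?S \<noteq> {}"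
    using finite_source_sink ex_source_sink by auto
  from Max_in[OF this] obtain p where p: "source_sink_path G p" "network_delay G d D \<C> = path_delay d D \<C> p"
    unfolding network_delay_def by auto
  have "sum_list (map (delay_of m M (intra \<C>)) q) \<le> sum_list (map (delay_of m M (intra \<C>)) p)"
    if "source_sink_path G q" for q
  proof -
    have "path_delay d D \<C> q \<le> path_delay d D \<C> p"
      unfolding p(2)[symmetric] network_delay_def using fin(1) that by (intro Max_ge) auto
    then have "path_delay d D \<C> q * k \<le> path_delay d D \<C> p * k"
      using k(1) by (intro mult_right_mono) auto
    then show ?thesis
      by (simp only: path_delay_scaled p(1) that of_nat_le_iff)
  qed
  with p show thesis
    by (intro that[of p]) (simp_all add: path_delay_scaled)
qed

lemma network_delay_le_iff:
  "network_delay G d D \<C> * k \<le> of_nat T \<longleftrightarrow> feasible (set as) (delay_of m M (intra \<C>)) T"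
proof -
  obtain p where p: "source_sink_path G p"
    "network_delay G d D \<C> * k = of_nat (sum_list (map (delay_of m M (intra \<C>)) p))"
    "\<And>q. source_sink_path G q \<Longrightarrow> sum_list (map (delay_of m M (intra \<C>)) q) \<le> sum_list (map (delay_of m M (intra \<C>)) p)"
    by (rule network_delay_scaled[of \<C>]) blast
  have "feasible (set as) (delay_of m M (intra \<C>)) T \<longleftrightarrow> sum_list (map (delay_of m M (intra \<C>)) p) \<le> T"
  proof
    assume "feasible (set as) (delay_of m M (intra \<C>)) T"
    moreover obtain u v where "awalk u p v"
      using p(1) by (auto simp: source_sink_path_def apath_def)
    ultimately show "sum_list (map (delay_of m M (intra \<C>)) p) \<le> T"
      using awalk_reach unfolding feasible_def by blast
  next
    assume le: "sum_list (map (delay_of m M (intra \<C>)) p) \<le> T"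
    show "feasible (set as) (delay_of m M (intra \<C>)) T"
      unfolding feasible_def
    proof (intro allI impI)
      fix u x v assume r: "reach (set as) (delay_of m M (intra \<C>)) u x v"
      show "x \<le> T"
      proof (cases "u \<in> set vs")
        case True
        from source_sink_extension[OF r this] p(3) le show ?thesis
          by (meson order_trans)
      next
        case False
        with reach_Field[OF r] Field_arcs show ?thesis
          by auto
      qed
    qed
  qed
  then show ?thesis
    by (simp add: p(2))
qed

text \<open>On a critical path \<open>i\<close> counts the arcs inside clusters and \<open>j\<close>
  the others. The path repeats no arc, hence the bounds.\<close>

lemma network_delay_candidate:
  "\<exists>i j. i \<le> length as \<and> j \<le> length as \<and> network_delay G d D \<C> * k = of_nat (i * m + j * M)"
proof -
  obtain p where p: "source_sink_path G p"
    "network_delay G d D \<C> * k = of_nat (sum_list (map (delay_of m M (intra \<C>)) p))"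
    by (rule network_delay_scaled[of \<C>]) blast
  have "sum_list (map (delay_of m M N) q) =
    length (filter (\<lambda>e. e \<in> N) q) * m + length (filter (\<lambda>e. e \<notin> N) q) * M" for N and q :: "(nat \<times> nat) list"
    by (induction q) (auto simp: delay_of_def algebra_simps)
  moreover have "length p \<le> length as"
    using source_sink_arcs[OF p(1)] distinct_lists(2) by (metis List.finite_set card_mono distinct_card)
  then have "length (filter (\<lambda>e. e \<in> intra \<C>) p) \<le> length as" "length (filter (\<lambda>e. e \<notin> intra \<C>) p) \<le> length as"
    by (meson length_filter_le order_trans)+
  ultimately show ?thesis
    using p(2) by metis
qed

end

text \<open>Here the capacity 2 enters: two arcs inside clusters that share a vertex lie in the same
  cluster and both exhaust it. If distinct they are antiparallel, which acyclicity excludes.\<close>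

lemma matching_intra:
  assumes "clustering 2 G \<C>"
  shows "matching (intra \<C>)"
  unfolding matching_def
proof (intro ballI impI)
  fix e f assume e: "e \<in> intra \<C>" and f: "f \<in> intra \<C>" and "e \<noteq> f"
  obtain C where C: "C \<in> \<C>" "fst e \<in> C" "snd e \<in> C" "e \<in> set as"
    using e by (auto simp: intra_def)
  obtain K where K: "K \<in> \<C>" "fst f \<in> K" "snd f \<in> K" "f \<in> set as"
    using f by (auto simp: intra_def)
  have part: "partition_on (set vs) \<C>" "\<forall>C \<in> \<C>. card C \<le> 2"
    using assms by (simp_all add: clustering_def)
  show "{fst e, snd e} \<inter> {fst f, snd f} = {}"
  proof (rule ccontr)
    assume "{fst e, snd e} \<inter> {fst f, snd f} \<noteq> {}"
    then have "C \<inter> K \<noteq> {}"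
      using C K by auto
    then have "C = K"
      using part(1) C(1) K(1) by (auto simp: partition_on_def disjoint_def)
    have "finite C"
      using part(1) C(1) by (intro finite_subset[of C "set vs"]) (auto simp: partition_on_def)
    have "{fst e, snd e} = C"
      using C \<open>finite C\<close> part(2) loopfree[OF C(4)] by (intro card_seteq) auto
    moreover have "{fst f, snd f} = C"
      using K \<open>finite C\<close> part(2) loopfree[OF K(4)] \<open>C = K\<close> by (intro card_seteq) auto
    ultimately have "fst e = snd f" "snd e = fst f"
      using \<open>e \<noteq> f\<close> by (auto simp: doubleton_eq_iff prod_eq_iff)
    then show False
      using asymmetric[of "fst e" "snd e"] C(4) K(4) by (cases e; cases f) simp
  qed
qed

text \<open>No arcs become cheap by accident: a singleton contains no arc, as there are no loops,
  and a pair contains only its own, as there are no antiparallel arcs.\<close>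

lemma clusters_of:
  assumes "pairing (set as) ps"
  shows "distinct (concat (clusters_of vs ps))" "clustering 2 G (set (map set (clusters_of vs ps)))"
    "intra (set (map set (clusters_of vs ps))) = arcs_of ps"
proof -
  have rest: "filter (\<lambda>w. w = v) (concat ps) = [] \<longleftrightarrow> v \<notin> set (concat ps)" for v
    unfolding filter_empty_conv by blast
  have sing: "concat (map (\<lambda>v. [v]) ws) = ws" for ws :: "nat list"
    by (induction ws) auto
  have concat: "concat (clusters_of vs ps) = concat ps @ filter (\<lambda>v. v \<notin> set (concat ps)) vs"
    by (simp only: clusters_of_def concat_append sing rest)
  show dist: "distinct (concat (clusters_of vs ps))"
    unfolding concat using assms distinct_lists(1) by (auto simp: pairing_def)
  have "set (concat ps) \<subseteq> set vs"
    using pairing_Field[OF assms] Field_arcs by blast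
  then have set: "set (concat (clusters_of vs ps)) = set vs"
    unfolding concat by auto
  have ne: "[] \<notin> set (clusters_of vs ps)"
    using assms by (auto simp: clusters_of_def pairing_def)
  have disj: "set l \<inter> set l' = {}" if "l \<in> set (clusters_of vs ps)" "l' \<in> set (clusters_of vs ps)" "set l \<noteq> set l'" for l l'
  proof -
    have "l \<noteq> l'"
      using that(3) by auto
    with that(1,2) show ?thesis
      using dist unfolding distinct_concat_iff by blast
  qed
  have "partition_on (set vs) (set (map set (clusters_of vs ps)))"
  proof (rule partition_onI)
    show "\<Union> (set (map set (clusters_of vs ps))) = set vs"
      using set by simp
    show "disjnt p q" if "p \<in> set (map set (clusters_of vs ps))" "q \<in> set (map set (clusters_of vs ps))" "p \<noteq> q" for p q
      using that disj by (auto simp: disjnt_def)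
    show "{} \<notin> set (map set (clusters_of vs ps))"
      using ne by auto
  qed
  moreover have "card (set l) \<le> 2" if "l \<in> set (clusters_of vs ps)" for l
  proof -
    have "length l \<le> 2"
      using that assms by (auto simp: clusters_of_def pairing_def)
    then show ?thesis
      using card_length[of l] by linarith
  qed
  ultimately show "clustering 2 G (set (map set (clusters_of vs ps)))"
    by (auto simp: clustering_def)
  show "intra (set (map set (clusters_of vs ps))) = arcs_of ps"
  proof
    show "arcs_of ps \<subseteq> intra (set (map set (clusters_of vs ps)))"
    proof
      fix e assume e: "e \<in> arcs_of ps"
      then have "e \<in> set as" "[fst e, snd e] \<in> set (clusters_of vs ps)"
        using pairing_arcs_of[OF assms] by (auto simp: arcs_of_def clusters_of_def)
      then have "e \<in> set as" "set [fst e, snd e] \<in> set (map set (clusters_of vs ps))"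
        by (simp_all only: set_map image_eqI)
      then show "e \<in> intra (set (map set (clusters_of vs ps)))"
        unfolding intra_def by (intro CollectI conjI bexI[of _ "set [fst e, snd e]"]) simp_all
    qed
    show "intra (set (map set (clusters_of vs ps))) \<subseteq> arcs_of ps"
    proof
      fix e assume "e \<in> intra (set (map set (clusters_of vs ps)))"
      then obtain l where l: "l \<in> set (clusters_of vs ps)" "fst e \<in> set l" "snd e \<in> set l" "e \<in> set as"
        by (auto simp: intra_def)
      have "l \<in> set ps"
        using l loopfree[OF l(4)] by (auto simp: clusters_of_def)
      then obtain u v where uv: "l = [u, v]" "(u, v) \<in> set as"
        using assms unfolding pairing_def by blast
      then have "e = (u, v)"
        using l loopfree[OF l(4)] asymmetric[OF uv(2)] by (cases e) auto
      with \<open>l \<in> set ps\<close> uv show "e \<in> arcs_of ps"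
        by (simp add: arcs_of_def)
    qed
  qed
qed

end


section \<open>The theorem\<close>

text \<open>After scaling, the delay of each clustering is itself one of the candidates
  \<open>i * m + j * M\<close>, so the least candidate for which \<open>collect\<close> succeeds is
  the optimum.\<close>

definition solutions :: "nat list \<Rightarrow> (nat \<times> nat) list \<Rightarrow> nat \<Rightarrow> nat \<Rightarrow> (nat \<times> nat list list) list" where
  "solutions vs as m M = best (concat (map (\<lambda>T. collect T vs (table T m M (elim_list as)))
     (concat (map (\<lambda>i. map (\<lambda>j. i * m + j * M) (count_down as)) (count_down as)))))"

text \<open>The delays are multiplied by the product of their denominators.\<close>

definition solve :: "cluster_instance \<Rightarrow> nat list list" where
  "solve x = (case solutions (fst x) (fst (snd x))
       (nat (fst (quotient_of (fst (snd (snd x))))) * nat (snd (quotient_of (snd (snd (snd x))))))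
       (nat (fst (quotient_of (snd (snd (snd x))))) * nat (snd (quotient_of (fst (snd (snd x))))))
     of [] \<Rightarrow> [] | r # _ \<Rightarrow> clusters_of (fst x) (snd r))"

lemma poly_time_solutions:
  assumes "poly_time A vs" "poly_time A as" "poly_time A m" "poly_time A M"
    and "\<And>x. A x \<Longrightarrow> elimination (elim_list (as x))"
  shows "poly_time A (\<lambda>x. solutions (vs x) (as x) (m x) (M x))"
proof -
  have "poly_time (\<lambda>p. elimination (elim_list (fst (snd p))))
     (\<lambda>p. solutions (fst p) (fst (snd p)) (fst (snd (snd p))) (snd (snd (snd p))))"
    unfolding solutions_def by (intro pt_intros poly_time_table)
  from poly_time_comp[OF this, where f = "\<lambda>x. (vs x, as x, m x, M x)" and A = A] show ?thesis
    using assms by (simp add: poly_time_Pair)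
qed

lemma poly_time_clusters_of [pt_intros]:
  "poly_time A vs \<Longrightarrow> poly_time A ps \<Longrightarrow> poly_time A (\<lambda>x. clusters_of (vs x) (ps x))"
  by (rule poly_time_comp2[of clusters_of]) (unfold clusters_of_def, (intro pt_intros)+)

lemma tree_digraph_instance: "tree_instance x \<Longrightarrow> tree_digraph (fst x) (fst (snd x))"
  by (cases x) (auto simp: tree_digraph_def)

lemma (in tree_digraph) elim_list:
  "elimination (elim_list as)" "snd ` set (elim_list as) = set as"
  using elim_list_correct[OF leafy_arcs distinct_lists(2) loopfree] by auto

lemma poly_time_solve: "poly_time tree_instance solve"
  unfolding solve_def
  by (intro pt_intros poly_time_solutions tree_digraph.elim_list(1)[OF tree_digraph_instance])

lemma rat_scaled:
  assumes "0 \<le> r"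
  shows "r * of_nat (nat (snd (quotient_of r))) = of_nat (nat (fst (quotient_of r)))"
    "0 < nat (snd (quotient_of r))"
proof -
  obtain a b where ab: "quotient_of r = (a, b)"
    by (cases "quotient_of r")
  then have b: "0 < b"
    by (rule quotient_of_denom_pos)
  have r: "r = of_int a / of_int b"
    using ab by (rule quotient_of_div)
  with assms b have "0 \<le> a"
    by (simp add: zero_le_divide_iff)
  moreover have "r * of_int b = of_int a"
    using r b by simp
  ultimately show "r * of_nat (nat (snd (quotient_of r))) = of_nat (nat (fst (quotient_of r)))"
    "0 < nat (snd (quotient_of r))"
    using b by (simp_all only: ab fst_conv snd_conv of_nat_nat less_imp_le zero_less_nat_eq)
qed

lemma in_set_concat_map: "x \<in> set xs \<Longrightarrow> y \<in> set (f x) \<Longrightarrow> y \<in> set (concat (map f xs))"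
  by auto

text \<open>Completeness is applied to the scaled delay of an arbitrary clustering as the bound, so
  the selected bound is at most that delay. By soundness the returned clustering stays within the
  selected bound.\<close>

lemma (in tree_digraph) solutions_optimal:
  assumes k: "0 < k" "d * k = of_nat m" "D * k = of_nat M"
  shows "\<exists>r rs. solutions vs as m M = r # rs \<and> distinct (concat (clusters_of vs (snd r))) \<and>
    optimal_clustering 2 G d D (set (map set (clusters_of vs (snd r))))"
proof -
  let ?sols = "concat (map (\<lambda>T. collect T vs (table T m M (elim_list as)))
     (concat (map (\<lambda>i. map (\<lambda>j. i * m + j * M) (count_down as)) (count_down as))))"
  have candidate: "\<exists>ps T. (T, ps) \<in> set ?sols \<and> of_nat T = network_delay G d D \<C> * k"
    if C: "clustering 2 G \<C>" for \<C>
  proof -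
    obtain i j where ij: "i \<le> length as" "j \<le> length as"
      "network_delay G d D \<C> * k = of_nat (i * m + j * M)"
      using network_delay_candidate[OF k, of \<C>] by blast
    let ?T = "i * m + j * M"
    have "feasible (set as) (delay_of m M (intra \<C>)) ?T"
      unfolding network_delay_le_iff[OF k, symmetric] ij(3) by (rule order_refl)
    then have "collect ?T vs (table ?T m M (elim_list as)) \<noteq> []"
      using matching_intra[OF C]
      by (intro collect_complete[where N = "intra \<C>"]) (auto simp: elim_list intra_def)
    then obtain T' ps where T': "(T', ps) \<in> set (collect ?T vs (table ?T m M (elim_list as)))"
      by (cases "collect ?T vs (table ?T m M (elim_list as))") auto
    then have "T' = ?T"
      using collect_sound(1)[of "elim_list as" vs T' ps ?T m M]
      by (simp add: elim_list acyclic_arcs Field_arcs distinct_lists)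
    have "i \<in> set (count_down as)" "j \<in> set (count_down as)"
      using ij by (auto simp: count_down_eq)
    then have "?T \<in> set (map (\<lambda>j. i * m + j * M) (count_down as))"
      unfolding set_map by (intro image_eqI[where f = "\<lambda>j. i * m + j * M" and x = j] refl)
    with \<open>i \<in> set (count_down as)\<close>
    have "?T \<in> set (concat (map (\<lambda>i. map (\<lambda>j. i * m + j * M) (count_down as)) (count_down as)))"
      by (intro in_set_concat_map[where f = "\<lambda>i. map (\<lambda>j. i * m + j * M) (count_down as)" and x = i])
    then have "(T', ps) \<in> set ?sols"
      using T' by (rule in_set_concat_map[where f = "\<lambda>T. collect T vs (table T m M (elim_list as))" and x = ?T])
    then show ?thesis
      unfolding \<open>T' = ?T\<close> ij(3) by (intro exI conjI) (assumption, rule refl)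
  qed
  \<comment> \<open>The clustering into singletons guarantees that at least one candidate
    succeeds.\<close>
  have "clustering 2 G ((\<lambda>v. {v}) ` set vs)"
    by (auto simp: clustering_def partition_on_def disjoint_def)
  from candidate[OF this] have "?sols \<noteq> []"
    by (elim exE conjE) (rule notI, simp only: list.set empty_iff)
  then obtain r where r: "solutions vs as m M = [r]" "r \<in> set ?sols" "\<And>p. p \<in> set ?sols \<Longrightarrow> fst r \<le> fst p"
    unfolding solutions_def by (cases rule: best_cases[of ?sols]) auto
  obtain T ps where Tps: "r = (T, ps)"
    by (cases r)
  from r(2) obtain T0 where "r \<in> set (collect T0 vs (table T0 m M (elim_list as)))"
    by auto
  then have ps: "pairing (set as) ps" "feasible (set as) (delay_of m M (arcs_of ps)) T"
    using collect_sound[of "elim_list as" vs T ps T0 m M]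
    by (auto simp: Tps elim_list acyclic_arcs Field_arcs distinct_lists)
  note clusters = clusters_of[OF ps(1)]
  have le: "network_delay G d D (set (map set (clusters_of vs ps))) \<le> network_delay G d D \<C>"
    if C: "clustering 2 G \<C>" for \<C>
  proof -
    obtain T' ps' where T': "(T', ps') \<in> set ?sols" "of_nat T' = network_delay G d D \<C> * k"
      using candidate[OF C] by blast
    have "network_delay G d D (set (map set (clusters_of vs ps))) * k \<le> of_nat T"
      unfolding network_delay_le_iff[OF k] clusters(3) by (rule ps(2))
    also have "of_nat T \<le> (of_nat T' :: rat)"
      using r(3)[OF T'(1)] by (simp add: Tps)
    also note T'(2)
    finally show ?thesis
      using k(1) by simp
  qed
  show ?thesis
    using r(1) clusters(1,2) le by (simp add: Tps optimal_clustering_def)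
qed

lemma solve_correct:
  assumes "tree_instance x"
  shows "solves_clustering 2 x (solve x)"
proof -
  obtain vs as d D where x: "x = (vs, as, d, D)"
    by (metis prod_cases4)
  interpret tree_digraph vs as
    using tree_digraph_instance[OF assms] by (simp add: x)
  have "0 \<le> d" "0 \<le> D"
    using assms by (auto simp: x)
  note d = rat_scaled[OF this(1)] and D = rat_scaled[OF this(2)]
  define k :: rat where "k = of_nat (nat (snd (quotient_of d)) * nat (snd (quotient_of D)))"
  have "0 < k"
    using d(2) D(2) by (simp add: k_def)
  moreover have "d * k = of_nat (nat (fst (quotient_of d)) * nat (snd (quotient_of D)))"
    using d(1) by (simp add: k_def mult.assoc[symmetric] del: of_nat_nat)
  moreover have "D * k = of_nat (nat (fst (quotient_of D)) * nat (snd (quotient_of d)))"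
    using D(1) by (simp add: k_def mult.assoc[symmetric] mult.commute del: of_nat_nat)
  ultimately obtain r rs where
    "solutions vs as (nat (fst (quotient_of d)) * nat (snd (quotient_of D)))
      (nat (fst (quotient_of D)) * nat (snd (quotient_of d))) = r # rs"
    "distinct (concat (clusters_of vs (snd r)))"
    "optimal_clustering 2 G d D (set (map set (clusters_of vs (snd r))))"
    using solutions_optimal by blast
  then show ?thesis
    by (simp add: x solve_def)
qed

lemma code_eq_enc: "(code :: cluster_instance \<Rightarrow> btree) = enc_instance"
  "(code :: nat list list \<Rightarrow> btree) = enc_clusters"
  by (simp_all add: enc_instance_def enc_clusters_def code_prod_def[abs_def] code_list_def[abs_def]
    code_nat_def[abs_def] code_rat_def[abs_def])

theorem theorem5:
  shows "poly_time_solvable enc_instance enc_clusters tree_instance (solves_clustering 2)"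
proof -
  obtain P T where T: "poly_bounded tree_instance T"
    "\<And>x. tree_instance x \<Longrightarrow> \<exists>t \<le> T x. runs P (code x) (code (solve x)) t"
    using poly_time_solve by (rule poly_timeE) blast
  obtain k where k: "\<And>x. tree_instance x \<Longrightarrow> T x \<le> (csize x + 2) ^ k"
    using T(1) unfolding poly_bounded_def by blast
  show ?thesis
    unfolding poly_time_solvable_def
  \<comment> \<open>\<open>[:2, 1:]\<close> is the polynomial \<open>X + 2\<close>, the base used in
    \<open>poly_bounded\<close>.\<close>
  proof (intro exI[of _ P] exI[of _ "[:2, 1:] ^ k"] allI impI)
    fix x assume x: "tree_instance x"
    then obtain t where t: "t \<le> T x" "runs P (code x) (code (solve x)) t"
      using T(2) by blast
    have "t \<le> poly ([:2, 1:] ^ k) (size (enc_instance x))"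
      using t(1) k[OF x] by (simp add: code_eq_enc(1)[symmetric] poly_power add.commute)
    then show "\<exists>y t. runs P (enc_instance x) (enc_clusters y) t \<and>
        t \<le> poly ([:2, 1:] ^ k) (size (enc_instance x)) \<and> solves_clustering 2 x y"
      using t(2) solve_correct[OF x] unfolding code_eq_enc by blast
  qed
qed

end
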